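(* Let $\Phi$ be a commutative associative ring with $1$, let $R$ and $S$ be associative unital $\Phi$-algebras, and let $n\ge 3$. Suppose that $$\varphi\colon T(R)^{(-)}/(\Phi\cdot I_R)\to T(S)^{(-)}/(\Phi\cdot I_S)$$ is an isomorphism of Lie algebras. Then there exist an idempotent $h\in\Phi$, an isomorphism $\psi_1\colon hR\to hS$, an antiisomorphism $\psi_2\colon(1-h)R\to(1-h)S$, and invertible elements $g_1\in UT(n,S)$ and $g_2\in\operatorname{Diag}(S^* )$ such that $\varphi$ lifts to $\widehat g_1\,\widehat g_2\,(\widetilde\psi_1-\widetilde\psi_2)$; that is, for all $x\in T(R)$, $$\varphi(x+\Phi\cdot I_R)=\widehat g_1\Bigl(\widehat g_2\bigl(\widetilde\psi_1(hx)-\widetilde\psi_2((1-h)x)\bigr)\Bigr)+\Phi\cdot I_S .$$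
   Context: All algebras are over $\Phi$ and all maps are $\Phi$-linear. The algebras $R$ and $S$ are arbitrary associative unital $\Phi$-algebras, not necessarily commutative, with identity elements $1_R$ and $1_S$. $T(R)$ is the associative $\Phi$-algebra of upper triangular $n\times n$ matrices with diagonal entries in $\Phi$ and entries strictly above the diagonal in $R$ (scalars from $\Phi$ multiply elements of $R$ through the $\Phi$-algebra structure). $I_R$ is the identity $n\times n$ matrix in $T(R)$. $T(R)^{(-)}$ is the Lie algebra on $T(R)$ with bracket $[x,y]=xy-yx$, and $\Phi\cdot I_R$ is a central ideal of it. $T(S)$, $I_S$ and $T(S)^{(-)}$ are defined likewise. $e_{ij}(a)$ is the $n\times n$ matrix with $(i,j)$-entry $a$ and all other entries zero. For an idempotent $h\in\Phi$ (possibly $0$ or $1$), $hT(R)$ is the ideal of $T(R)$ of matrices with diagonal entries in $h\Phi$ and strictly upper entries in $hR$, and $T(R)=hT(R)\oplus(1-h)T(R)$. An antiisomorphism is a bijective $\Phi$-linear map $\chi$ with $\chi(xy)=\chi(y)\chi(x)$. An isomorphism $\psi\colon hR\to hS$ induces the isomorphism $\widetilde\psi\colon hT(R)\to hT(S)$ that applies $\psi$ to each entry, $(a_{ij})\mapsto(\psi(a_{ij}))$. An antiisomorphism $\psi\colon hR\to hS$ induces the antiisomorphism $\widetilde\psi\colon hT(R)\to hT(S)$, $e_{ij}(a)\mapsto e_{n+1-j,\,n+1-i}(\psi(a))$. In both cases scalars from $h\Phi$ on the diagonal are left unchanged by $\psi$. $UT(n,S)$ is the group of upper triangular $n\times n$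 matrices with all diagonal entries $1_S$ and arbitrary entries from $S$ above the diagonal. $S^*$ is the group of invertible elements of $S$, and $\operatorname{Diag}(S^* )=\{\operatorname{diag}(u_1,\dots,u_n)\mid u_i\in S^*\}$. For $g$ in either group, $\widehat g$ is the automorphism $x\mapsto gxg^{-1}$ of $T(S)$.
   Formalization: The formal theorem also assumes that c ↦ c·1_R and c ↦ c·1_S are injective on Φ; without this the claim fails, e.g. Φ = ℤ, R = S = ℤ/2, n = 3, with (a₁,a₂) ↦ (a₁+2a₂,a₂) on differences of consecutive diagonal entries and the identity above the diagonal. *)

theory Defs
  imports "Jordan_Normal_Form.Matrix"
begin

text \<open>
  Sorts: \<open>{comm_ring, comm_monoid_mult}\<close> is a commutative ring with 1 and \<open>{ring, monoid_mult}\<close>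
  an associative ring with 1.  In contrast to \<^class>\<open>comm_ring_1\<close> and \<^class>\<open>ring_1\<close> they do not
  impose \<open>0 \<noteq> 1\<close>.
\<close>

locale unital_algebra =
  fixes sc :: "'f::{comm_ring, comm_monoid_mult} \<Rightarrow> 'r::{ring, monoid_mult} \<Rightarrow> 'r"
  assumes sc_add_right: "sc a (x + y) = sc a x + sc a y"
    and sc_add_left: "sc (a + b) x = sc a x + sc b x"
    and sc_sc: "sc a (sc b x) = sc (a * b) x"
    and sc_one: "sc 1 x = x"
    and sc_mult_left: "sc a (x * y) = sc a x * y"
    and sc_mult_right: "sc a (x * y) = x * sc a y"


subsection \<open>Lie algebras, quotients and isomorphisms\<close>

record ('f, 'v) lie =
  lcarrier :: "'v set"
  ladd :: "'v \<Rightarrow> 'v \<Rightarrow> 'v"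
  lscale :: "'f \<Rightarrow> 'v \<Rightarrow> 'v"
  lbracket :: "'v \<Rightarrow> 'v \<Rightarrow> 'v"

definition lcoset :: "('f, 'v) lie \<Rightarrow> 'v set \<Rightarrow> 'v \<Rightarrow> 'v set" where
  "lcoset L I x = ladd L x ` I"

text \<open>As in the quotient rings of HOL-Algebra, the operations on cosets are defined without
  choosing representatives.\<close>

definition lquot :: "('f, 'v) lie \<Rightarrow> 'v set \<Rightarrow> ('f, 'v set) lie" where
  "lquot L I = \<lparr>
     lcarrier = lcoset L I ` lcarrier L,
     ladd = (\<lambda>A B. \<Union>a\<in>A. \<Union>b\<in>B. lcoset L I (ladd L a b)),
     lscale = (\<lambda>c A. \<Union>a\<in>A. lcoset L I (lscale L c a)),
     lbracket = (\<lambda>A B. \<Union>a\<in>A. \<Union>b\<in>B. lcoset L I (lbracket L a b)) \<rparr>"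

definition lie_iso :: "('f, 'v) lie \<Rightarrow> ('f, 'w) lie \<Rightarrow> ('v \<Rightarrow> 'w) \<Rightarrow> bool" where
  "lie_iso L M \<phi> \<longleftrightarrow>
     bij_betw \<phi> (lcarrier L) (lcarrier M) \<and>
     (\<forall>x\<in>lcarrier L. \<forall>y\<in>lcarrier L. \<phi> (ladd L x y) = ladd M (\<phi> x) (\<phi> y)) \<and>
     (\<forall>c. \<forall>x\<in>lcarrier L. \<phi> (lscale L c x) = lscale M c (\<phi> x)) \<and>
     (\<forall>x\<in>lcarrier L. \<forall>y\<in>lcarrier L. \<phi> (lbracket L x y) = lbracket M (\<phi> x) (\<phi> y))"


subsection \<open>The algebra \<open>T(R)\<close>\<close>

text \<open>
  An element of \<open>T(R)\<close> is a pair: its diagonal, with entries in \<open>\<Phi>\<close>, and its strictly upper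
  triangular part, with entries in \<open>R\<close>.  Rows and columns are numbered from \<open>0\<close> to \<open>n - 1\<close>.
  These are matrices over \<open>R\<close>, with \<open>\<Phi>\<close> identified with \<open>\<Phi>\<cdot>1\<close>, provided that \<open>c \<mapsto> c\<cdot>1\<close> is
  injective; this is a standing assumption.
\<close>

type_synonym ('f, 'r) tri = "'f vec \<times> 'r mat"

definition tri :: "nat \<Rightarrow> ('f, 'r::zero) tri set" where
  "tri n = {(d, U). d \<in> carrier_vec n \<and> U \<in> carrier_mat n n \<and>
                    (\<forall>i<n. \<forall>j\<le>i. U $$ (i, j) = 0)}"

definition tri_add :: "('f::plus, 'r::plus) tri \<Rightarrow> ('f, 'r) tri \<Rightarrow> ('f, 'r) tri" where
  "tri_add x y = (fst x + fst y, snd x + snd y)"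

definition tri_diff :: "('f::minus, 'r::minus) tri \<Rightarrow> ('f, 'r) tri \<Rightarrow> ('f, 'r) tri" where
  "tri_diff x y = (fst x - fst y, snd x - snd y)"

definition tri_scale :: "('f::times \<Rightarrow> 'r \<Rightarrow> 'r) \<Rightarrow> 'f \<Rightarrow> ('f, 'r) tri \<Rightarrow> ('f, 'r) tri" where
  "tri_scale sc c x = (c \<cdot>\<^sub>v fst x, map_mat (sc c) (snd x))"

text \<open>Matrix multiplication; the products of a diagonal entry with an entry above the diagonal are
  formed by means of the \<open>\<Phi>\<close>-algebra structure (see \<open>tri_embed_mult\<close> below).\<close>

definition tri_mult ::
  "nat \<Rightarrow> ('f::times \<Rightarrow> 'r::semiring_0 \<Rightarrow> 'r) \<Rightarrow> ('f, 'r) tri \<Rightarrow> ('f, 'r) tri \<Rightarrow> ('f, 'r) tri" where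
  "tri_mult n sc x y =
     (vec n (\<lambda>i. fst x $ i * fst y $ i),
      mat n n (\<lambda>(i, j). sc (fst x $ i) (snd y $$ (i, j)) + (snd x * snd y) $$ (i, j)
                          + sc (fst y $ j) (snd x $$ (i, j))))"

definition tri_bracket ::
  "nat \<Rightarrow> ('f::{times, minus} \<Rightarrow> 'r::ring \<Rightarrow> 'r) \<Rightarrow> ('f, 'r) tri \<Rightarrow> ('f, 'r) tri \<Rightarrow> ('f, 'r) tri" where
  "tri_bracket n sc x y = tri_diff (tri_mult n sc x y) (tri_mult n sc y x)"

definition tri_lie ::
  "nat \<Rightarrow> ('f::comm_ring \<Rightarrow> 'r::ring \<Rightarrow> 'r) \<Rightarrow> ('f, ('f, 'r) tri) lie" where
  "tri_lie n sc = \<lparr> lcarrier = tri n, ladd = tri_add, lscale = tri_scale sc,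
                    lbracket = tri_bracket n sc \<rparr>"

definition tri_scalars :: "nat \<Rightarrow> ('f, 'r::zero) tri set" where
  "tri_scalars n = {(vec n (\<lambda>_. c), 0\<^sub>m n n) | c. True}"

abbreviation tri_coset ::
  "nat \<Rightarrow> ('f::comm_ring \<Rightarrow> 'r::ring \<Rightarrow> 'r) \<Rightarrow> ('f, 'r) tri \<Rightarrow> ('f, 'r) tri set" where
  "tri_coset n sc \<equiv> lcoset (tri_lie n sc) (tri_scalars n)"

abbreviation tri_lie_quot ::
  "nat \<Rightarrow> ('f::comm_ring \<Rightarrow> 'r::ring \<Rightarrow> 'r) \<Rightarrow> ('f, ('f, 'r) tri set) lie" where
  "tri_lie_quot n sc \<equiv> lquot (tri_lie n sc) (tri_scalars n)"

text \<open>\<open>T(R)\<close> inside the full matrix ring over \<open>R\<close>.\<close>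

definition tri_embed ::
  "nat \<Rightarrow> ('f \<Rightarrow> 'r::{zero, one} \<Rightarrow> 'r) \<Rightarrow> ('f, 'r) tri \<Rightarrow> 'r mat" where
  "tri_embed n sc x = mat n n (\<lambda>(i, j). if i = j then sc (fst x $ i) 1 else snd x $$ (i, j))"


lemma (in unital_algebra) sc_0_right [simp]: "sc a 0 = 0"
  using sc_add_right[of a 0 0] by simp

lemma tri_embed_index:
  "i < n \<Longrightarrow> j < n \<Longrightarrow>
    tri_embed n sc x $$ (i, j) = (if i = j then sc (fst x $ i) 1 else snd x $$ (i, j))"
  by (simp add: tri_embed_def)

lemma (in unital_algebra) tri_embed_mult:
  assumes "x \<in> tri n" "y \<in> tri n"
  shows "tri_embed n sc (tri_mult n sc x y) = tri_embed n sc x * tri_embed n sc y"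
proof -
  obtain d U where x: "x = (d, U)" by force
  obtain e V where y: "y = (e, V)" by force
  have U: "U \<in> carrier_mat n n" "\<And>i j. i < n \<Longrightarrow> j \<le> i \<Longrightarrow> U $$ (i, j) = 0"
    and V: "V \<in> carrier_mat n n" "\<And>i j. i < n \<Longrightarrow> j \<le> i \<Longrightarrow> V $$ (i, j) = 0"
    using assms unfolding x y tri_def by auto
  have UV: "(U * V) $$ (i, j) = (\<Sum>k<n. U $$ (i, k) * V $$ (k, j))" if "i < n" "j < n" for i j
    using that U(1) V(1) by (simp add: scalar_prod_def lessThan_atLeast0)
  have UV0: "(U * V) $$ (i, i) = 0" if "i < n" for i
    unfolding UV[OF that that] using that U(2) V(2)
    by (intro sum.neutral) (metis lessThan_iff linear mult_zero_left mult_zero_right)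
  show ?thesis
  proof (rule eq_matI)
    fix i j
    assume "i < dim_row (tri_embed n sc x * tri_embed n sc y)"
      and "j < dim_col (tri_embed n sc x * tri_embed n sc y)"
    then have ij: "i < n" "j < n" by (simp_all add: tri_embed_def)
    let ?D = "\<lambda>i k. if i = k then sc (d $ i) 1 else 0"
    let ?E = "\<lambda>k j. if k = j then sc (e $ j) 1 else 0"
    have "(tri_embed n sc x * tri_embed n sc y) $$ (i, j) =
        (\<Sum>k<n. (?D i k + U $$ (i, k)) * (?E k j + V $$ (k, j)))"
      using ij U V by (auto simp: tri_embed_def scalar_prod_def lessThan_atLeast0 x y intro!: sum.cong)
    also have "\<dots> = (\<Sum>k<n. ?D i k * ?E k j) + (\<Sum>k<n. ?D i k * V $$ (k, j))
        + (\<Sum>k<n. U $$ (i, k) * ?E k j) + (\<Sum>k<n. U $$ (i, k) * V $$ (k, j))"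
      by (simp add: algebra_simps sum.distrib)
    also have "(\<Sum>k<n. ?D i k * ?E k j) = (if i = j then sc (d $ i * e $ i) 1 else 0)"
      using ij by (auto simp: if_distrib[of "\<lambda>t. t * _"] sc_sc simp flip: sc_mult_left cong: if_cong)
    also have "(\<Sum>k<n. ?D i k * V $$ (k, j)) = sc (d $ i) (V $$ (i, j))"
      using ij by (simp add: if_distrib[of "\<lambda>t. t * _"] flip: sc_mult_left cong: if_cong)
    also have "(\<Sum>k<n. U $$ (i, k) * ?E k j) = sc (e $ j) (U $$ (i, j))"
      using ij by (simp add: if_distrib[of "\<lambda>t. _ * t"] flip: sc_mult_right cong: if_cong)
    finally show "tri_embed n sc (tri_mult n sc x y) $$ (i, j)
        = (tri_embed n sc x * tri_embed n sc y) $$ (i, j)"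
      using ij U(2) V(2) UV0[of i] UV[of i j]
      by (auto simp: tri_embed_index tri_mult_def x y
            simp del: index_mult_mat(1))
  qed (auto simp: tri_embed_def)
qed


subsection \<open>(Anti)isomorphisms \<open>hR \<rightarrow> hS\<close> and the induced maps\<close>

definition alg_iso_on ::
  "('f \<Rightarrow> 'r::ring \<Rightarrow> 'r) \<Rightarrow> ('f \<Rightarrow> 's::ring \<Rightarrow> 's) \<Rightarrow> 'f \<Rightarrow> ('r \<Rightarrow> 's) \<Rightarrow> bool" where
  "alg_iso_on sR sS h \<psi> \<longleftrightarrow>
     bij_betw \<psi> (range (sR h)) (range (sS h)) \<and>
     (\<forall>x\<in>range (sR h). \<forall>y\<in>range (sR h). \<psi> (x + y) = \<psi> x + \<psi> y) \<and>
     (\<forall>c. \<forall>x\<in>range (sR h). \<psi> (sR c x) = sS c (\<psi> x)) \<and>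
     (\<forall>x\<in>range (sR h). \<forall>y\<in>range (sR h). \<psi> (x * y) = \<psi> x * \<psi> y)"

definition alg_antiiso_on ::
  "('f \<Rightarrow> 'r::ring \<Rightarrow> 'r) \<Rightarrow> ('f \<Rightarrow> 's::ring \<Rightarrow> 's) \<Rightarrow> 'f \<Rightarrow> ('r \<Rightarrow> 's) \<Rightarrow> bool" where
  "alg_antiiso_on sR sS h \<psi> \<longleftrightarrow>
     bij_betw \<psi> (range (sR h)) (range (sS h)) \<and>
     (\<forall>x\<in>range (sR h). \<forall>y\<in>range (sR h). \<psi> (x + y) = \<psi> x + \<psi> y) \<and>
     (\<forall>c. \<forall>x\<in>range (sR h). \<psi> (sR c x) = sS c (\<psi> x)) \<and>
     (\<forall>x\<in>range (sR h). \<forall>y\<in>range (sR h). \<psi> (x * y) = \<psi> y * \<psi> x)"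

definition tri_map :: "('r \<Rightarrow> 's) \<Rightarrow> ('f, 'r) tri \<Rightarrow> ('f, 's) tri" where
  "tri_map \<psi> x = (fst x, map_mat \<psi> (snd x))"

text \<open>The linear map with \<open>e\<^sub>i\<^sub>j(a) \<mapsto> e\<^sub>p\<^sub>q(\<psi> a)\<close>, where \<open>p = n - 1 - j\<close> and \<open>q = n - 1 - i\<close> in the
  numbering from \<open>0\<close>: reflection in the second diagonal.\<close>

definition tri_antimap :: "nat \<Rightarrow> ('r \<Rightarrow> 's) \<Rightarrow> ('f, 'r) tri \<Rightarrow> ('f, 's) tri" where
  "tri_antimap n \<psi> x =
     (vec n (\<lambda>i. fst x $ (n - 1 - i)),
      mat n n (\<lambda>(i, j). \<psi> (snd x $$ (n - 1 - j, n - 1 - i))))"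


subsection \<open>Conjugation\<close>

definition mat_inverse_of :: "nat \<Rightarrow> 's::{ring, monoid_mult} mat \<Rightarrow> 's mat \<Rightarrow> bool" where
  "mat_inverse_of n g k \<longleftrightarrow> k \<in> carrier_mat n n \<and> g * k = 1\<^sub>m n \<and> k * g = 1\<^sub>m n"

definition mat_units :: "nat \<Rightarrow> 's::{ring, monoid_mult} mat set" where
  "mat_units n = {g \<in> carrier_mat n n. \<exists>k. mat_inverse_of n g k}"

definition mat_inv :: "nat \<Rightarrow> 's::{ring, monoid_mult} mat \<Rightarrow> 's mat" where
  "mat_inv n g = (THE k. mat_inverse_of n g k)"

definition UT :: "nat \<Rightarrow> 's::{ring, monoid_mult} mat set" where
  "UT n = {g \<in> carrier_mat n n. upper_triangular g \<and> (\<forall>i<n. g $$ (i, i) = 1)}"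

definition Diag_units :: "nat \<Rightarrow> 's::{ring, monoid_mult} mat set" where
  "Diag_units n = {mat_diag n u | u. \<forall>i<n. \<exists>v. u i * v = 1 \<and> v * u i = 1}"

text \<open>The automorphism \<open>x \<mapsto> g x g\<^sup>-\<^sup>1\<close> of \<open>T(S)\<close>, for \<open>g\<close> in \<^const>\<open>UT\<close> or \<^const>\<open>Diag_units\<close>: the
  product is computed in the full matrix ring over \<open>S\<close>, and since such a \<open>g\<close> does not change the
  diagonal, the result is again an element of \<open>T(S)\<close> (see \<open>tri_embed_conj\<close> below).\<close>

definition tri_conj ::
  "nat \<Rightarrow> ('f \<Rightarrow> 's::{ring, monoid_mult} \<Rightarrow> 's) \<Rightarrow> 's mat \<Rightarrow> ('f, 's) tri \<Rightarrow> ('f, 's) tri" where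
  "tri_conj n sc g x =
     (fst x, mat n n (\<lambda>(i, j). if i < j then (g * tri_embed n sc x * mat_inv n g) $$ (i, j) else 0))"

lemma mat_inverse_of_unique:
  fixes g :: "'s::{ring, monoid_mult} mat"
  assumes "g \<in> carrier_mat n n" "mat_inverse_of n g k" "mat_inverse_of n g l"
  shows "k = l"
proof -
  have k: "k \<in> carrier_mat n n" "k * g = 1\<^sub>m n" and l: "l \<in> carrier_mat n n" "g * l = 1\<^sub>m n"
    using assms by (auto simp: mat_inverse_of_def)
  have left: "1\<^sub>m n * l = l"
    using l by (intro eq_matI)
      (auto simp: scalar_prod_def if_distrib[of "\<lambda>t. t * _"] cong: if_cong)
  have right: "k * 1\<^sub>m n = k"
    using k by (intro eq_matI)
      (auto simp: scalar_prod_def if_distrib[of "\<lambda>t. _ * t"] cong: if_cong)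
  have "k = k * (g * l)" using l right by simp
  also have "\<dots> = l" using k l assms(1) left by (metis assoc_mult_mat)
  finally show ?thesis .
qed

lemma mat_inv:
  fixes g :: "'s::{ring, monoid_mult} mat"
  assumes "g \<in> mat_units n"
  shows "mat_inverse_of n g (mat_inv n g)"
  using assms mat_inverse_of_unique unfolding mat_units_def mat_inv_def
  by (smt (verit, ccfv_threshold) mem_Collect_eq theI)

lemma upper_triangular_left_inverse:
  fixes g :: "'s::{ring, monoid_mult} mat"
  assumes g: "g \<in> carrier_mat n n" "upper_triangular g"
    and u: "\<And>i. i < n \<Longrightarrow> \<exists>v. g $$ (i, i) * v = 1 \<and> v * g $$ (i, i) = 1"
    and k: "k \<in> carrier_mat n n" "k * g = 1\<^sub>m n"
  shows "upper_triangular k"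
    and "\<And>i. i < n \<Longrightarrow> k $$ (i, i) * g $$ (i, i) = 1"
    and "\<And>i. i < n \<Longrightarrow> g $$ (i, i) * k $$ (i, i) = 1"
proof -
  have prod: "(\<Sum>l<n. k $$ (i, l) * g $$ (l, j)) = (if i = j then 1 else 0)"
    if "i < n" "j < n" for i j
  proof -
    have "(k * g) $$ (i, j) = (\<Sum>l<n. k $$ (i, l) * g $$ (l, j))"
      using that g k(1) by (simp add: scalar_prod_def lessThan_atLeast0)
    then show ?thesis using k(2) that by simp
  qed
  have diag: "k $$ (i, j) * g $$ (j, j) = (if i = j then 1 else 0)"
    if "i < n" "j \<le> i" "\<And>l. l < j \<Longrightarrow> k $$ (i, l) = 0" for i j
  proof -
    have "(\<Sum>l<n. k $$ (i, l) * g $$ (l, j)) = (\<Sum>l\<in>{j}. k $$ (i, l) * g $$ (l, j))"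
    proof (rule sum.mono_neutral_right)
      show "\<forall>l\<in>{..<n} - {j}. k $$ (i, l) * g $$ (l, j) = 0"
      proof
        fix l assume "l \<in> {..<n} - {j}"
        then consider "l < j" | "j < l" "l < n" by fastforce
        then show "k $$ (i, l) * g $$ (l, j) = 0"
          using that g by cases (auto dest: upper_triangularD)
      qed
    qed (use that in auto)
    then show ?thesis using prod[of i j] that by simp
  qed
  have zero: "k $$ (i, j) = 0" if "j < i" "i < n" for i j
    using that
  proof (induction j rule: less_induct)
    case (less j)
    then have "k $$ (i, j) * g $$ (j, j) = 0" using diag[of i j] by simp
    moreover obtain v where "g $$ (j, j) * v = 1" using u[of j] less.prems by auto
    ultimately show ?case by (metis mult.assoc mult.right_neutral mult_zero_left)
  qed
  then show "upper_triangular k" using k by (auto simp: upper_triangular_def)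
  show kg: "k $$ (i, i) * g $$ (i, i) = 1" if "i < n" for i
    using diag[of i i] zero that by simp
  show "g $$ (i, i) * k $$ (i, i) = 1" if "i < n" for i
    using kg[OF that] u[OF that] by (metis mult.assoc mult.right_neutral mult_1_left)
qed

lemma upper_triangular_mult:
  fixes A B :: "'s::semiring_0 mat"
  assumes A: "A \<in> carrier_mat n n" "upper_triangular A"
    and B: "B \<in> carrier_mat n n" "upper_triangular B"
  shows "upper_triangular (A * B)"
    and "\<And>i. i < n \<Longrightarrow> (A * B) $$ (i, i) = A $$ (i, i) * B $$ (i, i)"
proof -
  have prod: "(A * B) $$ (i, j) = (\<Sum>l<n. A $$ (i, l) * B $$ (l, j))" if "i < n" "j < n" for i j
    using that A B by (simp add: scalar_prod_def lessThan_atLeast0)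
  have z: "A $$ (i, l) * B $$ (l, j) = 0" if "i < n" "l < n" "j < n" "j \<le> i" "\<not> (l = i \<and> l = j)"
    for i j l
  proof -
    have "l < i \<or> j < l" using that by auto
    then show ?thesis using A B that by (auto dest: upper_triangularD)
  qed
  have "(A * B) $$ (i, j) = 0" if "i < n" "j < i" for i j
    using that by (auto simp: prod intro!: sum.neutral z)
  then show "upper_triangular (A * B)" using A by (auto simp: upper_triangular_def)
  show "(A * B) $$ (i, i) = A $$ (i, i) * B $$ (i, i)" if "i < n" for i
  proof -
    have "(\<Sum>l<n. A $$ (i, l) * B $$ (l, i)) = (\<Sum>l\<in>{i}. A $$ (i, l) * B $$ (l, i))"
      using that z by (intro sum.mono_neutral_right) auto
    then show ?thesis using that by (simp add: prod)
  qed
qed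

lemma (in unital_algebra) tri_embed_conj:
  assumes g: "g \<in> UT n \<union> Diag_units n" "g \<in> mat_units n" and x: "x \<in> tri n"
  shows "tri_embed n sc (tri_conj n sc g x) = g * tri_embed n sc x * mat_inv n g"
proof -
  let ?k = "mat_inv n g" and ?X = "tri_embed n sc x"
  have gc: "g \<in> carrier_mat n n" using g(2) by (simp add: mat_units_def)
  have gu: "upper_triangular g"
    using g(1) by (auto simp: UT_def Diag_units_def mat_diag_def)
  have u: "\<exists>v. g $$ (i, i) * v = 1 \<and> v * g $$ (i, i) = 1" if "i < n" for i
    using g(1) that by (auto simp: UT_def Diag_units_def mat_diag_def)
  have k: "?k \<in> carrier_mat n n" "?k * g = 1\<^sub>m n"
    using mat_inv[OF g(2)] by (auto simp: mat_inverse_of_def)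
  note ku = upper_triangular_left_inverse[OF gc gu u k]
  have X: "?X \<in> carrier_mat n n" "upper_triangular ?X"
    using x by (auto simp: tri_def tri_embed_def)
  note gX = upper_triangular_mult[OF gc gu X]
  have gXc: "g * ?X \<in> carrier_mat n n" using gc X by simp
  note gXk = upper_triangular_mult[OF gXc gX(1) k(1) ku(1)]
  have d: "(g * ?X * ?k) $$ (i, i) = sc (fst x $ i) 1" if "i < n" for i
  proof -
    have "(g * ?X * ?k) $$ (i, i) = g $$ (i, i) * sc (fst x $ i) 1 * ?k $$ (i, i)"
      using that gXk(2) gX(2) by (simp add: tri_embed_def)
    also have "\<dots> = sc (fst x $ i) (g $$ (i, i) * ?k $$ (i, i))"
      by (simp flip: sc_mult_left sc_mult_right)
    finally show ?thesis using ku(3) that by simp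
  qed
  have l: "(g * ?X * ?k) $$ (i, j) = 0" if "j < i" "i < n" for i j
    using upper_triangularD[OF gXk(1) that(1)] that gc by simp
  show ?thesis
  proof (rule eq_matI)
    fix i j assume "i < dim_row (g * ?X * ?k)" "j < dim_col (g * ?X * ?k)"
    then have ij: "i < n" "j < n" using gc k by simp_all
    then have "tri_embed n sc (tri_conj n sc g x) $$ (i, j) =
        (if i = j then sc (fst x $ i) 1 else if i < j then (g * ?X * ?k) $$ (i, j) else 0)"
      by (simp add: tri_embed_index tri_conj_def del: index_mult_mat(1))
    also have "\<dots> = (g * ?X * ?k) $$ (i, j)"
      using d[OF ij(1)] l[OF _ ij(1), of j] by (cases i j rule: linorder_cases) simp_all
    finally show "tri_embed n sc (tri_conj n sc g x) $$ (i, j) = (g * ?X * ?k) $$ (i, j)" .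
  qed (use gc k in \<open>auto simp: tri_embed_def\<close>)
qed

end

(* Every coset of the scalars has exactly one representative with last diagonal entry 0, and these
   representatives form a Lie algebra; so phi becomes an honest Lie homomorphism F between algebras of
   triangular matrices.  The diagonal matrices, modulo scalars, act on the entries in position
   (i, i + 1) through the differences of consecutive diagonal entries.  Since F respects the powers of
   the ideal of strictly triangular matrices, comparing these actions shows that F induces on the
   differences a matrix A over Phi whose rows and columns are complete systems of orthogonal
   idempotents, a "permutation matrix locally".  The action on the positions (i, i + 2) shows that the
   permutation preserves adjacency, hence it is the identity on h Phi and the reversal on
   (1 - h) Phi, where h is the corner entry of A.

   The images of the diagonal idempotents diag(1,...,1,0,...,0), rearranged by h, commute and have
   the diagonals of these idempotents.  They are simultaneously conjugated to them by a unitriangular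
   g1, removing one superdiagonal at a time.  After this conjugation F respects weight spaces, so it
   sends e_ij(a) to e_ij(f_ij(a)) - e_j'i'(g_j'i'(a)), where the prime is reflection, f is
   multiplicative and g is multiplicative for the opposite algebra, with values in h S and (1 - h) S.
   The elements f_ij(h) are units of h S because n >= 3, which yields
   f_ij(a) = d_i psi_1(a) d_j^(-1), and in the same way psi_2 is obtained from g; the d's form g2. *)

theory Submission
  imports Defs
begin

subsection \<open>Entries\<close>

text \<open>Phi may have many idempotents and allows no division, and this shapes every step. No
  bijection of indices need exist globally; where a field would let one follow a permutation of the
  simple roots, the argument multiplies by an idempotent on which a row of A becomes a unit vector.
  Identities in Phi are read off from the action on the entry 1 of S, which is where the injectivity
  of \<open>c \<mapsto> c 1\<close> enters. Weight spaces are not separated by dividing by a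
  difference of eigenvalues: for two distinct positions there is a gap at which their weights are 0
  and 1. Strictly triangular matrices are preserved for an intrinsic reason: they form the derived
  algebra, each single entry being its own bracket with a diagonal idempotent. The minus sign before
  the second summand is forced, since reflection reverses products and only its negative respects
  brackets. As S is noncommutative, a one-sided inverse is not yet an inverse: surjectivity of the
  entry maps yields one side, injectivity the other.\<close>

abbreviation dg :: "('f, 'r) tri \<Rightarrow> nat \<Rightarrow> 'f" where
  "dg x i \<equiv> fst x $ i"

abbreviation up :: "('f, 'r) tri \<Rightarrow> nat \<Rightarrow> nat \<Rightarrow> 'r" where
  "up x i j \<equiv> snd x $$ (i, j)"

definition tri_of :: "nat \<Rightarrow> (nat \<Rightarrow> 'f) \<Rightarrow> (nat \<Rightarrow> nat \<Rightarrow> 'r::zero) \<Rightarrow> ('f, 'r) tri" where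
  "tri_of n d u = (vec n d, mat n n (\<lambda>(i, j). if i < j then u i j else 0))"

definition unit_elt :: "nat \<Rightarrow> nat \<Rightarrow> nat \<Rightarrow> 'r::zero \<Rightarrow> ('f::zero, 'r) tri" where
  "unit_elt n i j a = tri_of n (\<lambda>_. 0) (\<lambda>p q. if p = i \<and> q = j then a else 0)"

definition diag_elt :: "nat \<Rightarrow> (nat \<Rightarrow> 'f::comm_monoid_add) \<Rightarrow> ('f, 'r::zero) tri" where
  "diag_elt n c = tri_of n (\<lambda>i. \<Sum>k\<in>{i..<n - 1}. c k) (\<lambda>_ _. 0)"

definition single :: "nat \<Rightarrow> 'f::zero \<Rightarrow> nat \<Rightarrow> 'f" where
  "single k c i = (if i = k then c else 0)"

text \<open>Modulo scalars a diagonal matrix is determined by its gaps, the values of the simple roots;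
  \<open>diag_elt n c\<close> is the one with gaps \<open>c\<close> and last entry \<open>0\<close>.\<close>

definition gap :: "('f::minus, 'r) tri \<Rightarrow> nat \<Rightarrow> 'f" where
  "gap x i = dg x i - dg x (Suc i)"

text \<open>For \<open>r > 0\<close> this is the \<open>r\<close>-th power of the ideal of strictly
  triangular matrices.\<close>

definition strict :: "nat \<Rightarrow> nat \<Rightarrow> ('f::zero, 'r::zero) tri set" where
  "strict n r = {x \<in> tri n. (\<forall>i<n. dg x i = 0) \<and> (\<forall>i<n. \<forall>j<n. j < i + r \<longrightarrow> up x i j = 0)}"

lemma tri_of_in_tri [simp]: "tri_of n d u \<in> tri n"
  by (auto simp: tri_of_def tri_def)

lemma dg_tri_of [simp]: "i < n \<Longrightarrow> dg (tri_of n d u) i = d i"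
  by (simp add: tri_of_def)

lemma up_tri_of [simp]:
  "i < n \<Longrightarrow> j < n \<Longrightarrow> up (tri_of n d u) i j = (if i < j then u i j else 0)"
  by (simp add: tri_of_def)

lemma up_lower: "x \<in> tri n \<Longrightarrow> j \<le> i \<Longrightarrow> i < n \<Longrightarrow> up x i j = 0"
  by (auto simp: tri_def)

lemma tri_dim:
  assumes "x \<in> tri n"
  shows "fst x \<in> carrier_vec n" "snd x \<in> carrier_mat n n"
    "dim_vec (fst x) = n" "dim_row (snd x) = n" "dim_col (snd x) = n"
  using assms by (auto simp: tri_def)

lemma tri_eqI:
  assumes "x \<in> tri n" "y \<in> tri n"
    and "\<And>i. i < n \<Longrightarrow> dg x i = dg y i"
    and "\<And>i j. i < j \<Longrightarrow> j < n \<Longrightarrow> up x i j = up y i j"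
  shows "x = y"
proof (rule prod_eqI)
  show "fst x = fst y" using assms by (intro eq_vecI) (auto simp: tri_dim)
  show "snd x = snd y"
  proof (rule eq_matI)
    fix i j assume "i < dim_row (snd y)" "j < dim_col (snd y)"
    then have "i < n" "j < n" using assms(2) by (auto simp: tri_dim)
    then show "up x i j = up y i j"
      using assms up_lower[of x n j i] up_lower[of y n j i] by (cases "i < j") auto
  qed (use assms in \<open>auto simp: tri_dim\<close>)
qed

lemma dg_add: "x \<in> tri n \<Longrightarrow> y \<in> tri n \<Longrightarrow> i < n \<Longrightarrow> dg (tri_add x y) i = dg x i + dg y i"
  by (auto simp: tri_add_def tri_def)

lemma up_add:
  "x \<in> tri n \<Longrightarrow> y \<in> tri n \<Longrightarrow> i < n \<Longrightarrow> j < n \<Longrightarrow> up (tri_add x y) i j = up x i j + up y i j"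
  by (auto simp: tri_add_def tri_def)

lemma tri_add_in [simp]: "x \<in> tri n \<Longrightarrow> y \<in> tri n \<Longrightarrow> tri_add x (y :: ('f::plus, 'r::monoid_add) tri) \<in> tri n"
  by (auto simp: tri_add_def tri_def)

lemma dg_diff: "x \<in> tri n \<Longrightarrow> y \<in> tri n \<Longrightarrow> i < n \<Longrightarrow> dg (tri_diff x y) i = dg x i - dg y i"
  by (auto simp: tri_diff_def tri_def)

lemma up_diff:
  "x \<in> tri n \<Longrightarrow> y \<in> tri n \<Longrightarrow> i < n \<Longrightarrow> j < n \<Longrightarrow> up (tri_diff x y) i j = up x i j - up y i j"
  by (auto simp: tri_diff_def tri_def)

lemma tri_diff_in [simp]:
  "x \<in> tri n \<Longrightarrow> y \<in> tri n \<Longrightarrow> tri_diff x (y :: ('f::minus, 'r::group_add) tri) \<in> tri n"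
  by (auto simp: tri_diff_def tri_def minus_carrier_vec)

lemmas tri_ops = dg_add up_add dg_diff up_diff

lemma gap_add: "x \<in> tri n \<Longrightarrow> y \<in> tri n \<Longrightarrow> Suc i < n \<Longrightarrow>
    gap (tri_add x y) i = gap x i + gap (y :: ('f::ab_group_add, 'r::monoid_add) tri) i"
  by (simp add: gap_def dg_add[of _ n] algebra_simps)

lemma dg_unit_elt [simp]: "p < n \<Longrightarrow> dg (unit_elt n i j a) p = 0"
  by (simp add: unit_elt_def)

lemma up_unit_elt [simp]:
  "p < n \<Longrightarrow> q < n \<Longrightarrow> i < j \<Longrightarrow> up (unit_elt n i j a) p q = (if p = i \<and> q = j then a else 0)"
  by (auto simp: unit_elt_def)

lemma unit_elt_in [simp]: "unit_elt n i j a \<in> tri n"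
  by (simp add: unit_elt_def)

lemma dg_diag_elt [simp]: "i < n \<Longrightarrow> dg (diag_elt n c) i = (\<Sum>k\<in>{i..<n - 1}. c k)"
  by (simp add: diag_elt_def)

lemma up_diag_elt [simp]: "p < n \<Longrightarrow> q < n \<Longrightarrow> up (diag_elt n c) p q = 0"
  by (simp add: diag_elt_def)

lemma diag_elt_in [simp]: "diag_elt n c \<in> tri n"
  by (simp add: diag_elt_def)

lemma gap_diag_elt [simp]:
  "Suc i < n \<Longrightarrow> gap (diag_elt n c :: ('f::ab_group_add, 'r::zero) tri) i = c i"
proof -
  assume i: "Suc i < n"
  then have "(\<Sum>k\<in>{i..<n - 1}. c k) = c i + (\<Sum>k\<in>{Suc i..<n - 1}. c k)"
    by (intro sum.atLeast_Suc_lessThan) simp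
  then show ?thesis using i by (simp add: gap_def)
qed

lemma gap_unit_elt [simp]:
  "Suc k < n \<Longrightarrow> gap (unit_elt n i j a :: ('f::group_add, 'r::zero) tri) k = 0"
  by (simp add: gap_def)

lemma strict_in_tri: "x \<in> strict n r \<Longrightarrow> x \<in> tri n"
  by (simp add: strict_def)

lemma strict_dg: "x \<in> strict n r \<Longrightarrow> i < n \<Longrightarrow> dg x i = 0"
  by (auto simp: strict_def)

lemma strict_up: "x \<in> strict n r \<Longrightarrow> i < n \<Longrightarrow> j < n \<Longrightarrow> j < i + r \<Longrightarrow> up x i j = 0"
  by (auto simp: strict_def)

lemma strict_add: "x \<in> strict n r \<Longrightarrow> y \<in> strict n r \<Longrightarrow>
    tri_add x (y :: ('f::monoid_add, 'r::monoid_add) tri) \<in> strict n r"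
  by (auto simp: strict_def tri_ops[of _ n])

lemma strict_diff: "x \<in> strict n r \<Longrightarrow> y \<in> strict n r \<Longrightarrow>
    tri_diff x (y :: ('f::group_add, 'r::group_add) tri) \<in> strict n r"
  by (auto simp: strict_def tri_ops[of _ n])

lemma unit_elt_strict: "i < j \<Longrightarrow> i + r \<le> j \<Longrightarrow> unit_elt n i j a \<in> strict n r"
  by (auto simp: strict_def)

lemma strict_1_iff: "x \<in> strict n (Suc 0) \<longleftrightarrow> x \<in> tri n \<and> (\<forall>i<n. dg x i = 0)"
  by (auto simp: strict_def intro: up_lower)

lemma tri_scalars_iff:
  "0 < n \<Longrightarrow> x \<in> tri_scalars n \<longleftrightarrow>
    x \<in> tri n \<and> (\<forall>i<n. dg x i = dg x (n - 1)) \<and> (\<forall>i j. i < j \<longrightarrow> j < n \<longrightarrow> up x i j = 0)"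
  (is "_ \<Longrightarrow> _ \<longleftrightarrow> ?R")
proof
  assume "x \<in> tri_scalars n" "0 < n" then show ?R by (auto simp: tri_scalars_def tri_def)
next
  assume n: "0 < n" and R: ?R
  define c where "c = dg x (n - 1)"
  have "x \<in> tri n" "\<And>i. i < n \<Longrightarrow> dg x i = c" "\<And>i j. i < j \<Longrightarrow> j < n \<Longrightarrow> up x i j = 0"
    using R unfolding c_def by blast+
  then have "x = (vec n (\<lambda>_. c), 0\<^sub>m n n)"
    by (intro tri_eqI[of _ n]) (auto simp: tri_def)
  then show "x \<in> tri_scalars n" unfolding tri_scalars_def by blast
qed

lemma gap_eq_imp_dg_diff_const:
  fixes x y :: "('f::ab_group_add, 'r) tri"
  assumes "\<And>k. Suc k < n \<Longrightarrow> gap x k = gap y k" "i < n"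
  shows "dg x i - dg y i = dg x (n - 1) - dg y (n - 1)"
proof -
  have "i \<le> n - 1" using assms by simp
  then show ?thesis
  proof (induction rule: inc_induct)
    case (step k)
    then have "gap x k = gap y k" using assms(1)[of k] by simp
    then have "dg x k - dg y k = dg x (Suc k) - dg y (Suc k)"
      by (simp add: gap_def algebra_simps)
    then show ?case using step by simp
  qed simp
qed

lemma dg_diff_eq_sum_gap:
  assumes "i \<le> j" "j < n"
  shows "dg x i - dg x j = (\<Sum>k\<in>{i..<j}. gap (x :: ('f::ab_group_add, 'r) tri) k)"
  using assms by (induction rule: dec_induct) (auto simp: gap_def algebra_simps)


subsection \<open>Induction over generators\<close>

text \<open>The induction runs over a finite set containing the support and splits off one entry at
  a time; \<open>0 < r\<close> guarantees that this entry lies strictly above the diagonal.\<close>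

lemma strict_induct [consumes 2, case_names zero add unit]:
  fixes x :: "('f::monoid_add, 'r::monoid_add) tri"
  assumes x: "x \<in> strict n r" and r: "0 < r"
    and zero: "P (tri_of n (\<lambda>_. 0) (\<lambda>_ _. 0))"
    and add: "\<And>x y. x \<in> strict n r \<Longrightarrow> y \<in> strict n r \<Longrightarrow> P x \<Longrightarrow> P y \<Longrightarrow> P (tri_add x y)"
    and unit: "\<And>i j a. i + r \<le> j \<Longrightarrow> j < n \<Longrightarrow> P (unit_elt n i j a)"
  shows "P x"
proof -
  have "P x" if "finite K" "x \<in> strict n r" "\<And>i j. i < n \<Longrightarrow> j < n \<Longrightarrow> (i, j) \<notin> K \<Longrightarrow> up x i j = 0" for K x
    using that
  proof (induction K arbitrary: x rule: finite_induct)
    case empty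
    then have "x = tri_of n (\<lambda>_. 0) (\<lambda>_ _. 0)"
      by (intro tri_eqI[of _ n]) (auto simp: strict_def)
    then show ?case using zero by simp
  next
    case (insert ij K)
    obtain p q where ij: "ij = (p, q)" by force
    show ?case
    proof (cases "p + r \<le> q \<and> q < n")
      case True
      define y :: "('f, 'r) tri" where "y = tri_of n (\<lambda>_. 0) (\<lambda>i j. if (i, j) = (p, q) then 0 else up x i j)"
      have y: "y \<in> strict n r"
        using insert.prems(1) by (auto simp: strict_def y_def)
      have "P y"
        using insert.prems by (intro insert.IH y) (auto simp: y_def ij)
      moreover have eq: "x = tri_add y (unit_elt n p q (up x p q))"
        using insert.prems(1) True r y
        by (intro tri_eqI[of _ n]) (auto simp: strict_def y_def tri_ops[of _ n])
      moreover have "P (unit_elt n p q (up x p q))" using True by (intro unit) auto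
      moreover have "unit_elt n p q (up x p q) \<in> strict n r"
        using True r by (intro unit_elt_strict) auto
      ultimately show ?thesis by (subst eq) (rule add[OF y])
    next
      case False
      then have "up x i j = 0" if "i < n" "j < n" "(i, j) \<notin> K" for i j
        using insert.prems that strict_up[of x n r p q] by (cases "(i, j) = (p, q)") (auto simp: ij)
      then show ?thesis using insert.IH insert.prems by blast
    qed
  qed
  from this[of "{..<n} \<times> {..<n}" x] x show ?thesis by auto
qed

text \<open>Modulo scalars, additive generators are the multiples of diag(1, ..., 1, 0, ..., 0),
  which are dual to the simple roots, and the single entries. Anything additive in \<open>x\<close>
  can be tested on them.\<close>

lemma tri_induct [consumes 2, case_names scalar add diag unit]:
  fixes x :: "('f::ab_group_add, 'r::monoid_add) tri"
  assumes x: "x \<in> tri n" and n: "0 < n"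
    and scalar: "\<And>s. s \<in> tri_scalars n \<Longrightarrow> P s"
    and add: "\<And>x y. x \<in> tri n \<Longrightarrow> y \<in> tri n \<Longrightarrow> P x \<Longrightarrow> P y \<Longrightarrow> P (tri_add x y)"
    and diag: "\<And>k c. Suc k < n \<Longrightarrow> P (diag_elt n (single k c))"
    and unit: "\<And>i j a. i < j \<Longrightarrow> j < n \<Longrightarrow> P (unit_elt n i j a)"
  shows "P x"
proof -
  have zero: "P (tri_of n (\<lambda>_. 0) (\<lambda>_ _. 0))"
    using n by (intro scalar) (auto simp: tri_scalars_iff)
  have U: "P u" if "u \<in> strict n (Suc 0)" for u :: "('f, 'r) tri"
    using that zero_less_Suc
  proof (induction rule: strict_induct)
    case (add x y) then show ?case by (intro assms(4)) (auto dest: strict_in_tri)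
  qed (auto intro: zero unit)
  have D: "P (diag_elt n c)" if "m \<le> n - 1" "\<And>k. m \<le> k \<Longrightarrow> k < n - 1 \<Longrightarrow> c k = 0" for m c
    using that
  proof (induction m arbitrary: c)
    case 0
    then have "diag_elt n c = (tri_of n (\<lambda>_. 0) (\<lambda>_ _. 0) :: ('f, 'r) tri)"
      by (intro tri_eqI[of _ n]) (auto intro: sum.neutral)
    then show ?case using zero by simp
  next
    case (Suc m)
    have "P (diag_elt n (c(m := 0)))" using Suc.prems by (intro Suc.IH) auto
    moreover have "P (diag_elt n (single m (c m)))" using Suc.prems by (intro diag) auto
    moreover have eq: "diag_elt n c = (tri_add (diag_elt n (c(m := 0))) (diag_elt n (single m (c m))) :: ('f, 'r) tri)"
    proof (intro tri_eqI[of _ n])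
      fix i assume i: "i < n"
      have "(\<Sum>k\<in>{i..<n - 1}. c k) = (\<Sum>k\<in>{i..<n - 1}. (c(m := 0)) k + single m (c m) k)"
        by (intro sum.cong) (auto simp: single_def)
      then show "dg (diag_elt n c) i = dg (tri_add (diag_elt n (c(m := 0))) (diag_elt n (single m (c m)))) i"
        using i by (simp add: tri_ops[of _ n] sum.distrib del: fun_upd_apply)
    qed (auto simp: tri_ops[of _ n])
    ultimately show ?case by (subst eq) (rule add[OF diag_elt_in diag_elt_in])
  qed
  define d :: "('f, 'r) tri" where "d = diag_elt n (gap x)"
  define s :: "('f, 'r) tri" where "s = tri_of n (\<lambda>_. dg x (n - 1)) (\<lambda>_ _. 0)"
  define u :: "('f, 'r) tri" where "u = tri_of n (\<lambda>_. 0) (up x)"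
  have "P u" by (intro U) (auto simp: strict_1_iff u_def)
  moreover have "P s" by (intro scalar) (use n in \<open>auto simp: tri_scalars_iff s_def\<close>)
  moreover have "P d" unfolding d_def by (intro D[of "n - 1"]) auto
  moreover have eq: "x = tri_add (tri_add d s) u"
  proof (intro tri_eqI[of _ n])
    fix i assume i: "i < n"
    have "dg x i - dg d i = dg x (n - 1) - dg d (n - 1)"
      by (rule gap_eq_imp_dg_diff_const) (use i in \<open>auto simp: d_def\<close>)
    then show "dg x i = dg (tri_add (tri_add d s) u) i"
      using i n by (auto simp: d_def s_def u_def tri_ops[of _ n] algebra_simps)
  qed (use x in \<open>auto simp: d_def s_def u_def tri_ops[of _ n]\<close>)
  moreover have "d \<in> tri n" "s \<in> tri n" "u \<in> tri n" by (auto simp: d_def s_def u_def)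
  ultimately show ?thesis unfolding eq by (intro add tri_add_in)
qed


subsection \<open>Brackets\<close>

lemma mult_mat_entry:
  assumes "A \<in> carrier_mat n n" "B \<in> carrier_mat n n" "i < n" "j < n"
  shows "(A * B) $$ (i, j) = (\<Sum>k<n. A $$ (i, k) * B $$ (k, j))"
  using assms by (simp add: scalar_prod_def lessThan_atLeast0)

context unital_algebra
begin

lemma sc_0_left [simp]: "sc 0 x = 0"
  using sc_add_left[of 0 0 x] by simp

lemma sc_minus_left: "sc (- a) x = - sc a x"
  using sc_add_left[of a "- a" x] by (simp add: eq_neg_iff_add_eq_0 add.commute)

lemma sc_minus_right: "sc a (- x) = - sc a x"
  using sc_add_right[of a x "- x"] by (simp add: eq_neg_iff_add_eq_0 add.commute)

lemma sc_diff_left: "sc (a - b) x = sc a x - sc b x"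
  using sc_add_left[of a "- b" x] by (simp add: sc_minus_left)

lemma sc_diff_right: "sc a (x - y) = sc a x - sc a y"
  using sc_add_right[of a x "- y"] by (simp add: sc_minus_right)

lemma sc_sum: "sc a (sum f K) = (\<Sum>k\<in>K. sc a (f k))"
  by (induction K rule: infinite_finite_induct) (auto simp: sc_add_right)

lemma dg_scale: "x \<in> tri n \<Longrightarrow> i < n \<Longrightarrow> dg (tri_scale sc c x) i = c * dg x i"
  by (auto simp: tri_scale_def tri_def)

lemma up_scale:
  "x \<in> tri n \<Longrightarrow> i < n \<Longrightarrow> j < n \<Longrightarrow> up (tri_scale sc c x) i j = sc c (up x i j)"
  by (auto simp: tri_scale_def tri_def)

lemma tri_scale_in [simp]: "x \<in> tri n \<Longrightarrow> tri_scale sc c x \<in> tri n"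
  by (auto simp: tri_scale_def tri_def)

lemma diag_elt_scale: "tri_scale sc c (diag_elt n a) = diag_elt n (\<lambda>i. c * a i)"
  by (intro tri_eqI[of _ n]) (simp_all add: dg_scale[of _ n] up_scale[of _ n] sum_distrib_left)

lemma diag_elt_single_scale:
  "tri_scale sc c (diag_elt n (single k b)) = diag_elt n (single k (b * c))"
  unfolding diag_elt_scale by (rule arg_cong[of _ _ "diag_elt n"]) (auto simp: single_def mult.commute)

lemma tri_mult_in [simp]: "x \<in> tri n \<Longrightarrow> y \<in> tri n \<Longrightarrow> tri_mult n sc x y \<in> tri n"
proof -
  assume x: "x \<in> tri n" and y: "y \<in> tri n"
  have "(snd x * snd y) $$ (i, j) = 0" if "i < n" "j \<le> i" for i j
  proof -
    have "up x i k * up y k j = 0" if "k < n" for k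
      using x y \<open>i < n\<close> \<open>j \<le> i\<close> that up_lower[of x n k i] up_lower[of y n j k] by (cases "k \<le> i") auto
    then show ?thesis
      using x y that by (subst mult_mat_entry[where n = n]) (auto simp: tri_dim)
  qed
  then show "tri_mult n sc x y \<in> tri n"
    using x y unfolding tri_def tri_mult_def by (auto simp del: index_mult_mat(1))
qed

lemma tri_bracket_in [simp]: "x \<in> tri n \<Longrightarrow> y \<in> tri n \<Longrightarrow> tri_bracket n sc x y \<in> tri n"
  by (simp add: tri_bracket_def)

lemma dg_bracket: "x \<in> tri n \<Longrightarrow> y \<in> tri n \<Longrightarrow> i < n \<Longrightarrow> dg (tri_bracket n sc x y) i = 0"
  by (simp add: tri_bracket_def dg_diff[of _ n]) (simp add: tri_mult_def mult.commute)

lemma up_bracket: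
  assumes "x \<in> tri n" "y \<in> tri n" "i < n" "j < n"
  shows "up (tri_bracket n sc x y) i j =
    sc (dg x i - dg x j) (up y i j) - sc (dg y i - dg y j) (up x i j)
    + (\<Sum>k<n. up x i k * up y k j - up y i k * up x k j)"
proof -
  have "up (tri_mult n sc u v) i j = sc (dg u i) (up v i j) + (\<Sum>k<n. up u i k * up v k j) + sc (dg v j) (up u i j)"
    if "u \<in> tri n" "v \<in> tri n" for u v
    using that assms(3,4)
    by (simp add: tri_mult_def mult_mat_entry[OF tri_dim(2) tri_dim(2)] del: index_mult_mat(1))
  then show ?thesis
    using assms by (simp add: tri_bracket_def up_diff[of _ n] sc_diff_left sum_subtractf)
qed

lemma bracket_strict: "x \<in> tri n \<Longrightarrow> y \<in> tri n \<Longrightarrow> tri_bracket n sc x y \<in> strict n 1"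
  by (simp add: strict_1_iff dg_bracket[of _ n])

lemma bracket_strict_mult:
  assumes x: "x \<in> strict n r" and y: "y \<in> strict n s" and "0 < r" "0 < s"
  shows "tri_bracket n sc x y \<in> strict n (r + s)"
proof -
  have "up (tri_bracket n sc x y) i j = 0" if ij: "i < n" "j < n" "j < i + (r + s)" for i j
  proof -
    have "up x i k * up y k j = 0" "up y i k * up x k j = 0" if "k < n" for k
    proof -
      show "up x i k * up y k j = 0"
        using ij that strict_up[OF x, of i k] strict_up[OF y, of k j] by (cases "k < i + r") auto
      show "up y i k * up x k j = 0"
        using ij that strict_up[OF y, of i k] strict_up[OF x, of k j] by (cases "k < i + s") auto
    qed
    then show ?thesis
      by (simp add: up_bracket[OF strict_in_tri[OF x] strict_in_tri[OF y] ij(1,2)]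
          strict_dg[OF x] strict_dg[OF y] ij(1,2))
  qed
  then show ?thesis
    using tri_bracket_in[OF strict_in_tri[OF x] strict_in_tri[OF y]]
      dg_bracket[OF strict_in_tri[OF x] strict_in_tri[OF y]]
    unfolding strict_def by blast
qed

lemma bracket_unit_unit:
  assumes "i < j" "j < k" "k < n"
  shows "tri_bracket n sc (unit_elt n i j a) (unit_elt n j k b) = unit_elt n i k (a * b)"
proof (rule tri_eqI[of _ n])
  fix p q assume pq: "p < q" "q < n"
  have "(\<Sum>l<n. up (unit_elt n i j a) p l * up (unit_elt n j k b) l q
      - up (unit_elt n j k b) p l * up (unit_elt n i j a) l q)
    = (\<Sum>l<n. if l = j then (if p = i \<and> q = k then a * b else 0) else 0)"
    using assms pq by (intro sum.cong) auto
  also have "\<dots> = (if p = i \<and> q = k then a * b else 0)" using assms by simp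
  finally show "up (tri_bracket n sc (unit_elt n i j a) (unit_elt n j k b)) p q = up (unit_elt n i k (a * b)) p q"
    using assms pq by (simp add: up_bracket[of _ n])
qed (use assms in \<open>auto simp: dg_bracket[of _ n]\<close>)

lemma up_bracket_diag:
  assumes "y \<in> tri n" "i < n" "j < n"
  shows "up (tri_bracket n sc (diag_elt n c) y) i j =
    sc (dg (diag_elt n c :: ('f, 'r) tri) i - dg (diag_elt n c :: ('f, 'r) tri) j) (up y i j)"
  using assms by (subst up_bracket[of _ n]) auto

text \<open>Single entries are weight vectors: the root at position \<open>(i, j)\<close> is the sum
  of the simple roots \<open>i, ..., j - 1\<close>.\<close>

lemma bracket_diag_unit:
  assumes "i < j" "j < n"
  shows "tri_bracket n sc (diag_elt n c) (unit_elt n i j a) = unit_elt n i j (sc (\<Sum>k\<in>{i..<j}. c k) a)"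
proof (rule tri_eqI[of _ n])
  fix p q assume pq: "p < q" "q < n"
  have "dg (diag_elt n c :: ('f, 'r) tri) i - dg (diag_elt n c :: ('f, 'r) tri) j = (\<Sum>k\<in>{i..<j}. c k)"
    using assms by (subst dg_diff_eq_sum_gap[of _ _ n]) auto
  then show "up (tri_bracket n sc (diag_elt n c) (unit_elt n i j a)) p q
      = up (unit_elt n i j (sc (\<Sum>k\<in>{i..<j}. c k) a)) p q"
    using assms pq by (subst up_bracket_diag) auto
qed (auto simp: dg_bracket[of _ n])

end


subsection \<open>Unitriangular matrices\<close>

lemma one_mult_mat:
  fixes A :: "'s::{ring, monoid_mult} mat"
  assumes "A \<in> carrier_mat n m"
  shows "1\<^sub>m n * A = A"
  using assms by (intro eq_matI)
    (auto simp: scalar_prod_def if_distrib[of "\<lambda>t. t * _"] cong: if_cong)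

lemma mult_one_mat:
  fixes A :: "'s::{ring, monoid_mult} mat"
  assumes "A \<in> carrier_mat m n"
  shows "A * 1\<^sub>m n = A"
  using assms by (intro eq_matI)
    (auto simp: scalar_prod_def if_distrib[of "\<lambda>t. _ * t"] cong: if_cong)

text \<open>Terms with \<open>k < i\<close> die in \<open>A\<close>, terms with \<open>k > i\<close>
  fall below the band of \<open>B\<close>. Thus on the first superdiagonal of \<open>B\<close> that
  may be nonzero only the diagonal of \<open>A\<close> acts; corrections made one superdiagonal at a
  time rest on this.\<close>

lemma upper_triangular_mult_band:
  fixes A B :: "'s::ring mat"
  assumes A: "A \<in> carrier_mat n n" "upper_triangular A" and B: "B \<in> carrier_mat n n"
    and band: "\<And>i j. i < n \<Longrightarrow> j < n \<Longrightarrow> j < i + r \<Longrightarrow> B $$ (i, j) = 0"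
    and ij: "i < n" "j < n" "j \<le> i + r"
  shows "(A * B) $$ (i, j) = A $$ (i, i) * B $$ (i, j)"
proof -
  have "(\<Sum>k<n. A $$ (i, k) * B $$ (k, j)) = (\<Sum>k\<in>{i}. A $$ (i, k) * B $$ (k, j))"
  proof (rule sum.mono_neutral_right)
    show "\<forall>k\<in>{..<n} - {i}. A $$ (i, k) * B $$ (k, j) = 0"
    proof
      fix k assume k: "k \<in> {..<n} - {i}"
      then consider "k < i" | "i < k" by fastforce
      then show "A $$ (i, k) * B $$ (k, j) = 0"
      proof cases
        case 1 then show ?thesis using A ij upper_triangularD[of A k i] by simp
      next
        case 2 then show ?thesis using band[of k j] k ij by simp
      qed
    qed
  qed (use ij in auto)
  then show ?thesis using mult_mat_entry[OF A(1) B ij(1,2)] by simp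
qed

lemma UT_D:
  assumes "g \<in> UT n"
  shows "g \<in> carrier_mat n n" "upper_triangular g" "\<And>i. i < n \<Longrightarrow> g $$ (i, i) = 1"
    "\<And>i j. j < i \<Longrightarrow> i < n \<Longrightarrow> g $$ (i, j) = 0"
  using assms by (auto simp: UT_def dest: upper_triangularD)

lemma UT_I:
  assumes "g \<in> carrier_mat n n" "\<And>i. i < n \<Longrightarrow> g $$ (i, i) = 1"
    "\<And>i j. j < i \<Longrightarrow> i < n \<Longrightarrow> g $$ (i, j) = 0"
  shows "g \<in> UT n"
  using assms by (auto simp: UT_def upper_triangular_def)

lemma one_UT: "1\<^sub>m n \<in> UT n"
  by (auto simp: UT_def)

lemma UT_minus_band:
  fixes g C :: "'s::{ring, monoid_mult} mat"
  assumes g: "g \<in> UT n" and C: "C \<in> carrier_mat n n"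
    and band: "\<And>i j. i < n \<Longrightarrow> j \<le> i \<Longrightarrow> C $$ (i, j) = 0"
  shows "g - C \<in> UT n"
  using UT_D[OF g] C band by (intro UT_I) auto

text \<open>Successive approximation: \<open>g * k\<close> is made to agree with the identity on one
  more superdiagonal in each round.\<close>

lemma UT_right_inverse:
  fixes g :: "'s::{ring, monoid_mult} mat"
  assumes g: "g \<in> UT n"
  shows "\<exists>k\<in>UT n. g * k = 1\<^sub>m n"
proof -
  have "\<exists>k\<in>UT n. \<forall>i<n. \<forall>j<n. j < i + Suc r \<longrightarrow> (g * k) $$ (i, j) = 1\<^sub>m n $$ (i, j)" for r
  proof (induction r)
    case 0
    have "(g * 1\<^sub>m n) $$ (i, j) = 1\<^sub>m n $$ (i, j)" if "i < n" "j < n" "j < i + Suc 0" for i j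
      using that UT_D(3,4)[OF g] unfolding mult_one_mat[OF UT_D(1)[OF g]] by (cases "i = j") auto
    then show ?case using one_UT by blast
  next
    case (Suc r)
    then obtain k where k: "k \<in> UT n"
      and eq: "\<And>i j. i < n \<Longrightarrow> j < n \<Longrightarrow> j < i + Suc r \<Longrightarrow> (g * k) $$ (i, j) = 1\<^sub>m n $$ (i, j)"
      by blast
    \<comment> \<open>The error on the next superdiagonal, where the identity matrix is 0. As
      \<open>g\<close> has diagonal 1, \<open>g * C\<close> agrees with \<open>C\<close> there, so
      subtracting \<open>C\<close> from \<open>k\<close> removes the error without disturbing the
      lower superdiagonals.\<close>
    define C where "C = mat n n (\<lambda>(i, j). if j = i + Suc r then (g * k) $$ (i, j) else 0)"
    have C: "C \<in> carrier_mat n n" by (simp add: C_def)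
    have band: "C $$ (i, j) = 0" if "i < n" "j < n" "j < i + Suc r" for i j
      using that by (simp add: C_def)
    have "k - C \<in> UT n"
      by (rule UT_minus_band[OF k C]) (simp add: C_def)
    moreover have "(g * (k - C)) $$ (i, j) = 1\<^sub>m n $$ (i, j)" if ij: "i < n" "j < n" "j < i + Suc (Suc r)" for i j
    proof -
      have "(g * C) $$ (i, j) = g $$ (i, i) * C $$ (i, j)"
        using ij by (intro upper_triangular_mult_band[where r = "Suc r", OF UT_D(1,2)[OF g] C band]) auto
      then have "(g * C) $$ (i, j) = C $$ (i, j)"
        using UT_D(3)[OF g] ij by simp
      moreover have "(g * (k - C)) $$ (i, j) = (g * k) $$ (i, j) - (g * C) $$ (i, j)"
        using ij UT_D(1)[OF g] UT_D(1)[OF k] C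
        by (subst mult_minus_distrib_mat[of _ n n _ n]) auto
      ultimately show ?thesis
        using ij eq[of i j] by (cases "j = i + Suc r") (simp_all add: C_def)
    qed
    ultimately show ?case by blast
  qed
  \<comment> \<open>For \<open>r = n\<close> the band contains all positions.\<close>
  then obtain k where k: "k \<in> UT n"
    "\<And>i j. i < n \<Longrightarrow> j < n \<Longrightarrow> j < i + Suc n \<Longrightarrow> (g * k) $$ (i, j) = 1\<^sub>m n $$ (i, j)"
    by blast
  have "g * k = 1\<^sub>m n"
  proof (rule eq_matI)
    fix i j assume "i < dim_row (1\<^sub>m n :: 's mat)" "j < dim_col (1\<^sub>m n :: 's mat)"
    then show "(g * k) $$ (i, j) = 1\<^sub>m n $$ (i, j)" using k(2)[of i j] by simp
  qed (use UT_D(1)[OF g] UT_D(1)[OF k(1)] in auto)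
  then show ?thesis using k by blast
qed

text \<open>The right inverse \<open>k\<close> has a right inverse \<open>l\<close> of its own, and
  \<open>g = g * k * l = l\<close>; so \<open>k\<close> is two-sided.\<close>

lemma UT_inverse:
  fixes g :: "'s::{ring, monoid_mult} mat"
  assumes g: "g \<in> UT n"
  obtains k where "k \<in> UT n" "mat_inverse_of n g k"
proof -
  obtain k where k: "k \<in> UT n" "g * k = 1\<^sub>m n" using UT_right_inverse[OF g] by blast
  obtain l where l: "l \<in> UT n" "k * l = 1\<^sub>m n" using UT_right_inverse[OF k(1)] by blast
  have "g = g * (k * l)" using l UT_D(1)[OF g] by (simp add: mult_one_mat)
  also have "\<dots> = g * k * l"
    using UT_D(1)[OF g] UT_D(1)[OF k(1)] UT_D(1)[OF l(1)] by simp
  also have "\<dots> = l" using k UT_D(1)[OF l(1)] by (simp add: one_mult_mat)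
  finally have "mat_inverse_of n g k"
    using k l UT_D(1)[OF k(1)] by (simp add: mat_inverse_of_def)
  with that k(1) show ?thesis by blast
qed

text \<open>In the full matrix ring, for \<open>k < n - 1\<close>, the diagonal matrix whose only
  nonzero gap is 1, at \<open>k\<close>.\<close>

definition step_diag :: "nat \<Rightarrow> nat \<Rightarrow> 's::{ring, monoid_mult} mat" where
  "step_diag n k = mat n n (\<lambda>(i, j). if i = j \<and> i \<le> k then 1 else 0)"

lemma step_diag_carrier [simp]: "step_diag n k \<in> carrier_mat n n"
  by (simp add: step_diag_def)

lemma dim_step_diag [simp]: "dim_row (step_diag n k) = n" "dim_col (step_diag n k) = n"
  by (simp_all add: step_diag_def)

lemma step_diag_entry [simp]:
  "i < n \<Longrightarrow> j < n \<Longrightarrow> step_diag n k $$ (i, j) = (if i = j \<and> i \<le> k then 1 else 0)"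
  by (simp add: step_diag_def)

lemma mult_step_diag:
  fixes A :: "'s::{ring, monoid_mult} mat"
  assumes "A \<in> carrier_mat n n" "i < n" "j < n"
  shows "(A * step_diag n k) $$ (i, j) = (if j \<le> k then A $$ (i, j) else 0)"
proof -
  have "(A * step_diag n k) $$ (i, j) = (\<Sum>l<n. A $$ (i, l) * step_diag n k $$ (l, j))"
    using assms by (intro mult_mat_entry) auto
  also have "\<dots> = (\<Sum>l<n. if l = j then (if j \<le> k then A $$ (i, j) else 0) else 0)"
    using assms by (intro sum.cong) auto
  finally show ?thesis using assms by simp
qed

lemma step_diag_commute: "step_diag n k * step_diag n l = step_diag n l * step_diag n k"
  by (intro eq_matI) (auto simp: mult_step_diag[of _ n] simp del: index_mult_mat(1))

text \<open>If \<open>X k * g - g * step_diag n k\<close> is supported from the \<open>r\<close>-th superdiagonal on, then commutativity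
  forces its \<open>(i, i + r)\<close>-entry to be independent of \<open>k\<close> for \<open>i \<le> k < i + r\<close> and \<open>0\<close> for the other \<open>k\<close>;
  subtracting this common value from \<open>g\<close> clears the superdiagonal.\<close>

lemma simultaneous_diagonalization:
  fixes X :: "nat \<Rightarrow> 's::{ring, monoid_mult} mat"
  assumes X: "\<And>k. k < n - 1 \<Longrightarrow> X k \<in> carrier_mat n n"
    and ut: "\<And>k. k < n - 1 \<Longrightarrow> upper_triangular (X k)"
    and diag: "\<And>k i. k < n - 1 \<Longrightarrow> i < n \<Longrightarrow> X k $$ (i, i) = (if i \<le> k then 1 else 0)"
    and comm: "\<And>k l. k < n - 1 \<Longrightarrow> l < n - 1 \<Longrightarrow> X k * X l = X l * X k"
  shows "\<exists>g\<in>UT n. \<forall>k<n - 1. X k * g = g * step_diag n k"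
proof -
  have "\<exists>g\<in>UT n. \<forall>k<n - 1. \<forall>i<n. \<forall>j<n. j < i + Suc r \<longrightarrow>
      (X k * g) $$ (i, j) = (g * step_diag n k) $$ (i, j)" for r
  proof (induction r)
    case 0
    have "(X k * 1\<^sub>m n) $$ (i, j) = (1\<^sub>m n * step_diag n k) $$ (i, j)"
      if "k < n - 1" "i < n" "j < n" "j < i + Suc 0" for k i j
      using that upper_triangularD[OF ut, of k j i] X[of k] diag[of k i]
      unfolding mult_one_mat[OF X[OF that(1)]] one_mult_mat[OF step_diag_carrier]
      by (cases "i = j") (auto simp: step_diag_def)
    then show ?case using one_UT by blast
  next
    case (Suc r)
    then obtain g where g: "g \<in> UT n"
      and eq: "\<And>k i j. k < n - 1 \<Longrightarrow> i < n \<Longrightarrow> j < n \<Longrightarrow> j < i + Suc r \<Longrightarrow>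
        (X k * g) $$ (i, j) = (g * step_diag n k) $$ (i, j)"
      by blast
    note gc = UT_D(1)[OF g]
    define P where "P k = X k * g - g * step_diag n k" for k
    have P: "P k \<in> carrier_mat n n" for k
      unfolding P_def by (intro minus_carrier_mat mult_carrier_mat[OF gc step_diag_carrier])
    have Xg: "X k * g = g * step_diag n k + P k" if "k < n - 1" for k
      using carrier_matD[OF gc] carrier_matD[OF X[OF that]] unfolding P_def by (intro eq_matI) auto
    have Pband: "P k $$ (i, j) = 0" if "k < n - 1" "i < n" "j < n" "j < i + Suc r" for k i j
      using eq[OF that] carrier_matD[OF gc] that unfolding P_def by (simp del: index_mult_mat(1))
    \<comment> \<open>Both orders of multiplication are expanded through \<open>Xg\<close>; by
      commutativity the error terms of the two expansions can then be compared.\<close>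
    have XXg: "X l * X k * g = g * (step_diag n l * step_diag n k) + P l * step_diag n k + X l * P k"
      if "k < n - 1" "l < n - 1" for k l
    proof -
      have "X l * X k * g = X l * (g * step_diag n k + P k)"
        using X that gc by (simp add: assoc_mult_mat[of _ n n _ n _ n] Xg)
      also have "\<dots> = X l * g * step_diag n k + X l * P k"
        using X that gc P by (simp add: mult_add_distrib_mat[of _ n n _ n] assoc_mult_mat[of _ n n _ n _ n])
      also have "X l * g * step_diag n k = g * (step_diag n l * step_diag n k) + P l * step_diag n k"
        using X that gc P by (simp add: Xg add_mult_distrib_mat[of _ n n _ _ n] assoc_mult_mat[of _ n n _ n _ n])
      finally show ?thesis .
    qed
    \<comment> \<open>It suffices to commute \<open>X k\<close> with the matrix whose index is the
      row \<open>i\<close> itself. With \<open>j > i\<close> the comparison at \<open>(i, j)\<close>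
      says that the entry of \<open>P k\<close> is that of \<open>P i\<close> times [i \<le> k] -
      [j \<le> k].\<close>
    have key: "P k $$ (i, j) = (if i \<le> k \<and> k < j then P i $$ (i, j) else 0)"
      if k: "k < n - 1" and ij: "i < n" "j < n" "j = i + Suc r" for k i j
    proof -
      have i: "i < n - 1" using ij by simp
      have XP: "(X l * P m) $$ (i, j) = (if i \<le> l then P m $$ (i, j) else 0)" if "l < n - 1" "m < n - 1" for l m
        using upper_triangular_mult_band[where r = "Suc r", OF X[OF that(1)] ut[OF that(1)] P Pband[OF that(2)] ij(1,2)]
          that ij(3) diag[OF that(1) ij(1)] by simp
      have "g * (step_diag n i * step_diag n k) + P i * step_diag n k + X i * P k = X i * X k * g"
        by (rule XXg[OF k i, symmetric])
      also have "\<dots> = X k * X i * g" by (simp only: comm[OF i k])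
      also have "\<dots> = g * (step_diag n k * step_diag n i) + P k * step_diag n i + X k * P i"
        by (rule XXg[OF i k])
      finally have "(g * (step_diag n i * step_diag n k) + P i * step_diag n k + X i * P k) $$ (i, j)
        = (g * (step_diag n i * step_diag n k) + P k * step_diag n i + X k * P i) $$ (i, j)"
        by (simp only: step_diag_commute[of n k i])
      then have "(P i * step_diag n k) $$ (i, j) + (X i * P k) $$ (i, j)
        = (P k * step_diag n i) $$ (i, j) + (X k * P i) $$ (i, j)"
        using ij(1,2) carrier_matD[OF X[OF i]] carrier_matD[OF X[OF k]] carrier_matD[OF P] carrier_matD[OF gc]
        by (simp add: add.assoc del: index_mult_mat(1))
      then show ?thesis
        using ij(3) unfolding mult_step_diag[OF P ij(1,2)] XP[OF i k] XP[OF k i]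
        by (auto split: if_splits)
    qed
    \<comment> \<open>By \<open>key\<close> the value common to all \<open>k\<close> with
      \<open>i \<le> k < j\<close> is attained at \<open>k = i\<close>.\<close>
    define C where "C = mat n n (\<lambda>(i, j). if j = i + Suc r then P i $$ (i, j) else 0)"
    have C: "C \<in> carrier_mat n n" by (simp add: C_def)
    have band: "C $$ (i, j) = 0" if "i < n" "j < n" "j < i + Suc r" for i j
      using that by (simp add: C_def)
    have "g - C \<in> UT n"
      by (rule UT_minus_band[OF g C]) (simp add: C_def)
    moreover have "\<forall>k<n - 1. \<forall>i<n. \<forall>j<n. j < i + Suc (Suc r) \<longrightarrow>
      (X k * (g - C)) $$ (i, j) = ((g - C) * step_diag n k) $$ (i, j)"
    proof (intro allI impI)
      fix k i j assume k: "k < n - 1" and ij: "i < n" "j < n" "j < i + Suc (Suc r)"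
      have "(X k * C) $$ (i, j) = X k $$ (i, i) * C $$ (i, j)"
        using ij by (intro upper_triangular_mult_band[where r = "Suc r", OF X[OF k] ut[OF k] C band]) auto
      then have XC: "(X k * C) $$ (i, j) = (if i \<le> k then C $$ (i, j) else 0)"
        using diag[OF k] ij by simp
      have "(X k * (g - C)) $$ (i, j) = (X k * g) $$ (i, j) - (X k * C) $$ (i, j)"
        using ij gc X[OF k] C by (subst mult_minus_distrib_mat[of _ n n _ n]) auto
      also have "\<dots> = (g * step_diag n k) $$ (i, j) + P k $$ (i, j) - (X k * C) $$ (i, j)"
        unfolding Xg[OF k] using ij gc P[of k] by (simp del: index_mult_mat(1))
      finally have e1: "(X k * (g - C)) $$ (i, j) =
          (if j \<le> k then g $$ (i, j) else 0) + P k $$ (i, j) - (if i \<le> k then C $$ (i, j) else 0)"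
        unfolding XC mult_step_diag[OF gc ij(1,2)] .
      have e2: "((g - C) * step_diag n k) $$ (i, j) = (if j \<le> k then g $$ (i, j) - C $$ (i, j) else 0)"
        using mult_step_diag[OF minus_carrier_mat[OF C] ij(1,2)] ij(1,2) carrier_matD[OF C] by simp
      have e3: "P k $$ (i, j) = (if i \<le> k \<and> k < j then C $$ (i, j) else 0)"
      proof (cases "j = i + Suc r")
        case True
        have "C $$ (i, j) = P i $$ (i, j)" unfolding C_def using ij(1,2) True by simp
        then show ?thesis unfolding key[OF k ij(1,2) True] by (simp only:)
      next
        case False then show ?thesis using Pband[OF k ij(1,2)] band[OF ij(1,2)] ij(3) by simp
      qed
      have "C $$ (i, j) = 0" if "j \<le> i" using that by (intro band[OF ij(1,2)]) simp
      then show "(X k * (g - C)) $$ (i, j) = ((g - C) * step_diag n k) $$ (i, j)"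
        unfolding e1 e2 e3 by (cases "i \<le> k"; cases "j \<le> k") auto
    qed
    ultimately show ?case by blast
  qed
  from this[of n] obtain g where g: "g \<in> UT n" and eq: "\<And>k i j. k < n - 1 \<Longrightarrow> i < n \<Longrightarrow> j < n \<Longrightarrow> j < i + Suc n \<Longrightarrow>
        (X k * g) $$ (i, j) = (g * step_diag n k) $$ (i, j)" by blast
  have "X k * g = g * step_diag n k" if k: "k < n - 1" for k
  proof (rule eq_matI)
    fix i j assume "i < dim_row (g * step_diag n k)" "j < dim_col (g * step_diag n k)"
    then show "(X k * g) $$ (i, j) = (g * step_diag n k) $$ (i, j)"
      using eq[OF k, of i j] UT_D(1)[OF g] by (simp add: step_diag_def del: index_mult_mat(1))
  qed (use UT_D(1)[OF g] X[OF k] in \<open>auto simp: step_diag_def\<close>)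
  then show ?thesis using g by blast
qed


subsection \<open>The diagonal part\<close>

text \<open>Modulo the next power of the strict ideal, \<open>u\<close> acts on
  \<open>strict n r\<close> through its diagonal alone.\<close>

lemma (in unital_algebra) up_bracket_superdiag:
  assumes u: "u \<in> tri n" and x: "x \<in> strict n r" and ij: "i + r < n"
  shows "up (tri_bracket n sc u x) i (i + r) = sc (dg u i - dg u (i + r)) (up x i (i + r))"
proof -
  have "up u i k * up x k (i + r) - up x i k * up u k (i + r) = 0" if k: "k < n" for k
  proof -
    have "up u i k * up x k (i + r) = 0"
      using up_lower[OF u, of k i] strict_up[OF x, of k "i + r"] k ij by (cases "k \<le> i") auto
    moreover have "up x i k * up u k (i + r) = 0"
      using strict_up[OF x, of i k] up_lower[OF u, of "i + r" k] k ij by (cases "k < i + r") auto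
    ultimately show ?thesis by simp
  qed
  then show ?thesis
    using ij by (simp add: up_bracket[OF u strict_in_tri[OF x]] strict_dg[OF x])
qed

lemma gap_sum_2: "dg x i - dg x (i + 2) = gap x i + gap (x :: ('f::ab_group_add, 'r) tri) (Suc i)"
  by (simp add: gap_def)

text \<open>The gap \<open>i\<close> occurs exactly once in the root of \<open>(i, j)\<close>. Being
  brackets, single entries have strict images and strict preimages under a Lie homomorphism.\<close>

lemma (in unital_algebra) unit_elt_as_bracket:
  assumes "i < j" "j < n"
  shows "tri_bracket n sc (diag_elt n (single i 1)) (unit_elt n i j a) = unit_elt n i j a"
proof -
  have "(\<Sum>k\<in>{i..<j}. single i 1 k) = (1 :: 'f)"
    using assms by (simp add: single_def)
  then show ?thesis using assms by (simp add: bracket_diag_unit sc_one)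
qed

text \<open>An isomorphism of the quotients, written in representatives: \<open>F_last\<close>
  selects the representative in the target, and \<open>F_ker\<close> with \<open>F_scalars\<close>
  says that exactly the scalars are lost.\<close>

locale tri_lift = R: unital_algebra sR + S: unital_algebra sS
  for sR :: "'f::{comm_ring, comm_monoid_mult} \<Rightarrow> 'r::{ring, monoid_mult} \<Rightarrow> 'r"
    and sS :: "'f \<Rightarrow> 's::{ring, monoid_mult} \<Rightarrow> 's" +
  fixes n :: nat and F :: "('f, 'r) tri \<Rightarrow> ('f, 's) tri"
  assumes n3: "3 \<le> n"
    and faithful: "inj (\<lambda>c. sS c 1)"
    and F_in [simp]: "x \<in> tri n \<Longrightarrow> F x \<in> tri n"
    and F_last: "x \<in> tri n \<Longrightarrow> dg (F x) (n - 1) = 0"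
    and F_add: "x \<in> tri n \<Longrightarrow> y \<in> tri n \<Longrightarrow> F (tri_add x y) = tri_add (F x) (F y)"
    and F_scale: "x \<in> tri n \<Longrightarrow> F (tri_scale sR c x) = tri_scale sS c (F x)"
    and F_bracket: "x \<in> tri n \<Longrightarrow> y \<in> tri n \<Longrightarrow>
      F (tri_bracket n sR x y) = tri_bracket n sS (F x) (F y)"
    and F_surj: "z \<in> tri n \<Longrightarrow> dg z (n - 1) = 0 \<Longrightarrow> \<exists>x\<in>tri n. F x = z"
    and F_ker: "x \<in> tri n \<Longrightarrow> F x = tri_of n (\<lambda>_. 0) (\<lambda>_ _. 0) \<Longrightarrow> x \<in> tri_scalars n"
    and F_scalars: "x \<in> tri_scalars n \<Longrightarrow> F x = tri_of n (\<lambda>_. 0) (\<lambda>_ _. 0)"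
begin

lemma n_pos: "0 < n" "Suc 0 < n" "n - 1 < n" using n3 by auto

lemma faithfulD: "sS a 1 = sS b 1 \<Longrightarrow> a = b"
  using faithful by (auto dest: injD)

lemma F_diff:
  assumes "x \<in> tri n" "y \<in> tri n"
  shows "F (tri_diff x y) = tri_diff (F x) (F y)"
proof -
  have "x = tri_add (tri_diff x y) y"
    using assms by (intro tri_eqI[of _ n]) (auto simp: tri_ops[of _ n])
  then have eq: "F x = tri_add (F (tri_diff x y)) (F y)"
    using F_add[of "tri_diff x y" y] assms by simp
  show ?thesis
    unfolding eq using assms by (intro tri_eqI[of _ n]) (auto simp: tri_ops[of _ n])
qed

lemma F_zero: "F (tri_of n (\<lambda>_. 0) (\<lambda>_ _. 0)) = tri_of n (\<lambda>_. 0) (\<lambda>_ _. 0)"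
  using n_pos by (intro F_scalars) (simp add: tri_scalars_iff)

lemma F_strict_1:
  assumes "x \<in> strict n (Suc 0)"
  shows "F x \<in> strict n (Suc 0)"
  using assms zero_less_Suc
proof (induction rule: strict_induct)
  case zero
  then show ?case by (simp add: F_zero strict_def)
next
  case (add x y) then show ?case by (simp add: F_add strict_in_tri strict_add)
next
  case (unit i j a)
  then have "F (unit_elt n i j a) = F (tri_bracket n sR (diag_elt n (single i 1)) (unit_elt n i j a))"
    by (simp add: R.unit_elt_as_bracket)
  also have "\<dots> = tri_bracket n sS (F (diag_elt n (single i 1))) (F (unit_elt n i j a))"
    by (simp add: F_bracket)
  also have "\<dots> \<in> strict n (Suc 0)" using S.bracket_strict[of _ n] by simp
  finally show ?case .
qed

lemma F_strict: "x \<in> strict n (Suc r) \<Longrightarrow> F x \<in> strict n (Suc r)"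
proof (induction r arbitrary: x)
  case 0
  then show ?case by (rule F_strict_1)
next
  case (Suc r)
  from Suc.prems zero_less_Suc show ?case
  proof (induction rule: strict_induct)
    case zero
    then show ?case by (simp add: F_zero strict_def)
  next
    case (add x y) then show ?case by (simp add: F_add strict_in_tri strict_add)
  next
    case (unit i j a)
    \<comment> \<open>The way from \<open>i\<close> to \<open>j\<close> is cut after
      \<open>Suc r\<close> steps; what remains has length at least 1, so each factor falls under a
      case already settled.\<close>
    let ?u = "unit_elt n i (i + Suc r) a" and ?v = "unit_elt n (i + Suc r) j 1"
    have "F (unit_elt n i j a) = tri_bracket n sS (F ?u) (F ?v)"
      using R.bracket_unit_unit[of i "i + Suc r" j n a 1] unit by (simp add: F_bracket[symmetric])
    moreover have "F ?u \<in> strict n (Suc r)" by (intro Suc.IH unit_elt_strict) auto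
    moreover have "F ?v \<in> strict n (Suc 0)" using unit by (intro F_strict_1 unit_elt_strict) auto
    ultimately show ?case using S.bracket_strict_mult[of "F ?u" n "Suc r" "F ?v" "Suc 0"] by simp
  qed
qed

text \<open>\<open>F_surj\<close> alone gives a preimage with unknown diagonal. The bracket of two
  preimages is a preimage that is strict.\<close>

lemma ex_unit_elt:
  assumes "i < j" "j < n"
  shows "\<exists>x\<in>strict n (Suc 0). F x = unit_elt n i j a"
proof -
  obtain u where u: "u \<in> tri n" "F u = diag_elt n (single i 1)"
    using F_surj[of "diag_elt n (single i 1)"] n_pos by auto
  obtain v where v: "v \<in> tri n" "F v = unit_elt n i j a"
    using F_surj[of "unit_elt n i j a"] n_pos by auto
  have "F (tri_bracket n sR u v) = unit_elt n i j a"
    using u v assms by (simp add: F_bracket S.unit_elt_as_bracket)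
  then show ?thesis using R.bracket_strict[OF u(1) v(1)] by auto
qed

lemma ex_unit_elt_2:
  assumes "i + 2 < n"
  shows "\<exists>x\<in>strict n 2. F x = unit_elt n i (i + 2) a"
proof -
  obtain u where u: "u \<in> strict n (Suc 0)" "F u = unit_elt n i (Suc i) a"
    using ex_unit_elt[of i "Suc i" a] assms by (auto simp del: split_paired_Ex)
  obtain v where v: "v \<in> strict n (Suc 0)" "F v = unit_elt n (Suc i) (i + 2) 1"
    using ex_unit_elt[of "Suc i" "i + 2" 1] assms by (auto simp del: split_paired_Ex)
  have "F (tri_bracket n sR u v) = unit_elt n i (i + 2) a"
    using u v assms S.bracket_unit_unit[of i "Suc i" "i + 2" n a 1]
    by (simp add: F_bracket strict_in_tri)
  moreover have "tri_bracket n sR u v \<in> strict n 2"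
    using R.bracket_strict_mult[OF u(1) v(1)] by (simp add: numeral_2_eq_2)
  ultimately show ?thesis by blast
qed

lemma strict_surj:
  assumes "y \<in> strict n (Suc 0)"
  shows "\<exists>x\<in>strict n (Suc 0). F x = y"
  using assms zero_less_Suc
proof (induction rule: strict_induct)
  case zero
  have "tri_of n (\<lambda>_. 0) (\<lambda>_ _. 0) \<in> strict n (Suc 0)" by (simp add: strict_def)
  then show ?case using F_zero by blast
next
  case (add x y)
  then show ?case by (metis F_add strict_add strict_in_tri)
next
  case (unit i j a) then show ?case by (intro ex_unit_elt) auto
qed

section \<open>The matrix induced on the gaps\<close>

definition coef :: "nat \<Rightarrow> nat \<Rightarrow> 'f" where
  "coef j k = gap (F (diag_elt n (single k 1))) j"

lemma gap_strict: "x \<in> strict n r \<Longrightarrow> Suc j < n \<Longrightarrow> gap (x :: ('f, 't::zero) tri) j = 0"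
  by (simp add: gap_def strict_dg)

lemma gap_scalar: "x \<in> tri_scalars n \<Longrightarrow> Suc j < n \<Longrightarrow> gap (x :: ('f, 't::zero) tri) j = 0"
  using n_pos by (auto simp: gap_def tri_scalars_def)

lemma gap_F:
  assumes x: "x \<in> tri n" and j: "j < n - 1"
  shows "gap (F x) j = (\<Sum>k<n - 1. coef j k * gap x k)"
  using x n_pos(1)
proof (induction rule: tri_induct)
  case (scalar s)
  then show ?case using j gap_scalar[OF scalar] by (simp add: F_scalars gap_def)
next
  case (add x y)
  have "gap (F (tri_add x y)) j = gap (F x) j + gap (F y) j"
    using add j by (simp add: F_add gap_add[of _ n])
  also have "\<dots> = (\<Sum>k<n - 1. coef j k * (gap x k + gap y k))"
    using add by (simp add: sum.distrib distrib_left)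
  also have "\<dots> = (\<Sum>k<n - 1. coef j k * gap (tri_add x y) k)"
    using add by (intro sum.cong) (auto simp: gap_add[of _ n])
  finally show ?case .
next
  case (diag k c)
  have "gap (F (diag_elt n (single k c))) j = c * coef j k"
    using j R.diag_elt_single_scale[of c n k 1, symmetric]
    by (simp add: coef_def F_scale gap_def S.dg_scale[of _ n] right_diff_distrib)
  also have "\<dots> = (\<Sum>l<n - 1. if l = k then coef j k * c else 0)"
    using diag by (simp add: mult.commute less_diff_conv)
  also have "\<dots> = (\<Sum>l<n - 1. coef j l * gap (diag_elt n (single k c) :: ('f, 'r) tri) l)"
    by (intro sum.cong) (auto simp: single_def)
  finally show ?case .
next
  case (unit p q a)
  have "F (unit_elt n p q a) \<in> strict n (Suc 0)"
    using unit by (intro F_strict unit_elt_strict) auto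
  then show ?case using j by (simp add: gap_strict)
qed

text \<open>On the superdiagonal, the bracket with \<open>diag_elt n (\<lambda>k. c k * d k)\<close> agrees with the composition
  of the brackets with \<open>diag_elt n c\<close> and \<open>diag_elt n d\<close>, and \<open>F\<close> respects this congruence.\<close>

lemma gap_F_mult:
  assumes j: "j < n - 1"
  shows "gap (F (diag_elt n c)) j * gap (F (diag_elt n d)) j = gap (F (diag_elt n (\<lambda>k. c k * d k))) j"
proof -
  obtain x where x: "x \<in> strict n (Suc 0)" "F x = unit_elt n j (Suc j) 1"
    using ex_unit_elt[of j "Suc j" 1] j by (auto simp: less_diff_conv)
  let ?cd = "\<lambda>k. c k * d k"
  let ?b = "tri_bracket n sR (diag_elt n d) x"
  let ?z = "tri_diff (tri_bracket n sR (diag_elt n c) ?b) (tri_bracket n sR (diag_elt n ?cd) x)"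
  have xt: "x \<in> tri n" using x strict_in_tri by blast
  have b: "?b \<in> strict n (Suc 0)" using R.bracket_strict[of _ n x] xt by simp
  have z: "?z \<in> strict n (Suc 0)"
    using R.bracket_strict[of _ n x] R.bracket_strict[of _ n ?b] xt by (intro strict_diff) simp_all
  have "up ?z p (Suc p) = 0" if "Suc p < n" for p
  proof -
    have "up ?z p (Suc p) = sR (c p) (sR (d p) (up x p (Suc p))) - sR (c p * d p) (up x p (Suc p))"
      using that xt R.up_bracket_superdiag[OF _ x(1), of _ p] R.up_bracket_superdiag[OF _ b, of _ p]
      by (simp add: up_diff[of _ n] gap_def[symmetric] del: dg_diag_elt)
    then show ?thesis by (simp add: R.sc_sc)
  qed
  then have "?z \<in> strict n (Suc (Suc 0))"
    using z unfolding strict_def by (auto simp: less_Suc_eq)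
  then have Fz: "F ?z \<in> strict n (Suc (Suc 0))" by (rule F_strict)
  let ?e = "unit_elt n j (Suc j) 1 :: ('f, 's) tri"
  let ?c = "F (diag_elt n c)" and ?d = "F (diag_elt n d)" and ?f = "F (diag_elt n ?cd)"
  have e: "?e \<in> strict n (Suc 0)" by (intro unit_elt_strict) auto
  have be: "tri_bracket n sS ?d ?e \<in> strict n (Suc 0)"
    using S.bracket_strict[of ?d n ?e] by simp
  have "F ?z = tri_diff (tri_bracket n sS ?c (tri_bracket n sS ?d ?e)) (tri_bracket n sS ?f ?e)"
    using xt x(2) by (simp add: F_diff F_bracket)
  then have "0 = up (tri_diff (tri_bracket n sS ?c (tri_bracket n sS ?d ?e)) (tri_bracket n sS ?f ?e)) j (Suc j)"
    using strict_up[OF Fz, of j "Suc j"] j by simp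
  also have "\<dots> = sS (gap ?c j) (sS (gap ?d j) 1) - sS (gap ?f j) 1"
    using j S.up_bracket_superdiag[OF _ e, of _ j] S.up_bracket_superdiag[OF _ be, of _ j]
    by (simp add: up_diff[of _ n] gap_def)
  finally have "sS (gap ?c j * gap ?d j) 1 = sS (gap ?f j) 1" by (simp add: S.sc_sc)
  then show ?thesis by (rule faithfulD)
qed

text \<open>With all gaps 1, a diagonal matrix acts as the identity on the superdiagonal modulo
  higher ones, and \<open>F\<close> respects this congruence.\<close>

lemma gap_F_one:
  assumes j: "j < n - 1"
  shows "gap (F (diag_elt n (\<lambda>_. 1))) j = 1"
proof -
  obtain x where x: "x \<in> strict n (Suc 0)" "F x = unit_elt n j (Suc j) 1"
    using ex_unit_elt[of j "Suc j" 1] j by (auto simp: less_diff_conv)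
  let ?z = "tri_diff (tri_bracket n sR (diag_elt n (\<lambda>_. 1)) x) x"
  have xt: "x \<in> tri n" using x strict_in_tri by blast
  have z: "?z \<in> strict n (Suc 0)"
    using R.bracket_strict[of _ n x] x xt by (intro strict_diff) simp_all
  have "up ?z p (Suc p) = 0" if "Suc p < n" for p
  proof -
    have "up ?z p (Suc p) = sR 1 (up x p (Suc p)) - up x p (Suc p)"
      using that xt R.up_bracket_superdiag[OF _ x(1), of _ p]
      by (simp add: up_diff[of _ n] gap_def[symmetric] del: dg_diag_elt)
    then show ?thesis by (simp add: R.sc_one)
  qed
  then have "?z \<in> strict n (Suc (Suc 0))"
    using z unfolding strict_def by (auto simp: less_Suc_eq)
  then have Fz: "F ?z \<in> strict n (Suc (Suc 0))" by (rule F_strict)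
  let ?e = "unit_elt n j (Suc j) 1 :: ('f, 's) tri" and ?f = "F (diag_elt n (\<lambda>_. 1))"
  have e: "?e \<in> strict n (Suc 0)" by (intro unit_elt_strict) auto
  have "F ?z = tri_diff (tri_bracket n sS ?f ?e) ?e"
    using xt x(2) by (simp add: F_diff F_bracket)
  then have "0 = up (tri_diff (tri_bracket n sS ?f ?e) ?e) j (Suc j)"
    using strict_up[OF Fz, of j "Suc j"] j by simp
  also have "\<dots> = sS (gap ?f j) 1 - 1"
    using j S.up_bracket_superdiag[OF _ e, of _ j] by (simp add: up_diff[of _ n] gap_def)
  finally have "sS (gap ?f j) 1 = sS 1 1" by (simp add: S.sc_one)
  then show ?thesis by (rule faithfulD)
qed

text \<open>By \<open>gap_F_mult\<close> and \<open>gap_F_one\<close>, sending gaps \<open>c\<close>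
  to the \<open>j\<close>-th gap of the image is a unital ring homomorphism from a power of Phi to
  Phi. Row \<open>j\<close> consists of the images of the standard idempotents, hence is a complete
  orthogonal system.\<close>

lemma coef_idem: "j < n - 1 \<Longrightarrow> coef j k * coef j k = coef j k"
  using gap_F_mult[of j "single k 1" "single k 1"]
  by (simp add: coef_def single_def[abs_def] if_distrib[of "\<lambda>t. t * _"] cong: if_cong)

lemma coef_row: "j < n - 1 \<Longrightarrow> k \<noteq> l \<Longrightarrow> coef j k * coef j l = 0"
proof -
  assume j: "j < n - 1" and kl: "k \<noteq> l"
  have "(\<lambda>i. single k 1 i * single l 1 i) = (\<lambda>_. 0 :: 'f)"
    using kl by (auto simp: single_def)
  then show ?thesis
    using gap_F_mult[OF j, of "single k 1" "single l 1"] gap_F[OF diag_elt_in j, of "\<lambda>_. 0"]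
    by (simp add: coef_def)
qed

lemma coef_row_sum: "j < n - 1 \<Longrightarrow> (\<Sum>k<n - 1. coef j k) = 1"
  using gap_F_one[of j] gap_F[OF diag_elt_in, of j "\<lambda>_. 1"] by simp

text \<open>Surjectivity enters here. Multiplied by the idempotent \<open>coef i k\<close>, row
  \<open>i\<close> becomes the \<open>k\<close>-th unit vector and the gap of \<open>F y\<close> is
  \<open>gap y k\<close>. For a \<open>y\<close> whose image has its only nonzero gap at
  \<open>j\<close>, this element acts as 1 on \<open>coef j k\<close> and as 0 on
  \<open>coef j' k\<close>.\<close>

lemma coef_column:
  assumes "j < n - 1" "j' < n - 1" "k < n - 1" "j \<noteq> j'"
  shows "coef j k * coef j' k = 0"
proof -
  obtain y where y: "y \<in> tri n" "F y = diag_elt n (single j 1)"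
    using F_surj[of "diag_elt n (single j 1)"] n_pos by auto
  have *: "coef i k * gap y k = coef i k * single j 1 i" if i: "i < n - 1" for i
  proof -
    have "coef i k * single j 1 i = coef i k * (\<Sum>l<n - 1. coef i l * gap y l)"
      using gap_F[OF y(1) i] y(2) i by simp
    also have "\<dots> = (\<Sum>l<n - 1. if l = k then coef i k * gap y k else 0)"
      unfolding sum_distrib_left using coef_idem[OF i] coef_row[OF i, of k]
      by (intro sum.cong) (auto simp: mult.assoc[symmetric])
    finally show ?thesis using assms by simp
  qed
  have "coef j k * coef j' k = (coef j k * gap y k) * coef j' k"
    using *[of j] assms by (simp add: single_def)
  also have "\<dots> = coef j k * (coef j' k * gap y k)" by (simp add: mult_ac)
  also have "\<dots> = 0" using *[of j'] assms by (simp add: single_def)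
  finally show ?thesis .
qed

text \<open>Injectivity enters here. The defect \<open>c\<close> is annihilated by the whole column,
  so the diagonal matrix with gap \<open>c\<close> at \<open>k\<close> has a strict image; it then
  differs from a strict matrix by a scalar, which forces \<open>c = 0\<close>.\<close>

lemma coef_column_sum:
  assumes k: "k < n - 1"
  shows "(\<Sum>j<n - 1. coef j k) = 1"
proof -
  define c where "c = 1 - (\<Sum>j<n - 1. coef j k)"
  let ?x = "diag_elt n (single k c) :: ('f, 'r) tri"
  have gap0: "gap (F ?x) j = 0" if j: "j < n - 1" for j
  proof -
    have "coef j k * (\<Sum>i<n - 1. coef i k) = (\<Sum>i<n - 1. if i = j then coef j k else 0)"
      unfolding sum_distrib_left using coef_idem[OF j] coef_column[OF j _ k]
      by (intro sum.cong) auto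
    then have "coef j k * c = 0" using j by (simp add: c_def right_diff_distrib)
    moreover have "gap (F ?x) j = (\<Sum>l<n - 1. if l = k then coef j k * c else 0)"
      unfolding gap_F[OF diag_elt_in j] by (intro sum.cong) (auto simp: single_def)
    ultimately show ?thesis by simp
  qed
  \<comment> \<open>\<open>unit_elt n 0 1 0\<close> is the zero matrix: equal gaps and last entry 0
    make the whole diagonal 0.\<close>
  have "dg (F ?x) i = 0" if "i < n" for i
    using gap_eq_imp_dg_diff_const[of n "F ?x" "F ?x" i] that
      gap_eq_imp_dg_diff_const[of n "F ?x" "unit_elt n 0 1 0 :: ('f, 's) tri" i] gap0 F_last[of ?x] n_pos
    by simp
  then have "F ?x \<in> strict n (Suc 0)" by (simp add: strict_1_iff)
  then obtain y where y: "y \<in> strict n (Suc 0)" "F y = F ?x" using strict_surj by blast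
  have "F (tri_diff ?x y) = tri_of n (\<lambda>_. 0) (\<lambda>_ _. 0)"
    using y strict_in_tri[OF y(1)] by (simp add: F_diff) (intro tri_eqI[of _ n], auto simp: tri_ops[of _ n])
  then have "tri_diff ?x y \<in> tri_scalars n" using strict_in_tri[OF y(1)] by (intro F_ker) auto
  then have "gap (tri_diff ?x y) k = 0" using k by (intro gap_scalar) auto
  moreover have "gap (tri_diff ?x y) k = gap ?x k - gap y k"
    using k strict_in_tri[OF y(1)] by (simp add: gap_def dg_diff[of _ n] del: dg_diag_elt)
  ultimately have "c = 0" using k gap_strict[OF y(1), of k] by (simp add: single_def)
  then show ?thesis by (simp add: c_def)
qed

text \<open>For \<open>k\<close>, \<open>l\<close> not adjacent no position \<open>(i, i + 2)\<close> carries both the weights \<open>k\<close> and \<open>l\<close>.\<close>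

lemma coef_adjacent:
  assumes j: "j + 2 < n" and k: "k < n - 1" and kl: "k \<noteq> l" "Suc k \<noteq> l" "Suc l \<noteq> k"
  shows "coef j k * coef (Suc j) l = 0"
proof -
  obtain x where x: "x \<in> strict n 2" "F x = unit_elt n j (j + 2) 1"
    using ex_unit_elt_2[OF j] by blast
  let ?k = "diag_elt n (single k 1) :: ('f, 'r) tri" and ?l = "diag_elt n (single l 1) :: ('f, 'r) tri"
  let ?b = "tri_bracket n sR ?l x"
  let ?z = "tri_bracket n sR ?k ?b"
  have xt: "x \<in> tri n" using x strict_in_tri by blast
  have bracket2: "tri_bracket n sR u y \<in> strict n 2" if "y \<in> strict n 2" "u = diag_elt n c" for y u c
    using that R.up_bracket_diag[of y n _ _ c] strict_in_tri[OF that(1)] strict_up[OF that(1)] 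
    by (simp add: strict_def R.dg_bracket[of _ n] del: dg_diag_elt)
  have b: "?b \<in> strict n 2" by (rule bracket2[OF x(1) refl])
  have z: "?z \<in> strict n 2" by (rule bracket2[OF b refl])
  have "up ?z p (p + 2) = 0" if p: "p + 2 < n" for p
  proof -
    have "up ?z p (p + 2) = sR (single k 1 p + single k 1 (Suc p)) (sR (single l 1 p + single l 1 (Suc p)) (up x p (p + 2)))"
      using p R.up_bracket_superdiag[OF _ x(1) p] R.up_bracket_superdiag[OF _ b p]
      by (simp add: gap_sum_2[simplified] del: dg_diag_elt)
    moreover have "(single k 1 p + single k 1 (Suc p)) * (single l 1 p + single l 1 (Suc p)) = (0 :: 'f)"
      using kl by (auto simp: single_def)
    ultimately show ?thesis by (simp add: R.sc_sc)
  qed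
  then have "?z \<in> strict n (Suc (Suc (Suc 0)))"
    using z unfolding strict_def by (auto simp: less_Suc_eq numeral_2_eq_2)
  then have Fz: "F ?z \<in> strict n (Suc (Suc (Suc 0)))" by (rule F_strict)
  let ?e = "unit_elt n j (j + 2) 1 :: ('f, 's) tri"
  have e: "?e \<in> strict n 2" by (intro unit_elt_strict) auto
  have "F ?b \<in> strict n 2" using F_strict[of ?b 1] b by (simp add: numeral_2_eq_2)
  moreover have "F ?b = tri_bracket n sS (F ?l) ?e" using x xt by (simp add: F_bracket)
  ultimately have be: "tri_bracket n sS (F ?l) ?e \<in> strict n 2" by simp
  have "F ?z = tri_bracket n sS (F ?k) (tri_bracket n sS (F ?l) ?e)"
    using x xt by (simp add: F_bracket)
  then have "0 = up (tri_bracket n sS (F ?k) (tri_bracket n sS (F ?l) ?e)) j (j + 2)"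
    using strict_up[OF Fz, of j "j + 2"] j by simp
  also have "\<dots> = sS (coef j k + coef (Suc j) k) (sS (coef j l + coef (Suc j) l) 1)"
    using j S.up_bracket_superdiag[OF _ e j] S.up_bracket_superdiag[OF _ be j]
    by (simp add: gap_sum_2[simplified] coef_def)
  finally have "sS ((coef j k + coef (Suc j) k) * (coef j l + coef (Suc j) l)) 1 = sS 0 1"
    by (simp add: S.sc_sc)
  then have 0: "(coef j k + coef (Suc j) k) * (coef j l + coef (Suc j) l) = 0" by (rule faithfulD)
  \<comment> \<open>The idempotent \<open>coef j k\<close> kills the other three products by
    orthogonality in row \<open>j\<close> and in column \<open>k\<close>.\<close>
  have "coef j k * coef (Suc j) l =
      coef j k * ((coef j k + coef (Suc j) k) * (coef j l + coef (Suc j) l))"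
    using coef_idem[of j k] coef_row[of j k l] coef_column[of j "Suc j" k] j kl(1) k
    by (simp add: distrib_left distrib_right mult.assoc[symmetric])
  then show ?thesis using 0 by simp
qed

section \<open>From adjacency to the identity and the reversal\<close>

lemma coef_step:
  assumes "j + 2 < n" "k < n - 1" "l < n - 1" "Suc k \<noteq> l" "Suc l \<noteq> k"
  shows "coef j k * coef (Suc j) l = 0"
  using coef_adjacent[of j k l] coef_column[of j "Suc j" k] assms by (cases "k = l") auto

text \<open>Locally on \<open>c\<close>, row \<open>j\<close> is the unit vector at
  \<open>k\<close>; this replaces the statement that a permutation sends \<open>j\<close> to
  \<open>k\<close>.\<close>

lemma mult_row_sum:
  assumes "j < n - 1" "k < n - 1" "\<And>l. l < n - 1 \<Longrightarrow> l \<noteq> k \<Longrightarrow> c * coef j l = 0"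
  shows "c * coef j k = c"
proof -
  have "c = (\<Sum>l<n - 1. c * coef j l)"
    using coef_row_sum[OF assms(1)] by (simp add: sum_distrib_left[symmetric])
  also have "\<dots> = (\<Sum>l<n - 1. if l = k then c * coef j k else 0)"
    using assms(3) by (intro sum.cong) auto
  finally show ?thesis using assms(2) by simp
qed

text \<open>A local permutation carrying an inner index to the end point \<open>0\<close> would have to send both of its
  neighbours to \<open>1\<close>.\<close>

lemma coef_0_middle:
  assumes "0 < j" "j < n - 2"
  shows "coef j 0 = 0"
proof -
  have up: "coef j 0 * coef (Suc j) 1 = coef j 0"
    using assms coef_step[of j 0] by (intro mult_row_sum) auto
  have down: "coef j 0 * coef (j - 1) 1 = coef j 0"
    using assms coef_step[of "j - 1" _ 0] by (intro mult_row_sum) (auto simp: mult.commute)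
  have "coef j 0 = coef j 0 * (coef (Suc j) 1 * coef (j - 1) 1)"
    using up down by (simp add: mult.assoc[symmetric])
  also have "\<dots> = 0" using assms coef_column[of "Suc j" "j - 1" 1] by simp
  finally show ?thesis .
qed

definition h :: 'f where "h = coef 0 0"

lemma h_idem: "h * h = h"
  unfolding h_def using n3 by (intro coef_idem) auto

text \<open>Column 0 sums to 1 and its inner entries vanish, which leaves the two end rows.\<close>

lemma one_minus_h: "1 - h = coef (n - 2) 0"
proof -
  have "1 = (\<Sum>j<n - 1. coef j 0)" using coef_column_sum[of 0] n3 by simp
  also have "\<dots> = (\<Sum>j\<in>{0, n - 2}. coef j 0)"
  proof (rule sum.mono_neutral_right)
    show "\<forall>j\<in>{..<n - 1} - {0, n - 2}. coef j 0 = 0"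
    proof
      fix j assume "j \<in> {..<n - 1} - {0, n - 2}"
      then have "0 < j" "j < n - 2" by auto
      then show "coef j 0 = 0" by (rule coef_0_middle)
    qed
  qed (use n3 in auto)
  also have "\<dots> = h + coef (n - 2) 0" using n3 by (simp add: h_def)
  finally show ?thesis by (simp add: algebra_simps)
qed

text \<open>On \<open>h\<close> the rows are determined one after the other. In row
  \<open>j\<close>, columns \<open>l < j\<close> are already occupied by row \<open>l\<close>, and
  columns \<open>l > j\<close> are not adjacent to \<open>j - 1\<close>, the column of the previous
  row.\<close>

lemma h_coef: "j < n - 1 \<Longrightarrow> l < n - 1 \<Longrightarrow> h * coef j l = (if j = l then h else 0)"
proof (induction j arbitrary: l rule: less_induct)
  case (less j)
  have off: "h * coef j l = 0" if l: "l < n - 1" "l \<noteq> j" for l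
  proof (cases "l < j")
    case True
    then have "h * coef j l = h * coef l l * coef j l" using less.IH[of l l] l by simp
    then show ?thesis using coef_column[of l j l] less.prems l by (simp add: mult.assoc)
  next
    case False
    show ?thesis
    proof (cases j)
      case 0 then show ?thesis using coef_row[of 0 0 l] l n3 by (simp add: h_def)
    next
      case (Suc i)
      then have "h * coef j l = h * coef i i * coef j l" using less.IH[of i i] less.prems by simp
      then show ?thesis
        using coef_step[of i i l] Suc False less.prems l by (simp add: mult.assoc)
    qed
  qed
  show ?case
    using off less.prems mult_row_sum[of j j h] by (cases "l = j") auto
qed

lemma one_minus_h_coef:
  "j < n - 1 \<Longrightarrow> l < n - 1 \<Longrightarrow> (1 - h) * coef (n - 2 - j) l = (if j = l then 1 - h else 0)"
proof (induction j arbitrary: l rule: less_induct)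
  case (less j)
  have off: "(1 - h) * coef (n - 2 - j) l = 0" if l: "l < n - 1" "l \<noteq> j" for l
  proof (cases "l < j")
    case True
    then have "(1 - h) * coef (n - 2 - j) l = (1 - h) * coef (n - 2 - l) l * coef (n - 2 - j) l"
      using less.IH[of l l] l by simp
    then show ?thesis
      using coef_column[of "n - 2 - l" "n - 2 - j" l] less.prems l by (simp add: mult.assoc)
  next
    case False
    show ?thesis
    proof (cases j)
      case 0 then show ?thesis using coef_row[of "n - 2" 0 l] l n3 by (simp add: one_minus_h)
    next
      case (Suc i)
      then have "(1 - h) * coef (n - 2 - j) l = (1 - h) * coef (n - 2 - i) i * coef (n - 2 - j) l"
        using less.IH[of i i] less.prems by simp
      \<comment> \<open>The recursion descends through the rows whereas \<open>coef_step\<close>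
        goes from a row to its successor; hence the exchange of the factors.\<close>
      also have "\<dots> = (1 - h) * (coef (n - 2 - j) l * coef (n - 2 - i) i)" by (simp add: mult_ac)
      also have "n - 2 - i = Suc (n - 2 - j)" using Suc less.prems by simp
      also have "coef (n - 2 - j) l * coef (Suc (n - 2 - j)) i = 0"
        using Suc False less.prems l by (intro coef_step) auto
      finally show ?thesis by simp
    qed
  qed
  show ?case
    using off less.prems mult_row_sum[of "n - 2 - j" j "1 - h"] n3 by (cases "l = j") auto
qed

lemma gap_F_eq:
  assumes x: "x \<in> tri n" and j: "j < n - 1"
  shows "gap (F x) j = h * gap x j + (1 - h) * gap x (n - 2 - j)"
proof -
  have "h * coef j k * gap x k = (if k = j then h * gap x j else 0)" if "k < n - 1" for k
    using h_coef[OF j that] by simp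
  then have "h * gap (F x) j = (\<Sum>k<n - 1. if k = j then h * gap x j else 0)"
    unfolding gap_F[OF x j] sum_distrib_left by (intro sum.cong) (auto simp: mult.assoc)
  then have 1: "h * gap (F x) j = h * gap x j" using j by simp
  define j' where "j' = n - 2 - j"
  have j': "j' < n - 1" "n - 2 - j' = j" using j n3 by (auto simp: j'_def)
  have "(1 - h) * coef j k * gap x k = (if k = j' then (1 - h) * gap x j' else 0)"
    if "k < n - 1" for k
    using one_minus_h_coef[OF j'(1) that] unfolding j'(2) by simp
  then have "(1 - h) * gap (F x) j = (\<Sum>k<n - 1. if k = j' then (1 - h) * gap x j' else 0)"
    unfolding gap_F[OF x j] sum_distrib_left by (intro sum.cong) (auto simp: mult.assoc)
  then have 2: "(1 - h) * gap (F x) j = (1 - h) * gap x (n - 2 - j)" using j'(1) by (simp add: j'_def)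
  have "gap (F x) j = h * gap (F x) j + (1 - h) * gap (F x) j"
    by (simp add: left_diff_distrib)
  then show ?thesis using 1 2 by simp
qed

end


subsection \<open>Multiplicative families\<close>

lemma (in unital_algebra) sc_idem_mult:
  assumes "e * e = e"
  shows "sc e (x * y) = sc e x * sc e y"
proof -
  have "sc e x * sc e y = sc e (sc e (x * y))" by (simp only: sc_mult_left[symmetric] sc_mult_right[symmetric])
  then show ?thesis by (simp add: sc_sc assms)
qed

text \<open>The ideal \<open>range (sc e)\<close> is itself a unital ring, with identity
  \<open>sc e 1\<close>.\<close>

lemma (in unital_algebra) mult_sc_one:
  assumes "e * e = e" "x \<in> range (sc e)"
  shows "x * sc e 1 = x" "sc e 1 * x = x" "sc e x = x"
proof -
  obtain y where y: "x = sc e y" using assms by blast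
  show 1: "sc e x = x" using y assms by (simp add: sc_sc)
  show "x * sc e 1 = x" using 1 sc_mult_right[of e x 1] by simp
  show "sc e 1 * x = x" using 1 sc_mult_left[of e 1 x] by simp
qed

lemma (in unital_algebra) range_sc_mult:
  "x \<in> range (sc e) \<Longrightarrow> x * y \<in> range (sc e)"
  by (auto simp: sc_mult_left[symmetric])

lemma (in unital_algebra) range_sc_diff:
  "x \<in> range (sc e) \<Longrightarrow> y \<in> range (sc e) \<Longrightarrow> x - y \<in> range (sc e)"
  by (auto simp: sc_diff_right[symmetric])

text \<open>The multiplication \<open>mu\<close> is that of the algebra or of its opposite.\<close>

lemma multiplicative_family:
  fixes sR :: "'f::{comm_ring, comm_monoid_mult} \<Rightarrow> 'r::{ring, monoid_mult} \<Rightarrow> 'r"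
    and sS :: "'f \<Rightarrow> 's::{ring, monoid_mult} \<Rightarrow> 's"
    and mu :: "'r \<Rightarrow> 'r \<Rightarrow> 'r" and f :: "nat \<Rightarrow> nat \<Rightarrow> 'r \<Rightarrow> 's"
  assumes "unital_algebra sR" "unital_algebra sS" and e: "e * e = e" and n: "3 \<le> n"
    and mu_one: "\<And>a. mu a 1 = a" "\<And>a. mu 1 a = a"
    and add: "\<And>i j a b. i < j \<Longrightarrow> j < n \<Longrightarrow> f i j (a + b) = f i j a + f i j b"
    and scale: "\<And>i j c a. i < j \<Longrightarrow> j < n \<Longrightarrow> f i j (sR c a) = sS c (f i j a)"
    and bij: "\<And>i j. i < j \<Longrightarrow> j < n \<Longrightarrow> bij_betw (f i j) (range (sR e)) (range (sS e))"
    and cut: "\<And>i j a. i < j \<Longrightarrow> j < n \<Longrightarrow> f i j (sR e a) = f i j a"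
    and mult: "\<And>i j k a b. i < j \<Longrightarrow> j < k \<Longrightarrow> k < n \<Longrightarrow> f i k (mu a b) = f i j a * f j k b"
  obtains \<psi> d d' where
    "bij_betw \<psi> (range (sR e)) (range (sS e))"
    "\<And>a b. \<psi> (a + b) = \<psi> a + \<psi> b"
    "\<And>c a. \<psi> (sR c a) = sS c (\<psi> a)"
    "\<And>a b. \<psi> (mu a b) = \<psi> a * \<psi> b"
    "\<And>a. \<psi> (sR e a) = \<psi> a"
    "\<And>i. i < n \<Longrightarrow> d i \<in> range (sS e) \<and> d' i \<in> range (sS e)
      \<and> d i * d' i = sS e 1 \<and> d' i * d i = sS e 1"
    "\<And>i j a. i < j \<Longrightarrow> j < n \<Longrightarrow> f i j a = d i * \<psi> a * d' j"
proof -
  interpret R: unital_algebra sR by fact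
  interpret S: unital_algebra sS by fact
  define E where "E = sS e 1"
  have E: "x * E = x" "E * x = x" if "x \<in> range (sS e)" for x
    using S.mult_sc_one[OF e that] by (simp_all add: E_def)
  have f_range: "f i j a \<in> range (sS e)" if "i < j" "j < n" for i j a
    using bij_betwE[OF bij[OF that]] cut[OF that, of a] by (metis rangeI)
  have E_range: "E \<in> range (sS e)" by (simp add: E_def)
  have f_zero_iff: "f i j a = 0 \<longleftrightarrow> sR e a = 0" if "i < j" "j < n" for i j a
  proof -
    have "f i j 0 = 0" using scale[OF that, of 0 0] by simp
    then have "f i j a = 0 \<longleftrightarrow> f i j (sR e a) = f i j (sR e 0)"
      using cut[OF that] by simp
    also have "\<dots> \<longleftrightarrow> sR e a = sR e 0"
      by (rule inj_on_eq_iff[OF bij_betw_imp_inj_on[OF bij[OF that]]]) (rule rangeI)+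
    finally show ?thesis by simp
  qed
  define u where "u i j = f i j 1" for i j
  have u_range: "u i j \<in> range (sS e)" if "i < j" "j < n" for i j
    using f_range[OF that] by (simp add: u_def)
  have u_left: "f i k a = u i j * f j k a" if "i < j" "j < k" "k < n" for i j k a
    using mult[OF that, of 1 a] by (simp add: mu_one u_def)
  have u_right: "f i k a = f i j a * u j k" if "i < j" "j < k" "k < n" for i j k a
    using mult[OF that, of a 1] by (simp add: mu_one u_def)
  have onto': "\<exists>a. f i j a = s" if "i < j" "j < n" "s \<in> range (sS e)" for i j s
  proof -
    have "s \<in> f i j ` range (sR e)"
      unfolding bij_betw_imp_surj_on[OF bij[OF that(1,2)]] by (rule that(3))
    then show ?thesis by blast
  qed
  have onto: "\<exists>a. f i j a = E" if "i < j" "j < n" for i j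
    by (rule onto'[OF that E_range])
  \<comment> \<open>Surjectivity of \<open>f i k\<close> yields the right inverse \<open>v\<close>.
    Its defect \<open>v * u i j - E\<close> is a value \<open>f j k b\<close>; multiplication by
    \<open>u i j\<close> on the left kills it and turns it into \<open>f i k b\<close>, so
    injectivity of \<open>f i k\<close> gives \<open>b\<close> the \<open>e\<close>-part 0.\<close>
  have unit_left: "\<exists>v\<in>range (sS e). u i j * v = E \<and> v * u i j = E" if ijk: "i < j" "j < k" "k < n" for i j k
  proof -
    have jn: "j < n" and ik: "i < k" using ijk by auto
    obtain a where a: "f i k a = E" using onto[OF ik ijk(3)] by blast
    define v where "v = f j k a"
    have v: "v \<in> range (sS e)" using f_range ijk by (simp add: v_def)
    have uv: "u i j * v = E" using a u_left[OF ijk] by (simp add: v_def)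
    have "v * u i j - E \<in> range (sS e)"
      using v E_range by (intro S.range_sc_diff S.range_sc_mult)
    then obtain b where b: "f j k b = v * u i j - E" using onto'[OF ijk(2,3)] by blast
    have "f i k b = u i j * v * u i j - u i j * E"
      using u_left[OF ijk] b by (simp add: right_diff_distrib mult.assoc)
    also have "\<dots> = 0" using uv E[OF u_range[OF ijk(1) jn]] by simp
    finally have "f j k b = 0" using f_zero_iff[OF ik ijk(3)] f_zero_iff[OF ijk(2,3)] by simp
    then show ?thesis using uv v b by auto
  qed
  have unit_right: "\<exists>v\<in>range (sS e). u j k * v = E \<and> v * u j k = E" if ijk: "i < j" "j < k" "k < n" for i j k
  proof -
    have jn: "j < n" and ik: "i < k" using ijk by auto
    obtain a where a: "f i k a = E" using onto[OF ik ijk(3)] by blast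
    define v where "v = f i j a"
    have v: "v \<in> range (sS e)" using f_range[OF ijk(1) jn] by (simp add: v_def)
    have vu: "v * u j k = E" using a u_right[OF ijk] by (simp add: v_def)
    have "u j k * v - E \<in> range (sS e)"
      using u_range[OF ijk(2,3)] E_range by (intro S.range_sc_diff S.range_sc_mult)
    then obtain b where b: "f i j b = u j k * v - E" using onto'[OF ijk(1) jn] by blast
    have "f i k b = u j k * (v * u j k) - E * u j k"
      using u_right[OF ijk] b by (simp add: left_diff_distrib mult.assoc)
    also have "\<dots> = 0" using vu E[OF u_range[OF ijk(2,3)]] by simp
    finally have "f i j b = 0" using f_zero_iff[OF ik ijk(3)] f_zero_iff[OF ijk(1) jn] by simp
    then show ?thesis using vu v b by auto
  qed
  \<comment> \<open>Before the last column \<open>unit_left\<close> finds a third index on the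
    right. For the corner there is none on either side, and \<open>u 0 j\<close> is split at 1,
    which lies strictly between because \<open>n \<ge> 3\<close>.\<close>
  have "\<exists>v\<in>range (sS e). u 0 j * v = E \<and> v * u 0 j = E" if j: "0 < j" "j < n" for j
  proof (cases "j = n - 1")
    case False
    then show ?thesis using unit_left[of 0 j "n - 1"] j by auto
  next
    case True
    have 1: "0 < (1::nat)" "1 < j" using n True by auto
    obtain v where v: "v \<in> range (sS e)" "u 0 1 * v = E" "v * u 0 1 = E"
      using unit_left[of 0 1 2] n by auto
    obtain w where w: "w \<in> range (sS e)" "u 1 j * w = E" "w * u 1 j = E"
      using unit_right[of 0 1 j] j 1 by blast
    have eq: "u 0 j = u 0 1 * u 1 j" using u_left[of 0 1 j 1] n True by (simp add: u_def)
    have ur: "u 0 1 \<in> range (sS e)" "u 1 j \<in> range (sS e)" using u_range n True by auto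
    have "u 0 j * (w * v) = u 0 1 * (u 1 j * w) * v" by (simp add: eq mult.assoc)
    then have "u 0 j * (w * v) = E" using w(2) v(2) E ur by simp
    moreover have "w * v * u 0 j = w * (v * u 0 1) * u 1 j" by (simp add: eq mult.assoc)
    then have "w * v * u 0 j = E" using v(3) w E ur by simp
    ultimately show ?thesis using S.range_sc_mult[OF w(1)] by blast
  qed
  then obtain v where v: "\<And>j. 0 < j \<Longrightarrow> j < n \<Longrightarrow>
      v j \<in> range (sS e) \<and> u 0 j * v j = E \<and> v j * u 0 j = E" by metis
  \<comment> \<open>A common unit could be shifted between \<open>\<psi>\<close> and the factors;
    \<open>d 0 = E\<close> removes this freedom. As then \<open>\<psi> 1 = E\<close>, row 0 forces
    \<open>d' j = u 0 j\<close>.\<close>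
  define d where "d i = (if i = 0 then E else v i)" for i
  define d' where "d' i = (if i = 0 then E else u 0 i)" for i
  have d: "d i \<in> range (sS e) \<and> d' i \<in> range (sS e) \<and> d i * d' i = E \<and> d' i * d i = E"
    if "i < n" for i
    using that v[of i] u_range[of 0 i] E_range E[OF E_range] by (auto simp: d_def d'_def)
  have n1: "0 < (1::nat)" "1 < n" using n by auto
  define \<psi> where "\<psi> a = f 0 1 a * d 1" for a
  have \<psi>_range: "\<psi> a \<in> range (sS e)" for a
    using f_range[OF n1] by (simp add: \<psi>_def S.range_sc_mult)
  have f_0: "f 0 j a = \<psi> a * d' j" if j: "0 < j" "j < n" for j a
  proof (cases "j = 1")
    case True
    have "\<psi> a * d' 1 = f 0 1 a * (d 1 * d' 1)" by (simp add: \<psi>_def mult.assoc)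
    then show ?thesis using d[OF n1(2)] E f_range[OF n1] True by simp
  next
    case False
    then have "u 0 j = u 0 1 * u 1 j" using u_left[of 0 1 j 1] j by (simp add: u_def)
    then have "\<psi> a * d' j = f 0 1 a * (d 1 * d' 1) * u 1 j"
      using j by (simp add: \<psi>_def d'_def mult.assoc)
    also have "\<dots> = f 0 1 a * u 1 j" using d[OF n1(2)] E f_range[OF n1] by simp
    also have "\<dots> = f 0 j a" using u_right[of 0 1 j a] j False by simp
    finally show ?thesis by simp
  qed
  have f_eq: "f i j a = d i * \<psi> a * d' j" if ij: "i < j" "j < n" for i j a
  proof (cases "i = 0")
    case True
    then show ?thesis using f_0[of j a] ij E \<psi>_range by (simp add: d_def)
  next
    case False
    then have "d i * \<psi> a * d' j = d i * (u 0 i * f i j a)"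
      using f_0[of j a] u_left[of 0 i j a] ij by (simp add: mult.assoc)
    also have "\<dots> = (d i * d' i) * f i j a" using False by (simp add: d'_def mult.assoc)
    also have "\<dots> = f i j a" using d[of i] E f_range[OF ij] ij by simp
    finally show ?thesis by simp
  qed
  \<comment> \<open>The product rule for the indices 0, 1, 2, after cancelling the unit
    \<open>d' 2\<close> of the ring e S.\<close>
  have \<psi>_mult: "\<psi> (mu a b) = \<psi> a * \<psi> b" for a b
  proof -
    have 12: "1 < (2::nat)" "2 < n" using n by auto
    have "\<psi> (mu a b) * d' 2 = \<psi> a * d' 1 * (d 1 * \<psi> b * d' 2)"
      using f_0[of 2 "mu a b"] mult[OF n1(1) 12, of a b] f_0[of 1 a] f_eq[OF 12, of b] n by simp
    also have "\<dots> = \<psi> a * (d' 1 * d 1) * \<psi> b * d' 2" by (simp add: mult.assoc)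
    also have "\<dots> = \<psi> a * \<psi> b * d' 2" using d[OF n1(2)] E \<psi>_range by simp
    finally have "\<psi> (mu a b) * (d' 2 * d 2) = \<psi> a * \<psi> b * (d' 2 * d 2)"
      by (simp add: mult.assoc[symmetric])
    then show ?thesis using d[OF 12(2)] E \<psi>_range S.range_sc_mult by simp
  qed
  have d1: "x * d 1 * d' 1 = x" "x * d' 1 * d 1 = x" if "x \<in> range (sS e)" for x
    using d[OF n1(2)] E[OF that] by (simp_all add: mult.assoc)
  have "bij_betw (\<lambda>x. x * d 1) (range (sS e)) (range (sS e))"
    by (rule bij_betw_byWitness[where f' = "\<lambda>x. x * d' 1"]) (use d1 S.range_sc_mult in blast)+
  then have "bij_betw \<psi> (range (sR e)) (range (sS e))"
    using bij_betw_trans[OF bij[OF n1]] by (simp add: \<psi>_def[abs_def] o_def)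
  moreover have "\<psi> (a + b) = \<psi> a + \<psi> b" for a b
    using add[OF n1] by (simp add: \<psi>_def distrib_right)
  moreover have "\<psi> (sR c a) = sS c (\<psi> a)" for c a
    using scale[OF n1] by (simp add: \<psi>_def S.sc_mult_left)
  moreover have "\<psi> (sR e a) = \<psi> a" for a
    using cut[OF n1] by (simp add: \<psi>_def)
  ultimately show ?thesis
    using that[of \<psi> d d'] \<psi>_mult d f_eq unfolding E_def by blast
qed


subsection \<open>Lifts respecting the grading\<close>

text \<open>Two different intervals are told apart by one of their end points. Hence a single gap,
  with weights 0 and 1, separates two positions over any ring.\<close>

lemma ex_separating:
  fixes i j p q :: nat
  assumes "i < j" "p < q" "(p, q) \<noteq> (i, j)" "j \<le> m" "q \<le> m"
  shows "\<exists>k<m. (i \<le> k \<and> k < j) \<noteq> (p \<le> k \<and> k < q)"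
proof -
  consider "i < p" | "p < i" | "i = p" "j < q" | "i = p" "q < j" using assms(3) by fastforce
  then show ?thesis
  proof cases
    case 1 then show ?thesis using assms by (intro exI[of _ i]) auto
  next
    case 2 then show ?thesis using assms by (intro exI[of _ p]) auto
  next
    case 3 then show ?thesis using assms by (intro exI[of _ j]) auto
  next
    case 4 then show ?thesis using assms by (intro exI[of _ q]) auto
  qed
qed

lemma (in unital_algebra) up_bracket_single:
  assumes "y \<in> tri n" "p < q" "q < n"
  shows "up (tri_bracket n sc (diag_elt n (single k c)) y) p q = sc (if p \<le> k \<and> k < q then c else 0) (up y p q)"
proof -
  let ?d = "diag_elt n (single k c) :: ('f, 'r) tri"
  have "dg ?d p - dg ?d q = (\<Sum>l\<in>{p..<q}. gap ?d l)"
    using assms by (intro dg_diff_eq_sum_gap) auto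
  also have "\<dots> = (\<Sum>l\<in>{p..<q}. single k c l)"
    using assms by (intro sum.cong) auto
  also have "\<dots> = (if p \<le> k \<and> k < q then c else 0)" by (simp add: single_def)
  finally show ?thesis using up_bracket_diag[of y n p q "single k c"] assms by simp
qed

lemma (in unital_algebra) bracket_single_unit:
  assumes "i < j" "j < n"
  shows "tri_bracket n sc (diag_elt n (single k c)) (unit_elt n i j a)
    = tri_scale sc (if i \<le> k \<and> k < j then c else 0) (unit_elt n i j a)"
  using assms
  by (intro tri_eqI[of _ n]) (auto simp: up_bracket_single up_scale[of _ n] dg_scale[of _ n] dg_bracket[of _ n])

text \<open>The idempotent is a parameter, so that the one found before the conjugation can be kept
  for the conjugated lift.\<close>

locale graded_lift = tri_lift sR sS n F
  for sR :: "'f::{comm_ring, comm_monoid_mult} \<Rightarrow> 'r::{ring, monoid_mult} \<Rightarrow> 'r"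
    and sS :: "'f \<Rightarrow> 's::{ring, monoid_mult} \<Rightarrow> 's" and n F +
  fixes e :: 'f
  assumes e: "e * e = e"
    and F_diag: "k < n - 1 \<Longrightarrow> F (diag_elt n (single k e)) = diag_elt n (single k e)"
    and F_antidiag: "k < n - 1 \<Longrightarrow>
      F (diag_elt n (single k (1 - e))) = diag_elt n (single (n - 2 - k) (1 - e))"
begin

lemma e': "(1 - e) * (1 - e) = 1 - e"
  using e by (simp add: algebra_simps)

lemma unit_eq: "unit_elt n i j (a + b) = tri_add (unit_elt n i j a) (unit_elt n i j b :: ('f, 'r) tri)"
  by (intro tri_eqI[of _ n]) (auto simp: tri_ops[of _ n] unit_elt_def)

lemma unit_scale: "unit_elt n i j (sR c a) = tri_scale sR c (unit_elt n i j a)"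
  by (intro tri_eqI[of _ n]) (auto simp: R.dg_scale[of _ n] R.up_scale[of _ n] unit_elt_def)

lemma F_unit_strict: "i < j \<Longrightarrow> F (unit_elt n i j a) \<in> strict n (Suc 0)"
  by (intro F_strict unit_elt_strict) auto

lemma F_unit_scale: "p < n \<Longrightarrow> q < n \<Longrightarrow>
    up (F (unit_elt n i j (sR c a))) p q = sS c (up (F (unit_elt n i j a)) p q)"
  by (simp add: unit_scale F_scale S.up_scale[of _ n])

text \<open>At a separating gap, the bracket with the diagonal idempotent scaled by \<open>e\<close>
  multiplies the entry by \<open>e\<close> on one side of the equation and by 0 on the
  other.\<close>

lemma F_unit_weight:
  assumes "i < j" "j < n" "p < n" "q < n" "(p, q) \<noteq> (i, j)"
  shows "sS e (up (F (unit_elt n i j a)) p q) = 0"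
proof (cases "p < q")
  case False
  then show ?thesis using up_lower[of "F (unit_elt n i j a)" n q p] assms by simp
next
  case True
  let ?u = "unit_elt n i j a" and ?y = "F (unit_elt n i j a)"
  have "\<exists>k<n - 1. (i \<le> k \<and> k < j) \<noteq> (p \<le> k \<and> k < q)"
    by (rule ex_separating) (use assms True in auto)
  then obtain k where k: "k < n - 1" "(i \<le> k \<and> k < j) \<noteq> (p \<le> k \<and> k < q)" by blast
  have "tri_bracket n sS (diag_elt n (single k e)) ?y = F (tri_bracket n sR (diag_elt n (single k e)) ?u)"
    using F_diag[OF k(1)] by (simp add: F_bracket)
  also have "\<dots> = tri_scale sS (if i \<le> k \<and> k < j then e else 0) ?y"
    using assms by (simp add: R.bracket_single_unit F_scale)
  finally have "up (tri_bracket n sS (diag_elt n (single k e)) ?y) p q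
      = up (tri_scale sS (if i \<le> k \<and> k < j then e else 0) ?y) p q"
    by simp
  then show ?thesis
    using True assms k(2) by (auto simp: S.up_bracket_single S.up_scale[of _ n] split: if_splits)
qed

lemma F_unit_antiweight:
  assumes "i < j" "j < n" "p < n" "q < n" "(p, q) \<noteq> (n - 1 - j, n - 1 - i)"
  shows "sS (1 - e) (up (F (unit_elt n i j a)) p q) = 0"
proof (cases "p < q")
  case False
  then show ?thesis using up_lower[of "F (unit_elt n i j a)" n q p] assms by simp
next
  case True
  let ?u = "unit_elt n i j a" and ?y = "F (unit_elt n i j a)"
  have "\<exists>k<n - 1. (i \<le> k \<and> k < j) \<noteq> (n - 1 - q \<le> k \<and> k < n - 1 - p)"
  proof (rule ex_separating)
    show "(n - 1 - q, n - 1 - p) \<noteq> (i, j)" using assms True by auto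
  qed (use assms True in auto)
  then obtain k where k: "k < n - 1" "(i \<le> k \<and> k < j) \<noteq> (n - 1 - q \<le> k \<and> k < n - 1 - p)" by blast
  \<comment> \<open>Reflecting gaps and reflecting positions are compatible: gap \<open>k\<close>
    corresponds to gap \<open>n - 2 - k\<close>, index \<open>p\<close> to index
    \<open>n - 1 - p\<close>.\<close>
  have flip: "(p \<le> n - 2 - k \<and> n - 2 - k < q) \<longleftrightarrow> (n - 1 - q \<le> k \<and> k < n - 1 - p)"
    using k(1) True assms(4) by auto
  have "tri_bracket n sS (diag_elt n (single (n - 2 - k) (1 - e))) ?y
      = F (tri_bracket n sR (diag_elt n (single k (1 - e))) ?u)"
    using F_antidiag[OF k(1)] by (simp add: F_bracket)
  also have "\<dots> = tri_scale sS (if i \<le> k \<and> k < j then 1 - e else 0) ?y"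
    using assms by (simp add: R.bracket_single_unit F_scale)
  finally have "up (tri_bracket n sS (diag_elt n (single (n - 2 - k) (1 - e))) ?y) p q
      = up (tri_scale sS (if i \<le> k \<and> k < j then 1 - e else 0) ?y) p q"
    by simp
  then have "sS (if n - 1 - q \<le> k \<and> k < n - 1 - p then 1 - e else 0) (up ?y p q)
      = sS (if i \<le> k \<and> k < j then 1 - e else 0) (up ?y p q)"
    unfolding S.up_bracket_single[OF F_in[OF unit_elt_in] True assms(4)] flip
    using assms by (simp add: S.up_scale[of _ n])
  then show ?thesis using k(2) by (auto split: if_splits)
qed

definition iso_part :: "nat \<Rightarrow> nat \<Rightarrow> 'r \<Rightarrow> 's" where
  "iso_part p q a = sS e (up (F (unit_elt n p q a)) p q)"

text \<open>Minus the part that reverses products, indexed by its target position.\<close>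

definition anti_part :: "nat \<Rightarrow> nat \<Rightarrow> 'r \<Rightarrow> 's" where
  "anti_part p q a = - sS (1 - e) (up (F (unit_elt n (n - 1 - q) (n - 1 - p) a)) p q)"

lemma up_F_bracket_unit:
  assumes "i < j" "j < k" "k < n" "p < n" "q < n"
  shows "up (F (unit_elt n i k (a * b))) p q =
    (\<Sum>l<n. up (F (unit_elt n i j a)) p l * up (F (unit_elt n j k b)) l q
      - up (F (unit_elt n j k b)) p l * up (F (unit_elt n i j a)) l q)"
proof -
  have "F (unit_elt n i k (a * b)) = tri_bracket n sS (F (unit_elt n i j a)) (F (unit_elt n j k b))"
    using R.bracket_unit_unit[of i j k n a b] assms by (simp add: F_bracket[symmetric])
  then show ?thesis
    using assms strict_dg[OF F_unit_strict[OF assms(1)]] strict_dg[OF F_unit_strict[OF assms(2)]]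
    by (simp add: S.up_bracket[of _ n])
qed

text \<open>After cutting with \<open>e\<close> each factor is concentrated at its own position, so
  in the bracket only the term \<open>l = j\<close> of the product in the given order
  survives.\<close>

lemma iso_part_mult:
  assumes "i < j" "j < k" "k < n"
  shows "iso_part i k (a * b) = iso_part i j a * iso_part j k b"
proof -
  let ?y = "up (F (unit_elt n i j a))" and ?z = "up (F (unit_elt n j k b))"
  have *: "j < n" "i < n" using assms by auto
  have "iso_part i k (a * b) = (\<Sum>l<n. sS e (?y i l) * sS e (?z l k) - sS e (?z i l) * sS e (?y l k))"
    unfolding iso_part_def up_F_bracket_unit[OF assms *(2) assms(3)]
    by (simp add: S.sc_sum S.sc_diff_right S.sc_idem_mult[OF e])
  also have "\<dots> = (\<Sum>l<n. if l = j then iso_part i j a * iso_part j k b else 0)"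
  proof (intro sum.cong refl)
    fix l assume "l \<in> {..<n}"
    then have l: "l < n" by simp
    have "sS e (?z i l) = 0" using F_unit_weight[OF assms(2,3) *(2) l] assms by auto
    moreover have "sS e (?y i l) = 0" if "l \<noteq> j"
      using F_unit_weight[OF assms(1) *(1) *(2) l] that by auto
    ultimately show "sS e (?y i l) * sS e (?z l k) - sS e (?z i l) * sS e (?y l k)
        = (if l = j then iso_part i j a * iso_part j k b else 0)"
      by (simp add: iso_part_def)
  qed
  finally show ?thesis using * by simp
qed

text \<open>At reflected positions only the subtracted product of the bracket survives. The signs in
  \<open>anti_part\<close> are chosen so that the resulting minus disappears.\<close>

lemma anti_part_mult:
  assumes "p < r" "r < q" "q < n"
  shows "anti_part p q (a * b) = anti_part p r b * anti_part r q a"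
proof -
  let ?p = "n - 1 - p" and ?q = "n - 1 - q" and ?r = "n - 1 - r"
  let ?y = "up (F (unit_elt n ?q ?r a))" and ?z = "up (F (unit_elt n ?r ?p b))"
  have *: "?q < ?r" "?r < ?p" "?p < n" "?r < n" "p < n" "r < n" using assms by auto
  have pp: "n - 1 - ?p = p" "n - 1 - ?q = q" "n - 1 - ?r = r" using assms by auto
  have "anti_part p q (a * b) =
      - (\<Sum>l<n. sS (1 - e) (?y p l) * sS (1 - e) (?z l q) - sS (1 - e) (?z p l) * sS (1 - e) (?y l q))"
    unfolding anti_part_def up_F_bracket_unit[OF *(1,2,3,5) assms(3)]
    by (simp add: S.sc_sum S.sc_diff_right S.sc_idem_mult[OF e'])
  also have "\<dots> = - (\<Sum>l<n. if l = r then - (anti_part p r b * anti_part r q a) else 0)"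
  proof (intro arg_cong[where f = uminus] sum.cong refl)
    fix l assume "l \<in> {..<n}"
    then have l: "l < n" by simp
    have "sS (1 - e) (?y p l) = 0"
      using F_unit_antiweight[OF *(1) *(4) *(5) l] assms unfolding pp by auto
    moreover have "sS (1 - e) (?z p l) = 0" if "l \<noteq> r"
      using F_unit_antiweight[OF *(2) *(3) *(5) l] that unfolding pp by auto
    ultimately show "sS (1 - e) (?y p l) * sS (1 - e) (?z l q) - sS (1 - e) (?z p l) * sS (1 - e) (?y l q)
        = (if l = r then - (anti_part p r b * anti_part r q a) else 0)"
      by (simp add: anti_part_def)
  qed
  finally show ?thesis using * by simp
qed

lemma iso_part_add: "p < q \<Longrightarrow> q < n \<Longrightarrow> iso_part p q (a + b) = iso_part p q a + iso_part p q b"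
  by (simp add: iso_part_def unit_eq F_add up_add[of _ n] S.sc_add_right)

lemma iso_part_scale: "p < q \<Longrightarrow> q < n \<Longrightarrow> iso_part p q (sR c a) = sS c (iso_part p q a)"
  by (simp add: iso_part_def F_unit_scale S.sc_sc mult.commute)

lemma iso_part_cut: "p < q \<Longrightarrow> q < n \<Longrightarrow> iso_part p q (sR e a) = iso_part p q a"
  by (simp add: iso_part_def F_unit_scale S.sc_sc e)

lemma anti_part_add: "p < q \<Longrightarrow> q < n \<Longrightarrow> anti_part p q (a + b) = anti_part p q a + anti_part p q b"
  by (simp add: anti_part_def unit_eq F_add up_add[of _ n] S.sc_add_right)

lemma anti_part_scale: "p < q \<Longrightarrow> q < n \<Longrightarrow> anti_part p q (sR c a) = sS c (anti_part p q a)"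
  by (simp add: anti_part_def F_unit_scale S.sc_sc S.sc_minus_right mult.commute)

lemma anti_part_cut: "p < q \<Longrightarrow> q < n \<Longrightarrow> anti_part p q (sR (1 - e) a) = anti_part p q a"
  by (simp add: anti_part_def F_unit_scale S.sc_sc e')

lemma iso_part_zero: "p < q \<Longrightarrow> q < n \<Longrightarrow> iso_part p q 0 = 0"
  using iso_part_scale[of p q 0 0] by simp

lemma anti_part_zero: "p < q \<Longrightarrow> q < n \<Longrightarrow> anti_part p q 0 = 0"
  using anti_part_scale[of p q 0 0] by simp

text \<open>The locale prescribes images only for the gaps \<open>e\<close> and
  \<open>1 - e\<close>; by scaling and adding, every such generator has a diagonal image.\<close>

lemma F_diag_single_split:
  assumes "k < n - 1"
  shows "F (diag_elt n (single k c)) = tri_add (diag_elt n (single k (e * c))) (diag_elt n (single (n - 2 - k) ((1 - e) * c)))"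
proof -
  have "single k c i = single k (e * c) i + single k ((1 - e) * c) i" for i
    by (cases "i = k") (simp_all add: single_def left_diff_distrib)
  then have "(\<Sum>i\<in>K. single k c i) = (\<Sum>i\<in>K. single k (e * c) i) + (\<Sum>i\<in>K. single k ((1 - e) * c) i)" for K
    unfolding sum.distrib[symmetric] by (intro sum.cong) simp_all
  then have "diag_elt n (single k c) =
      (tri_add (diag_elt n (single k (e * c))) (diag_elt n (single k ((1 - e) * c))) :: ('f, 'r) tri)"
    by (intro tri_eqI[of _ n]) (simp_all add: tri_ops[of _ n])
  also have "F \<dots> = tri_add (tri_scale sS c (F (diag_elt n (single k e))))
      (tri_scale sS c (F (diag_elt n (single k (1 - e)))))"
    unfolding R.diag_elt_single_scale[symmetric] by (simp only: F_add F_scale R.tri_scale_in diag_elt_in)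
  also have "\<dots> = tri_add (diag_elt n (single k (e * c))) (diag_elt n (single (n - 2 - k) ((1 - e) * c)))"
    unfolding F_diag[OF assms] F_antidiag[OF assms] S.diag_elt_single_scale ..
  finally show ?thesis .
qed

text \<open>Both equations are additive in \<open>x\<close>. Diagonal generators contribute nothing
  above the diagonal, single entries only at their own or their reflected position.\<close>

lemma up_F:
  assumes x: "x \<in> tri n" and pq: "p < q" "q < n"
  shows "sS e (up (F x) p q) = iso_part p q (up x p q)"
    and "sS (1 - e) (up (F x) p q) = - anti_part p q (up x (n - 1 - q) (n - 1 - p))"
proof -
  have pn: "p < n" and star: "n - 1 - q < n - 1 - p" "n - 1 - p < n" "n - 1 - q < n"
    using pq by auto
  have "sS e (up (F x) p q) = iso_part p q (up x p q) \<and>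
    sS (1 - e) (up (F x) p q) = - anti_part p q (up x (n - 1 - q) (n - 1 - p))"
    using x n_pos(1)
  proof (induction rule: tri_induct)
    case (scalar s)
    have "up s p q = 0" "up s (n - 1 - q) (n - 1 - p) = 0"
      using scalar pq star n_pos(1) by (simp_all add: tri_scalars_iff)
    then show ?case using F_scalars[OF scalar] pq pn by (simp add: iso_part_zero anti_part_zero)
  next
    case (add x y)
    then show ?case
      using pq pn star by (simp add: F_add up_add[of _ n] S.sc_add_right iso_part_add anti_part_add)
  next
    case (diag k c)
    then show ?case
      using pq pn star F_diag_single_split[of k c] by (simp add: up_add[of _ n] iso_part_zero anti_part_zero)
  next
    case (unit i j a)
    show ?case
    proof
      show "sS e (up (F (unit_elt n i j a)) p q) = iso_part p q (up (unit_elt n i j a :: ('f, 'r) tri) p q)"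
      proof (cases "p = i \<and> q = j")
        case True then show ?thesis using unit pn by (simp add: iso_part_def)
      next
        case False
        then have "sS e (up (F (unit_elt n i j a)) p q) = 0"
          by (intro F_unit_weight[OF unit pn pq(2)]) auto
        moreover have "up (unit_elt n i j a :: ('f, 'r) tri) p q = 0"
          using False unit pn pq by auto
        ultimately show ?thesis using iso_part_zero[OF pq] by simp
      qed
      show "sS (1 - e) (up (F (unit_elt n i j a)) p q)
          = - anti_part p q (up (unit_elt n i j a :: ('f, 'r) tri) (n - 1 - q) (n - 1 - p))"
      proof (cases "n - 1 - q = i \<and> n - 1 - p = j")
        case True
        then show ?thesis using unit star by (auto simp: anti_part_def)
      next
        case False
        then have "(p, q) \<noteq> (n - 1 - j, n - 1 - i)" using unit pq by auto
        then have "sS (1 - e) (up (F (unit_elt n i j a)) p q) = 0"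
          using F_unit_antiweight[OF unit pn pq(2)] by blast
        moreover have "up (unit_elt n i j a :: ('f, 'r) tri) (n - 1 - q) (n - 1 - p) = 0"
          using False unit star by auto
        ultimately show ?thesis using anti_part_zero[OF pq] by simp
      qed
    qed
  qed
  then show "sS e (up (F x) p q) = iso_part p q (up x p q)"
    and "sS (1 - e) (up (F x) p q) = - anti_part p q (up x (n - 1 - q) (n - 1 - p))"
    by blast+
qed

lemma F_unit_eq_0:
  assumes ij: "i < j" "j < n" and "\<And>p q. p < q \<Longrightarrow> q < n \<Longrightarrow> up (F (unit_elt n i j a)) p q = 0"
  shows "a = 0"
proof -
  have "F (unit_elt n i j a) = tri_of n (\<lambda>_. 0) (\<lambda>_ _. 0)"
    using assms strict_dg[OF F_unit_strict[OF ij(1)]] by (intro tri_eqI[of _ n]) auto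
  then have "unit_elt n i j a \<in> (tri_scalars n :: ('f, 'r) tri set)" by (intro F_ker) auto
  then have "up (unit_elt n i j a :: ('f, 'r) tri) i j = 0"
    using ij unfolding tri_scalars_iff[OF n_pos(1)] by blast
  then show ?thesis using ij by simp
qed

text \<open>For \<open>a\<close> in e R the image of the single entry \<open>a\<close> is a multiple
  of \<open>e\<close>, hence concentrated at \<open>(p, q)\<close>; if it vanishes there, the single
  entry lies in the kernel. Surjectivity reads off the \<open>(p, q)\<close>-entry of a
  preimage.\<close>

lemma iso_part_bij:
  assumes pq: "p < q" "q < n"
  shows "bij_betw (iso_part p q) (range (sR e)) (range (sS e))"
  unfolding bij_betw_def
proof
  have inj: "a - b = 0" if "a \<in> range (sR e)" "b \<in> range (sR e)" "iso_part p q a = iso_part p q b" for a b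
  proof (rule F_unit_eq_0[OF pq])
    fix i j assume ij: "i < j" "j < n"
    have "sR e (a - b) = a - b" by (rule R.mult_sc_one(3)[OF e R.range_sc_diff[OF that(1,2)]])
    then have "up (F (unit_elt n p q (a - b))) i j = sS e (up (F (unit_elt n p q (a - b))) i j)"
      using F_unit_scale[of i j p q e "a - b"] ij by simp
    moreover have "iso_part p q (a - b) = 0"
      using iso_part_add[OF pq, of "a - b" b] that(3) by simp
    ultimately show "up (F (unit_elt n p q (a - b))) i j = 0"
      using F_unit_weight[of p q i j "a - b"] ij pq by (cases "(i, j) = (p, q)") (auto simp: iso_part_def)
  qed
  show "inj_on (iso_part p q) (range (sR e))"
  proof (rule inj_onI)
    fix a b assume "a \<in> range (sR e)" "b \<in> range (sR e)" "iso_part p q a = iso_part p q b"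
    then have "a - b = 0" by (rule inj)
    then show "a = b" by simp
  qed
  show "iso_part p q ` range (sR e) = range (sS e)"
  proof
    show "iso_part p q ` range (sR e) \<subseteq> range (sS e)" by (auto simp: iso_part_def)
    show "range (sS e) \<subseteq> iso_part p q ` range (sR e)"
    proof
      fix s assume s: "s \<in> range (sS e)"
      obtain x where x: "x \<in> tri n" "F x = unit_elt n p q s"
        using F_surj[of "unit_elt n p q s"] n_pos by auto
      have "iso_part p q (sR e (up x p q)) = sS e s"
        using up_F(1)[OF x(1) pq] x(2) pq by (simp add: iso_part_cut)
      then show "s \<in> iso_part p q ` range (sR e)" using S.mult_sc_one(3)[OF e s] by (metis imageI rangeI)
    qed
  qed
qed

lemma anti_part_bij:
  assumes pq: "p < q" "q < n"
  shows "bij_betw (anti_part p q) (range (sR (1 - e))) (range (sS (1 - e)))"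
  unfolding bij_betw_def
proof
  have star: "n - 1 - q < n - 1 - p" "n - 1 - p < n" using pq by auto
  have pp: "n - 1 - (n - 1 - p) = p" "n - 1 - (n - 1 - q) = q" using pq by auto
  have inj: "a - b = 0" if "a \<in> range (sR (1 - e))" "b \<in> range (sR (1 - e))" "anti_part p q a = anti_part p q b" for a b
  proof (rule F_unit_eq_0[OF star])
    fix i j assume ij: "i < j" "j < n"
    let ?u = "unit_elt n (n - 1 - q) (n - 1 - p) (a - b)"
    have "sR (1 - e) (a - b) = a - b" by (rule R.mult_sc_one(3)[OF e' R.range_sc_diff[OF that(1,2)]])
    then have "up (F ?u) i j = sS (1 - e) (up (F ?u) i j)"
      using F_unit_scale[of i j "n - 1 - q" "n - 1 - p" "1 - e" "a - b"] ij by simp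
    moreover have "anti_part p q (a - b) = 0"
      using anti_part_add[OF pq, of "a - b" b] that(3) by simp
    ultimately show "up (F ?u) i j = 0"
      using F_unit_antiweight[OF star, of i j "a - b"] ij pq pp
      by (cases "(i, j) = (p, q)") (auto simp: anti_part_def)
  qed
  show "inj_on (anti_part p q) (range (sR (1 - e)))"
  proof (rule inj_onI)
    fix a b assume "a \<in> range (sR (1 - e))" "b \<in> range (sR (1 - e))" "anti_part p q a = anti_part p q b"
    then have "a - b = 0" by (rule inj)
    then show "a = b" by simp
  qed
  show "anti_part p q ` range (sR (1 - e)) = range (sS (1 - e))"
  proof
    show "anti_part p q ` range (sR (1 - e)) \<subseteq> range (sS (1 - e))"
      by (auto simp: anti_part_def S.sc_minus_right[symmetric])
    show "range (sS (1 - e)) \<subseteq> anti_part p q ` range (sR (1 - e))"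
    proof
      fix s assume s: "s \<in> range (sS (1 - e))"
      \<comment> \<open>The sign cancels the one in \<open>anti_part\<close>.\<close>
      obtain x where x: "x \<in> tri n" "F x = unit_elt n p q (- s)"
        using F_surj[of "unit_elt n p q (- s)"] n_pos by auto
      have "anti_part p q (sR (1 - e) (up x (n - 1 - q) (n - 1 - p))) = sS (1 - e) s"
        using up_F(2)[OF x(1) pq] x(2) pq by (simp add: anti_part_cut S.sc_minus_right)
      then show "s \<in> anti_part p q ` range (sR (1 - e))"
        using S.mult_sc_one(3)[OF e' s] by (metis imageI rangeI)
    qed
  qed
qed

lemma up_F_split:
  assumes "x \<in> tri n" "p < q" "q < n"
  shows "up (F x) p q = iso_part p q (up x p q) - anti_part p q (up x (n - 1 - q) (n - 1 - p))"
proof -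
  have "up (F x) p q = sS e (up (F x) p q) + sS (1 - e) (up (F x) p q)"
    by (simp add: S.sc_add_left[symmetric] S.sc_one)
  then show ?thesis using up_F[OF assms] by simp
qed

end


subsection \<open>Conjugation as an automorphism of the Lie algebra\<close>

lemma mat_inv_eq:
  fixes q :: "'s::{ring, monoid_mult} mat"
  assumes "q \<in> carrier_mat n n" "mat_inverse_of n q q'"
  shows "q \<in> mat_units n" "mat_inv n q = q'"
proof -
  show u: "q \<in> mat_units n" using assms by (auto simp: mat_units_def)
  show "mat_inv n q = q'" using mat_inverse_of_unique[OF assms(1) mat_inv[OF u] assms(2)] .
qed

lemma mat_inverse_of_sym:
  "q \<in> carrier_mat n n \<Longrightarrow> mat_inverse_of n q q' \<Longrightarrow> mat_inverse_of n q' q"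
  by (auto simp: mat_inverse_of_def)

lemma mat_inverse_ofD:
  assumes "mat_inverse_of n q q'"
  shows "q' \<in> carrier_mat n n" "q * q' = 1\<^sub>m n" "q' * q = 1\<^sub>m n"
  using assms by (auto simp: mat_inverse_of_def)

lemma conj_mat_cancel:
  fixes q :: "'s::{ring, monoid_mult} mat"
  assumes q: "q \<in> carrier_mat n n" and inv: "mat_inverse_of n q q'" and A: "A \<in> carrier_mat n n"
  shows "q * (q' * A * q) * q' = A"
proof -
  note q' = mat_inverse_ofD[OF inv]
  have "q * (q' * A * q) * q' = (q * q') * A * (q * q')"
    using q q'(1) A by (simp add: assoc_mult_mat[of _ n n _ n _ n])
  then show ?thesis using q' A by (simp add: one_mult_mat mult_one_mat)
qed

lemma conj_mat_mult:
  fixes q :: "'s::{ring, monoid_mult} mat"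
  assumes q: "q \<in> carrier_mat n n" and inv: "mat_inverse_of n q q'"
    and A: "A \<in> carrier_mat n n" and B: "B \<in> carrier_mat n n"
  shows "(q * A * q') * (q * B * q') = q * (A * B) * q'"
proof -
  note q' = mat_inverse_ofD[OF inv]
  have "(q * A * q') * (q * B * q') = q * A * (q' * q) * (B * q')"
    using q q'(1) A B by (simp add: assoc_mult_mat[of _ n n _ n _ n])
  also have "q * A * (q' * q) = q * A"
    unfolding q'(3) using q A by (intro mult_one_mat) auto
  also have "q * A * (B * q') = q * (A * B) * q'"
    using q q'(1) A B by (simp add: assoc_mult_mat[of _ n n _ n _ n])
  finally show ?thesis .
qed

lemma tri_embed_carrier [simp]: "tri_embed n sc x \<in> carrier_mat n n"
  by (simp add: tri_embed_def)

lemma dg_conj [simp]: "dg (tri_conj n sc q x) i = dg x i"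
  by (simp add: tri_conj_def)

lemma tri_conj_in [simp]: "x \<in> tri n \<Longrightarrow> tri_conj n sc q x \<in> tri n"
  by (auto simp: tri_conj_def tri_def)

context unital_algebra
begin

text \<open>Transfers identities from the full matrix ring back to T(S); diagonal entries are
  recovered by faithfulness.\<close>

lemma tri_embed_inj:
  assumes "inj (\<lambda>c. sc c 1)" "x \<in> tri n" "y \<in> tri n" "tri_embed n sc x = tri_embed n sc y"
  shows "x = y"
proof (rule tri_eqI[OF assms(2,3)])
  fix i assume i: "i < n"
  have "sc (dg x i) 1 = sc (dg y i) 1"
    using arg_cong[OF assms(4), of "\<lambda>A. A $$ (i, i)"] i by (simp add: tri_embed_index)
  then show "dg x i = dg y i" using assms(1) by (auto dest: injD)
next
  fix i j assume "i < j" "j < n"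
  then show "up x i j = up y i j"
    using arg_cong[OF assms(4), of "\<lambda>A. A $$ (i, j)"] by (simp add: tri_embed_index)
qed

lemma tri_embed_add:
  "x \<in> tri n \<Longrightarrow> y \<in> tri n \<Longrightarrow> tri_embed n sc (tri_add x y) = tri_embed n sc x + tri_embed n sc y"
  by (intro eq_matI) (auto simp: tri_embed_def tri_ops[of _ n] sc_add_left)

lemma tri_embed_diff:
  "x \<in> tri n \<Longrightarrow> y \<in> tri n \<Longrightarrow> tri_embed n sc (tri_diff x y) = tri_embed n sc x - tri_embed n sc y"
  by (intro eq_matI) (auto simp: tri_embed_def tri_ops[of _ n] sc_diff_left)

lemma tri_embed_scale:
  "x \<in> tri n \<Longrightarrow> tri_embed n sc (tri_scale sc c x) = map_mat (sc c) (tri_embed n sc x)"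
  by (intro eq_matI) (auto simp: tri_embed_def dg_scale[of _ n] up_scale[of _ n] sc_sc)

lemma tri_embed_bracket:
  "x \<in> tri n \<Longrightarrow> y \<in> tri n \<Longrightarrow> tri_embed n sc (tri_bracket n sc x y) =
    tri_embed n sc x * tri_embed n sc y - tri_embed n sc y * tri_embed n sc x"
  by (simp add: tri_bracket_def tri_embed_diff tri_embed_mult)

lemma map_mat_mult:
  assumes "A \<in> carrier_mat n n" "B \<in> carrier_mat n n"
  shows "A * map_mat (sc c) B = map_mat (sc c) (A * B)" "map_mat (sc c) A * B = map_mat (sc c) (A * B)"
  using assms by (auto intro!: eq_matI simp: mult_mat_entry[of _ n] sc_sum
      sc_mult_left[symmetric] sc_mult_right[symmetric] simp del: index_mult_mat(1))

end

text \<open>Carries an explicit inverse \<open>q'\<close>, so that \<open>mat_inv\<close> need not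
  be unfolded; both kinds of conjugating matrices are covered.\<close>

locale tri_conjugation = unital_algebra sc
  for sc :: "'f::{comm_ring, comm_monoid_mult} \<Rightarrow> 's::{ring, monoid_mult} \<Rightarrow> 's" +
  fixes n :: nat and q q' :: "'s mat"
  assumes faithful: "inj (\<lambda>c. sc c 1)"
    and q: "q \<in> carrier_mat n n" "q \<in> UT n \<union> Diag_units n"
    and inv: "mat_inverse_of n q q'"
begin

abbreviation "cj \<equiv> tri_conj n sc q"

lemmas q' = mat_inverse_ofD[OF inv]

lemma embed_conj: "x \<in> tri n \<Longrightarrow> tri_embed n sc (cj x) = q * tri_embed n sc x * q'"
  using tri_embed_conj[OF q(2)] mat_inv_eq[OF q(1) inv] by simp

lemma conj_eqI:
  "x \<in> tri n \<Longrightarrow> y \<in> tri n \<Longrightarrow> q * tri_embed n sc x * q' = tri_embed n sc y \<Longrightarrow> cj x = y"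
  by (intro tri_embed_inj[OF faithful]) (auto simp: embed_conj)

lemma conj_add:
  assumes "x \<in> tri n" "y \<in> tri n"
  shows "cj (tri_add x y) = tri_add (cj x) (cj y)"
  using assms q(1) q'(1)
  by (intro conj_eqI)
    (auto simp: tri_embed_add embed_conj mult_add_distrib_mat[of _ n n _ n] add_mult_distrib_mat[of _ n n _ _ n])

lemma conj_scale:
  assumes "x \<in> tri n"
  shows "cj (tri_scale sc c x) = tri_scale sc c (cj x)"
  using assms q(1) q'(1)
  by (intro conj_eqI) (auto simp: tri_embed_scale embed_conj map_mat_mult[of _ n])

lemma conj_bracket:
  assumes "x \<in> tri n" "y \<in> tri n"
  shows "cj (tri_bracket n sc x y) = tri_bracket n sc (cj x) (cj y)"
proof (rule conj_eqI)
  let ?X = "tri_embed n sc x" and ?Y = "tri_embed n sc y"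
  have XY: "?X * ?Y \<in> carrier_mat n n" "?Y * ?X \<in> carrier_mat n n"
    by (rule mult_carrier_mat[OF tri_embed_carrier tri_embed_carrier])+
  have "q * (?X * ?Y - ?Y * ?X) * q' = q * (?X * ?Y) * q' - q * (?Y * ?X) * q'"
    unfolding mult_minus_distrib_mat[OF q(1) XY]
    by (rule minus_mult_distrib_mat[OF mult_carrier_mat[OF q(1) XY(1)] mult_carrier_mat[OF q(1) XY(2)] q'(1)])
  then show "q * tri_embed n sc (tri_bracket n sc x y) * q' = tri_embed n sc (tri_bracket n sc (cj x) (cj y))"
    using assms by (simp add: tri_embed_bracket embed_conj conj_mat_mult[OF q(1) inv])
qed (use assms in auto)

lemma conj_scalars:
  assumes "s \<in> tri_scalars n"
  shows "cj s = s"
proof -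
  obtain c where c: "s = (vec n (\<lambda>_. c), 0\<^sub>m n n)" using assms by (auto simp: tri_scalars_def)
  have st: "s \<in> tri n" by (auto simp: c tri_def)
  have s: "tri_embed n sc s = map_mat (sc c) (1\<^sub>m n)"
    by (intro eq_matI) (auto simp: c tri_embed_def)
  have "q * tri_embed n sc s * q' = map_mat (sc c) (q * 1\<^sub>m n * q')"
    unfolding s using q(1) q'(1) by (simp add: map_mat_mult[of _ n])
  also have "\<dots> = tri_embed n sc s"
    unfolding s mult_one_mat[OF q(1)] q'(2) ..
  finally show ?thesis by (intro conj_eqI st)
qed

lemma conj_cancel:
  assumes "x \<in> tri n" "q' \<in> UT n"
  shows "cj (tri_conj n sc q' x) = x"
proof (rule conj_eqI)
  have q'u: "q' \<in> mat_units n" "mat_inv n q' = q"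
    using mat_inv_eq[OF q'(1) mat_inverse_of_sym[OF q(1) inv]] by auto
  have "tri_embed n sc (tri_conj n sc q' x) = q' * tri_embed n sc x * q"
    using tri_embed_conj[OF _ q'u(1) assms(1)] assms(2) q'u(2) by simp
  then show "q * tri_embed n sc (tri_conj n sc q' x) * q' = tri_embed n sc x"
    using conj_mat_cancel[OF q(1) inv] by simp
qed (use assms in auto)

end


subsection \<open>Normalized lifts\<close>

context unital_algebra
begin

lemma tri_diff_scalarI:
  assumes "x \<in> tri n" "y \<in> tri n" "\<And>i. i < n \<Longrightarrow> dg x i = dg y i + c"
    and "\<And>i j. i < j \<Longrightarrow> j < n \<Longrightarrow> up x i j = up y i j"
  shows "tri_diff x (y :: ('f, 'r) tri) \<in> tri_scalars n"
proof -
  have "tri_diff x y = (vec n (\<lambda>_. c), 0\<^sub>m n n)"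
  proof (rule tri_eqI[of _ n])
    show "tri_diff x y \<in> tri n" using assms by simp
    show "(vec n (\<lambda>_. c), 0\<^sub>m n n) \<in> tri n" by (auto simp: tri_def)
  qed (use assms in \<open>auto simp: tri_ops[of _ n]\<close>)
  then show ?thesis unfolding tri_scalars_def by blast
qed

lemma tri_diff_scalarD:
  assumes "tri_diff x y \<in> tri_scalars n" and x: "x \<in> tri n" and y: "y \<in> tri n"
  shows "\<exists>c::'f. (\<forall>i<n. dg x i = dg y i + c) \<and> (\<forall>i<n. \<forall>j<n. up x i j = (up y i j :: 'r))"
proof -
  obtain c where c: "tri_diff x y = (vec n (\<lambda>_. c), 0\<^sub>m n n)"
    using assms(1) by (auto simp: tri_scalars_def)
  have "dg x i = dg y i + c" if "i < n" for i
    using dg_diff[OF x y that] that unfolding c by (simp add: eq_diff_eq add.commute)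
  moreover have "up x i j = up y i j" if "i < n" "j < n" for i j
    using up_diff[OF x y that] that unfolding c by simp
  ultimately show ?thesis by blast
qed

section \<open>The quotient Lie algebra on representatives\<close>

lemma mem_tri_coset:
  assumes n: "0 < n" and x: "x \<in> tri n"
  shows "y \<in> tri_coset n sc x \<longleftrightarrow> y \<in> tri n \<and> tri_diff y x \<in> tri_scalars n"
proof
  assume "y \<in> tri_coset n sc x"
  then obtain s where s: "s \<in> tri_scalars n" "y = tri_add x s"
    by (auto simp: lcoset_def tri_lie_def)
  have st: "s \<in> tri n" using s(1) n by (simp add: tri_scalars_iff)
  have "tri_diff y x = s" unfolding s(2)
    using x st by (intro tri_eqI[of _ n]) (auto simp: tri_ops[of _ n])
  then show "y \<in> tri n \<and> tri_diff y x \<in> tri_scalars n" using s x st by simp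
next
  assume y: "y \<in> tri n \<and> tri_diff y x \<in> tri_scalars n"
  have "y = tri_add x (tri_diff y x)"
    using x y by (intro tri_eqI[of _ n]) (auto simp: tri_ops[of _ n])
  then show "y \<in> tri_coset n sc x"
    using y unfolding lcoset_def tri_lie_def by (auto intro!: image_eqI[of y])
qed

lemma tri_diff_scalars_trans:
  fixes x y z :: "('f, 'r) tri"
  assumes "x \<in> tri n" "y \<in> tri n" "z \<in> tri n"
    "tri_diff x y \<in> tri_scalars n" "tri_diff y z \<in> tri_scalars n"
  shows "tri_diff x z \<in> tri_scalars n"
proof -
  obtain c where c: "\<And>i. i < n \<Longrightarrow> dg x i = dg y i + c" "\<And>i j. i < n \<Longrightarrow> j < n \<Longrightarrow> up x i j = up y i j"
    using tri_diff_scalarD[OF assms(4,1,2)] by blast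
  obtain d where d: "\<And>i. i < n \<Longrightarrow> dg y i = dg z i + d" "\<And>i j. i < n \<Longrightarrow> j < n \<Longrightarrow> up y i j = up z i j"
    using tri_diff_scalarD[OF assms(5,2,3)] by blast
  show ?thesis
    by (rule tri_diff_scalarI[OF assms(1,3), of "d + c"]) (simp_all add: c d add.assoc)
qed

lemma tri_diff_scalars_sym:
  fixes x y :: "('f, 'r) tri"
  assumes "x \<in> tri n" "y \<in> tri n" "tri_diff x y \<in> tri_scalars n"
  shows "tri_diff y x \<in> tri_scalars n"
proof -
  obtain c where c: "\<And>i. i < n \<Longrightarrow> dg x i = dg y i + c" "\<And>i j. i < n \<Longrightarrow> j < n \<Longrightarrow> up x i j = up y i j"
    using tri_diff_scalarD[OF assms(3,1,2)] by blast
  show ?thesis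
    by (rule tri_diff_scalarI[OF assms(2,1), of "- c"]) (simp_all add: c)
qed

lemma tri_coset_eq_iff:
  assumes n: "0 < n" and x: "x \<in> tri n" and y: "y \<in> tri n"
  shows "tri_coset n sc x = tri_coset n sc y \<longleftrightarrow> tri_diff x y \<in> tri_scalars n"
proof
  assume "tri_coset n sc x = tri_coset n sc y"
  moreover have "tri_diff x x \<in> tri_scalars n"
    by (rule tri_diff_scalarI[OF x x, of 0]) simp_all
  then have "x \<in> tri_coset n sc x" using x by (simp add: mem_tri_coset[OF n x])
  ultimately show "tri_diff x y \<in> tri_scalars n" by (simp add: mem_tri_coset[OF n y])
next
  assume xy: "tri_diff x y \<in> tri_scalars n"
  show "tri_coset n sc x = tri_coset n sc y"
    using tri_diff_scalars_trans[OF _ x y _ xy]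
      tri_diff_scalars_trans[OF _ y x _ tri_diff_scalars_sym[OF x y xy]]
    by (auto simp: mem_tri_coset[OF n x] mem_tri_coset[OF n y])
qed

lemma tri_coset_nonempty: "0 < n \<Longrightarrow> x \<in> tri n \<Longrightarrow> tri_coset n sc x \<noteq> {}"
  by (auto simp: lcoset_def tri_scalars_def)

text \<open>The quotient operation is a union over representatives. All its members are the same
  coset, and cosets are nonempty, so the union collapses.\<close>

lemma tri_quot_add:
  assumes n: "0 < n" and x: "x \<in> tri n" and y: "y \<in> tri n"
  shows "ladd (tri_lie_quot n sc) (tri_coset n sc x) (tri_coset n sc y) = tri_coset n sc (tri_add x y)"
proof -
  have "tri_coset n sc (tri_add a b) = tri_coset n sc (tri_add x y)"
    if ab: "a \<in> tri_coset n sc x" "b \<in> tri_coset n sc y" for a b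
  proof -
    have a: "a \<in> tri n" "tri_diff a x \<in> tri_scalars n" and b: "b \<in> tri n" "tri_diff b y \<in> tri_scalars n"
      using ab by (simp_all add: mem_tri_coset[OF n x] mem_tri_coset[OF n y])
    obtain c where c: "\<And>i. i < n \<Longrightarrow> dg a i = dg x i + c" "\<And>i j. i < n \<Longrightarrow> j < n \<Longrightarrow> up a i j = up x i j"
      using tri_diff_scalarD[OF a(2,1) x] by blast
    obtain d where d: "\<And>i. i < n \<Longrightarrow> dg b i = dg y i + d" "\<And>i j. i < n \<Longrightarrow> j < n \<Longrightarrow> up b i j = up y i j"
      using tri_diff_scalarD[OF b(2,1) y] by blast
    have "tri_diff (tri_add a b) (tri_add x y) \<in> tri_scalars n"
      using a(1) b(1) x y
      by (intro tri_diff_scalarI[where c = "c + d"]) (simp_all add: tri_ops[of _ n] c d add_ac)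
    then show ?thesis using a b x y by (simp add: tri_coset_eq_iff[OF n])
  qed
  then have "(\<Union>a\<in>tri_coset n sc x. \<Union>b\<in>tri_coset n sc y. tri_coset n sc (tri_add a b)) = tri_coset n sc (tri_add x y)"
    using tri_coset_nonempty[OF n x] tri_coset_nonempty[OF n y] by auto
  then show ?thesis by (simp add: lquot_def tri_lie_def)
qed

lemma tri_quot_scale:
  assumes n: "0 < n" and x: "x \<in> tri n"
  shows "lscale (tri_lie_quot n sc) c (tri_coset n sc x) = tri_coset n sc (tri_scale sc c x)"
proof -
  have "tri_coset n sc (tri_scale sc c a) = tri_coset n sc (tri_scale sc c x)"
    if "a \<in> tri_coset n sc x" for a
  proof -
    have a: "a \<in> tri n" "tri_diff a x \<in> tri_scalars n"
      using that by (simp_all add: mem_tri_coset[OF n x])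
    obtain d where d: "\<And>i. i < n \<Longrightarrow> dg a i = dg x i + d" "\<And>i j. i < n \<Longrightarrow> j < n \<Longrightarrow> up a i j = up x i j"
      using tri_diff_scalarD[OF a(2,1) x] by blast
    have "tri_diff (tri_scale sc c a) (tri_scale sc c x) \<in> tri_scalars n"
      using a(1) x by (intro tri_diff_scalarI[where c = "c * d"])
        (simp_all add: dg_scale[of _ n] up_scale[of _ n] d distrib_left)
    then show ?thesis using a x by (simp add: tri_coset_eq_iff[OF n])
  qed
  then have "(\<Union>a\<in>tri_coset n sc x. tri_coset n sc (tri_scale sc c a)) = tri_coset n sc (tri_scale sc c x)"
    using tri_coset_nonempty[OF n x] by auto
  then show ?thesis by (simp add: lquot_def tri_lie_def)
qed

text \<open>Scalars are central: the bracket itself, not only its coset, is independent of the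
  representatives.\<close>

lemma tri_quot_bracket:
  assumes n: "0 < n" and x: "x \<in> tri n" and y: "y \<in> tri n"
  shows "lbracket (tri_lie_quot n sc) (tri_coset n sc x) (tri_coset n sc y) = tri_coset n sc (tri_bracket n sc x y)"
proof -
  have "tri_bracket n sc a b = tri_bracket n sc x y"
    if ab: "a \<in> tri_coset n sc x" "b \<in> tri_coset n sc y" for a b
  proof -
    have a: "a \<in> tri n" "tri_diff a x \<in> tri_scalars n" and b: "b \<in> tri n" "tri_diff b y \<in> tri_scalars n"
      using ab by (simp_all add: mem_tri_coset[OF n x] mem_tri_coset[OF n y])
    obtain c where c: "\<And>i. i < n \<Longrightarrow> dg a i = dg x i + c" "\<And>i j. i < n \<Longrightarrow> j < n \<Longrightarrow> up a i j = up x i j"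
      using tri_diff_scalarD[OF a(2,1) x] by blast
    obtain d where d: "\<And>i. i < n \<Longrightarrow> dg b i = dg y i + d" "\<And>i j. i < n \<Longrightarrow> j < n \<Longrightarrow> up b i j = up y i j"
      using tri_diff_scalarD[OF b(2,1) y] by blast
    show ?thesis
      using a(1) b(1) x y
      by (intro tri_eqI[of _ n]) (simp_all add: dg_bracket[of _ n] up_bracket[of _ n] c d)
  qed
  then have "(\<Union>a\<in>tri_coset n sc x. \<Union>b\<in>tri_coset n sc y. tri_coset n sc (tri_bracket n sc a b))
      = tri_coset n sc (tri_bracket n sc x y)"
    using tri_coset_nonempty[OF n x] tri_coset_nonempty[OF n y] by auto
  then show ?thesis by (simp add: lquot_def tri_lie_def)
qed

lemma lcarrier_tri_quot: "lcarrier (tri_lie_quot n sc) = tri_coset n sc ` tri n"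
  by (simp add: lquot_def tri_lie_def)

end


text \<open>Sums, multiples and brackets of matrices with last diagonal entry 0 again have last
  entry 0. Both sides of each homomorphism law are therefore normalized representatives of one
  coset, and uniqueness makes them equal.\<close>

lemma ex_tri_lift:
  fixes sR :: "'f::{comm_ring, comm_monoid_mult} \<Rightarrow> 'r::{ring, monoid_mult} \<Rightarrow> 'r"
    and sS :: "'f \<Rightarrow> 's::{ring, monoid_mult} \<Rightarrow> 's"
  assumes "unital_algebra sR" and "unital_algebra sS" and faithful: "inj (\<lambda>c. sS c 1)" and n3: "3 \<le> n"
    and iso: "lie_iso (tri_lie_quot n sR) (tri_lie_quot n sS) \<phi>"
  obtains F where "tri_lift sR sS n F" "\<And>x. x \<in> tri n \<Longrightarrow> \<phi> (tri_coset n sR x) = tri_coset n sS (F x)"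
proof -
  interpret R: unital_algebra sR by fact
  interpret S: unital_algebra sS by fact
  let ?L = "tri_lie_quot n sR" and ?M = "tri_lie_quot n sS"
  let ?Z = "tri_of n (\<lambda>_. 0) (\<lambda>_ _. 0)"
  have n: "0 < n" using n3 by simp
  have bij: "bij_betw \<phi> (tri_coset n sR ` tri n) (tri_coset n sS ` tri n)"
    using iso by (simp add: lie_iso_def R.lcarrier_tri_quot S.lcarrier_tri_quot)
  have hom: "\<phi> (ladd ?L (tri_coset n sR x) (tri_coset n sR y)) = ladd ?M (\<phi> (tri_coset n sR x)) (\<phi> (tri_coset n sR y))"
    "\<phi> (lbracket ?L (tri_coset n sR x) (tri_coset n sR y)) = lbracket ?M (\<phi> (tri_coset n sR x)) (\<phi> (tri_coset n sR y))"
    "\<phi> (lscale ?L c (tri_coset n sR x)) = lscale ?M c (\<phi> (tri_coset n sR x))"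
    if "x \<in> tri n" "y \<in> tri n" for x y c
    using iso that unfolding lie_iso_def R.lcarrier_tri_quot S.lcarrier_tri_quot by blast+
  have uniq: "y = z" if yz: "y \<in> tri n" "z \<in> tri n" "dg y (n - 1) = 0" "dg z (n - 1) = 0"
    "tri_coset n sS y = tri_coset n sS z" for y z
  proof -
    obtain c where c: "\<And>i. i < n \<Longrightarrow> dg y i = dg z i + c" "\<And>i j. i < n \<Longrightarrow> j < n \<Longrightarrow> up y i j = up z i j"
      using S.tri_diff_scalarD[of y z n] yz S.tri_coset_eq_iff[OF n yz(1,2)] by blast
    have "c = 0" using c(1)[of "n - 1"] yz n by simp
    then show ?thesis using c yz by (intro tri_eqI[of _ n]) simp_all
  qed
  have norm: "\<exists>z\<in>tri n. dg z (n - 1) = 0 \<and> tri_coset n sS z = tri_coset n sS y" if y: "y \<in> tri n" for y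
  proof -
    \<comment> \<open>Subtracting the scalar matrix of the last diagonal entry stays in the
      coset.\<close>
    let ?z = "tri_of n (\<lambda>i. dg y i - dg y (n - 1)) (up y)"
    have "tri_diff ?z y \<in> tri_scalars n"
      using y by (intro S.tri_diff_scalarI[where c = "- dg y (n - 1)"]) simp_all
    then have "tri_coset n sS ?z = tri_coset n sS y" using y by (simp add: S.tri_coset_eq_iff[OF n])
    then show ?thesis using n by (intro bexI[of _ ?z]) simp_all
  qed
  have "\<forall>x\<in>tri n. \<exists>z. z \<in> tri n \<and> dg z (n - 1) = 0 \<and> \<phi> (tri_coset n sR x) = tri_coset n sS z"
  proof
    fix x :: "('f, 'r) tri" assume "x \<in> tri n"
    then have "\<phi> (tri_coset n sR x) \<in> tri_coset n sS ` tri n" using bij_betwE[OF bij] by blast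
    then obtain y where "y \<in> tri n" "\<phi> (tri_coset n sR x) = tri_coset n sS y" by blast
    then show "\<exists>z. z \<in> tri n \<and> dg z (n - 1) = 0 \<and> \<phi> (tri_coset n sR x) = tri_coset n sS z"
      using norm[of y] by metis
  qed
  from bchoice[OF this] obtain F where F: "\<And>x. x \<in> tri n \<Longrightarrow> F x \<in> tri n" "\<And>x. x \<in> tri n \<Longrightarrow> dg (F x) (n - 1) = 0"
    "\<And>x. x \<in> tri n \<Longrightarrow> \<phi> (tri_coset n sR x) = tri_coset n sS (F x)" by blast
  have F_eqI: "F x = z" if "x \<in> tri n" "z \<in> tri n" "dg z (n - 1) = 0" "\<phi> (tri_coset n sR x) = tri_coset n sS z" for x z
    using uniq[OF F(1) _ F(2)] that F(3) by simp
  have last: "n - 1 < n" using n by simp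
  have add: "F (tri_add x y) = tri_add (F x) (F y)" if "x \<in> tri n" "y \<in> tri n" for x y
  proof (rule F_eqI)
    show "\<phi> (tri_coset n sR (tri_add x y)) = tri_coset n sS (tri_add (F x) (F y))"
      using hom(1)[OF that] that F by (simp add: R.tri_quot_add[OF n] S.tri_quot_add[OF n])
  qed (use that F last in \<open>simp_all add: tri_ops[of _ n]\<close>)
  have scale: "F (tri_scale sR c x) = tri_scale sS c (F x)" if "x \<in> tri n" for x c
  proof (rule F_eqI)
    show "\<phi> (tri_coset n sR (tri_scale sR c x)) = tri_coset n sS (tri_scale sS c (F x))"
      using hom(3)[OF that that] that F by (simp add: R.tri_quot_scale[OF n] S.tri_quot_scale[OF n])
  qed (use that F last in \<open>simp_all add: S.dg_scale[of _ n]\<close>)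
  have bracket: "F (tri_bracket n sR x y) = tri_bracket n sS (F x) (F y)" if "x \<in> tri n" "y \<in> tri n" for x y
  proof (rule F_eqI)
    show "\<phi> (tri_coset n sR (tri_bracket n sR x y)) = tri_coset n sS (tri_bracket n sS (F x) (F y))"
      using hom(2)[OF that] that F by (simp add: R.tri_quot_bracket[OF n] S.tri_quot_bracket[OF n])
  qed (use that F last in \<open>simp_all add: S.dg_bracket[of _ n]\<close>)
  have "tri_scale sR 0 ?Z = ?Z" by (intro tri_eqI[of _ n]) (simp_all add: R.dg_scale[of _ n] R.up_scale[of _ n])
  then have "F ?Z = tri_scale sS 0 (F ?Z)" using scale[of ?Z 0] by simp
  also have "\<dots> = ?Z" using F(1)[of ?Z] by (intro tri_eqI[of _ n]) (simp_all add: S.dg_scale[of _ n] S.up_scale[of _ n])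
  finally have zero: "F ?Z = ?Z" .
  have coset_Z: "tri_coset n sR x = tri_coset n sR ?Z \<longleftrightarrow> x \<in> tri_scalars n" if x: "x \<in> tri n" for x
  proof -
    have "tri_diff x ?Z = x" using x by (intro tri_eqI[of _ n]) (simp_all add: tri_ops[of _ n])
    then show ?thesis using x by (simp add: R.tri_coset_eq_iff[OF n])
  qed
  have "tri_lift sR sS n F"
  proof unfold_locales
    show "3 \<le> n" "inj (\<lambda>c. sS c 1)" by fact+
    show "\<exists>x\<in>tri n. F x = z" if "z \<in> tri n" "dg z (n - 1) = 0" for z
    proof -
      have "tri_coset n sS z \<in> \<phi> ` (tri_coset n sR ` tri n)"
        using bij that by (simp add: bij_betw_def)
      then obtain x where "x \<in> tri n" "tri_coset n sS z = \<phi> (tri_coset n sR x)" by blast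
      then show ?thesis using F_eqI[of x z] that by auto
    qed
    show "x \<in> tri_scalars n" if "x \<in> tri n" "F x = ?Z" for x
    proof -
      have "\<phi> (tri_coset n sR x) = \<phi> (tri_coset n sR ?Z)" using F(3) that zero by simp
      then have "tri_coset n sR x = tri_coset n sR ?Z"
        using bij_betw_imp_inj_on[OF bij] that(1) by (auto dest: inj_onD)
      then show ?thesis using coset_Z[OF that(1)] by simp
    qed
    show "F x = ?Z" if "x \<in> tri_scalars n" for x
    proof -
      have x: "x \<in> tri n" using that n by (simp add: tri_scalars_iff)
      then have "\<phi> (tri_coset n sR x) = tri_coset n sS ?Z"
        using coset_Z[OF x] that F(3)[of ?Z] zero by simp
      then show ?thesis using x last by (intro F_eqI) simp_all
    qed
  qed (use F add scale bracket in auto)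
  then show ?thesis using that F(3) by blast
qed

text \<open>Conjugation keeps the diagonal, so the normalization survives, and conjugation by
  \<open>q'\<close> undoes it, so image and kernel do not change.\<close>

lemma tri_lift_conj:
  assumes "tri_lift sR sS n F" and q: "q \<in> UT n" "q' \<in> UT n" and inv: "mat_inverse_of n q q'"
  shows "tri_lift sR sS n (\<lambda>x. tri_conj n sS q (F x))"
proof -
  interpret tri_lift sR sS n F by fact
  note qc = UT_D(1)[OF q(1)] UT_D(1)[OF q(2)]
  interpret C: tri_conjugation sS n q q'
    by unfold_locales (use faithful q qc inv in auto)
  interpret C': tri_conjugation sS n q' q
    by unfold_locales (use faithful q qc mat_inverse_of_sym[OF qc(1) inv] in auto)
  have Z: "tri_of n (\<lambda>_. 0) (\<lambda>_ _. 0) \<in> (tri_scalars n :: ('a, 'c) tri set)"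
    using n_pos by (simp add: tri_scalars_iff)
  show ?thesis
  proof unfold_locales
    show "\<exists>x\<in>tri n. tri_conj n sS q (F x) = z" if "z \<in> tri n" "dg z (n - 1) = 0" for z
    proof -
      obtain x where x: "x \<in> tri n" "F x = tri_conj n sS q' z"
        using F_surj[of "tri_conj n sS q' z"] \<open>z \<in> tri n\<close> \<open>dg z (n - 1) = 0\<close> by auto
      then have "tri_conj n sS q (F x) = z" using C.conj_cancel[OF \<open>z \<in> tri n\<close> q(2)] by simp
      then show ?thesis using x(1) by blast
    qed
    show "x \<in> tri_scalars n" if "x \<in> tri n" "tri_conj n sS q (F x) = tri_of n (\<lambda>_. 0) (\<lambda>_ _. 0)" for x
    proof (rule F_ker[OF \<open>x \<in> tri n\<close>])
      have "F x = tri_conj n sS q' (tri_conj n sS q (F x))"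
        using C'.conj_cancel[OF _ q(1)] that(1) by simp
      also have "\<dots> = tri_of n (\<lambda>_. 0) (\<lambda>_ _. 0)" unfolding that(2) by (rule C'.conj_scalars[OF Z])
      finally show "F x = tri_of n (\<lambda>_. 0) (\<lambda>_ _. 0)" .
    qed
    show "tri_conj n sS q (F x) = tri_of n (\<lambda>_. 0) (\<lambda>_ _. 0)" if "x \<in> tri_scalars n" for x
      using F_scalars[OF that] C.conj_scalars[OF Z] by simp
  qed (use n3 faithful F_last in \<open>auto simp: F_add F_scale F_bracket C.conj_add C.conj_scale C.conj_bracket\<close>)
qed

lemma (in tri_lift) ex_graded_lift:
  obtains g g' where "g \<in> UT n" "g' \<in> UT n" "mat_inverse_of n g g'"
    "graded_lift sR sS n (\<lambda>x. tri_conj n sS g' (F x)) h"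
proof -
  \<comment> \<open>The inverse of the local permutation applied to the \<open>k\<close>-th unit
    vector. If \<open>n - 2 - k = k\<close>, the terms add up to \<open>h + (1 - h) = 1\<close>, so
    no case distinction is needed.\<close>
  define D where "D k = (diag_elt n (\<lambda>i. single k h i + single (n - 2 - k) (1 - h) i) :: ('f, 'r) tri)" for k
  have D [simp]: "D k \<in> tri n" for k by (simp add: D_def)
  have hh: "h * (1 - h) = 0" "(1 - h) * h = 0" "(1 - h) * (1 - h) = 1 - h"
    using h_idem by (simp_all add: algebra_simps)
  have gap_FD: "gap (F (D k)) j = single k 1 j" if k: "k < n - 1" and j: "j < n - 1" for k j
  proof -
    have gap_D: "gap (D k) i = single k h i + single (n - 2 - k) (1 - h) i" if "i < n - 1" for i
      unfolding D_def by (rule gap_diag_elt) (use that in simp)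
    have j': "n - 2 - j < n - 1" using n3 by simp
    have "gap (F (D k)) j = h * (single k h j + single (n - 2 - k) (1 - h) j)
        + (1 - h) * (single k h (n - 2 - j) + single (n - 2 - k) (1 - h) (n - 2 - j))"
      unfolding gap_F_eq[OF D j] gap_D[OF j] gap_D[OF j'] ..
    also have "\<dots> = h * single k h j + (1 - h) * single (n - 2 - k) (1 - h) (n - 2 - j)"
      by (simp add: distrib_left single_def hh)
    also have "\<dots> = single k 1 j"
    proof (cases "j = k")
      case True then show ?thesis by (simp add: single_def h_idem hh)
    next
      case False
      then have "n - 2 - j \<noteq> n - 2 - k" using j k by auto
      then show ?thesis using False by (simp add: single_def)
    qed
    finally show ?thesis .
  qed
  have dg_FD: "dg (F (D k)) i = (if i \<le> k then 1 else 0)" if k: "k < n - 1" and i: "i < n" for k i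
  proof -
    let ?d = "diag_elt n (single k 1) :: ('f, 's) tri"
    have "dg (F (D k)) i - dg ?d i = dg (F (D k)) (n - 1) - dg ?d (n - 1)"
      by (rule gap_eq_imp_dg_diff_const) (use gap_FD[OF k] i in auto)
    then have "dg (F (D k)) i = (\<Sum>l\<in>{i..<n - 1}. single k 1 l)"
      using i n_pos F_last[OF D] by simp
    then show ?thesis using k by (simp add: single_def)
  qed
  define X where "X k = tri_embed n sS (F (D k))" for k
  have "\<exists>g\<in>UT n. \<forall>k<n - 1. X k * g = g * step_diag n k"
  proof (rule simultaneous_diagonalization)
    fix k assume k: "k < n - 1"
    show "X k \<in> carrier_mat n n" by (simp add: X_def)
    show "upper_triangular (X k)"
      using up_lower[OF F_in[OF D]] by (auto simp: X_def tri_embed_def)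
    show "X k $$ (i, i) = (if i \<le> k then 1 else 0)" if "i < n" for i
      using that dg_FD[OF k that] by (simp add: X_def tri_embed_index S.sc_one)
    fix l assume l: "l < n - 1"
    have "tri_bracket n sR (D k) (D l) = tri_of n (\<lambda>_. 0) (\<lambda>_ _. 0)"
      by (intro tri_eqI[of _ n]) (simp_all add: R.dg_bracket[of _ n] R.up_bracket[of _ n], simp add: D_def)
    then have "tri_bracket n sS (F (D k)) (F (D l)) = tri_of n (\<lambda>_. 0) (\<lambda>_ _. 0)"
      by (simp add: F_bracket[symmetric] F_zero)
    then have "X k * X l - X l * X k = tri_embed n sS (tri_of n (\<lambda>_. 0) (\<lambda>_ _. 0))"
      by (simp add: X_def S.tri_embed_bracket[symmetric])
    then have 0: "(X k * X l - X l * X k) $$ (i, j) = 0" if "i < n" "j < n" for i j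
      using that by (simp add: tri_embed_index)
    have c: "X k * X l \<in> carrier_mat n n" "X l * X k \<in> carrier_mat n n"
      unfolding X_def by (rule mult_carrier_mat[OF tri_embed_carrier tri_embed_carrier])+
    show "X k * X l = X l * X k"
    proof (rule eq_matI)
      fix i j assume "i < dim_row (X l * X k)" "j < dim_col (X l * X k)"
      then have ij: "i < n" "j < n" using c by auto
      then show "(X k * X l) $$ (i, j) = (X l * X k) $$ (i, j)"
        using 0[OF ij] carrier_matD[OF c(2)] by (simp del: index_mult_mat)
    qed (simp_all only: carrier_matD[OF c(1)] carrier_matD[OF c(2)])
  qed
  then obtain g where g: "g \<in> UT n" and Xg: "\<And>k. k < n - 1 \<Longrightarrow> X k * g = g * step_diag n k" by blast
  obtain g' where g': "g' \<in> UT n" and inv: "mat_inverse_of n g g'" by (rule UT_inverse[OF g])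
  note gc = UT_D(1)[OF g] UT_D(1)[OF g'] and gg = mat_inverse_ofD[OF inv]
  let ?F = "\<lambda>x. tri_conj n sS g' (F x)"
  interpret T: tri_lift sR sS n ?F
    by (rule tri_lift_conj[OF tri_lift_axioms g' g mat_inverse_of_sym[OF gc(1) inv]])
  interpret C: tri_conjugation sS n g' g
    by unfold_locales (use faithful g' gc mat_inverse_of_sym[OF gc(1) inv] in auto)
  have FD: "?F (D k) = diag_elt n (single k 1)" if k: "k < n - 1" for k
  proof (rule C.conj_eqI)
    have "g' * X k * g = g' * (X k * g)"
      using gc by (simp add: X_def assoc_mult_mat[of _ n n _ n _ n])
    also have "\<dots> = g' * g * step_diag n k"
      unfolding Xg[OF k] using gc by (simp add: assoc_mult_mat[of _ n n _ n _ n])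
    also have "\<dots> = step_diag n k" unfolding gg(3) by (rule one_mult_mat[OF step_diag_carrier])
    also have "\<dots> = tri_embed n sS (diag_elt n (single k 1))"
      using k by (intro eq_matI) (auto simp: tri_embed_def S.sc_one single_def)
    finally show "g' * tri_embed n sS (F (D k)) * g = tri_embed n sS (diag_elt n (single k 1))"
      by (simp add: X_def)
  qed simp_all
  have "h * (single k h i + single (n - 2 - k) (1 - h) i) = single k h i"
    "(1 - h) * (single k h i + single (n - 2 - k) (1 - h) i) = single (n - 2 - k) (1 - h) i" for k i
    by (simp_all add: distrib_left single_def hh h_idem)
  \<comment> \<open>Multiplication by the two idempotents separates the parts of \<open>D k\<close>.
    For \<open>1 - h\<close> the index is reflected, which is why \<open>D (n - 2 - k)\<close> is
    used below.\<close>
  then have D_scale: "tri_scale sR h (D k) = diag_elt n (single k h)"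
    "tri_scale sR (1 - h) (D k) = diag_elt n (single (n - 2 - k) (1 - h))" for k
    unfolding D_def R.diag_elt_scale by simp_all
  have "graded_lift sR sS n ?F h"
  proof unfold_locales
    show "h * h = h" by (rule h_idem)
    show "?F (diag_elt n (single k h)) = diag_elt n (single k h)" if "k < n - 1" for k
      unfolding D_scale(1)[symmetric] T.F_scale[OF D] FD[OF that] S.diag_elt_single_scale mult_1_left ..
    show "?F (diag_elt n (single k (1 - h))) = diag_elt n (single (n - 2 - k) (1 - h))"
      if k: "k < n - 1" for k
    proof -
      have k': "n - 2 - k < n - 1" "n - 2 - (n - 2 - k) = k" using k by auto
      have "?F (diag_elt n (single k (1 - h))) = ?F (tri_scale sR (1 - h) (D (n - 2 - k)))"
        unfolding D_scale(2) k'(2) ..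
      then show ?thesis unfolding T.F_scale[OF D] FD[OF k'(1)] S.diag_elt_single_scale mult_1_left .
    qed
  qed
  then show ?thesis using that g g' inv by blast
qed

lemma mat_diag_mult:
  fixes A :: "'s::{ring, monoid_mult} mat"
  assumes A: "A \<in> carrier_mat n n" and ij: "i < n" "j < n"
  shows "(mat_diag n u * A) $$ (i, j) = u i * A $$ (i, j)" "(A * mat_diag n u) $$ (i, j) = A $$ (i, j) * u j"
proof -
  have D: "mat_diag n u \<in> carrier_mat n n" by (simp add: mat_diag_def)
  have "(mat_diag n u * A) $$ (i, j) = (\<Sum>k<n. mat_diag n u $$ (i, k) * A $$ (k, j))"
    by (rule mult_mat_entry[OF D A ij])
  also have "\<dots> = (\<Sum>k<n. if k = i then u i * A $$ (i, j) else 0)"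
    using ij by (intro sum.cong) (auto simp: mat_diag_def)
  finally show "(mat_diag n u * A) $$ (i, j) = u i * A $$ (i, j)" using ij by simp
  have "(A * mat_diag n u) $$ (i, j) = (\<Sum>k<n. A $$ (i, k) * mat_diag n u $$ (k, j))"
    by (rule mult_mat_entry[OF A D ij])
  also have "\<dots> = (\<Sum>k<n. if k = j then A $$ (i, j) * u j else 0)"
    using ij by (intro sum.cong) (auto simp: mat_diag_def)
  finally show "(A * mat_diag n u) $$ (i, j) = A $$ (i, j) * u j" using ij by simp
qed

lemma mat_diag_units:
  fixes u v :: "nat \<Rightarrow> 's::{ring, monoid_mult}"
  assumes "\<And>i. i < n \<Longrightarrow> u i * v i = 1 \<and> v i * u i = 1"
  shows "mat_diag n u \<in> Diag_units n" "mat_inverse_of n (mat_diag n u) (mat_diag n v)"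
proof -
  show "mat_diag n u \<in> Diag_units n" using assms by (auto simp: Diag_units_def)
  have D: "mat_diag n w \<in> carrier_mat n n" for w :: "nat \<Rightarrow> 's" by (simp add: mat_diag_def)
  have "mat_diag n a * mat_diag n b = 1\<^sub>m n" if ab: "\<And>i. i < n \<Longrightarrow> a i * b i = 1" for a b :: "nat \<Rightarrow> 's"
  proof (rule eq_matI)
    fix i j assume "i < dim_row (1\<^sub>m n :: 's mat)" "j < dim_col (1\<^sub>m n :: 's mat)"
    then have ij: "i < n" "j < n" by auto
    show "(mat_diag n a * mat_diag n b) $$ (i, j) = 1\<^sub>m n $$ (i, j)"
      unfolding mat_diag_mult(1)[OF D ij] using ij ab by (auto simp: mat_diag_def)
  qed (auto simp: mat_diag_def)
  then show "mat_inverse_of n (mat_diag n u) (mat_diag n v)"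
    using assms D by (auto simp: mat_inverse_of_def)
qed

lemma (in unital_algebra) orthogonal_mult:
  assumes "a * b = 0" "x \<in> range (sc a)" "y \<in> range (sc b)"
  shows "x * y = 0"
proof -
  obtain x' y' where "x = sc a x'" "y = sc b y'" using assms by blast
  then have "x * y = sc a (sc b (x' * y'))"
    by (simp only: sc_mult_left[symmetric]) (simp only: sc_mult_right[symmetric])
  also have "\<dots> = sc (a * b) (x' * y')" by (rule sc_sc)
  finally show ?thesis using assms by simp
qed

theorem theorem1:
  fixes sR :: "'f::{comm_ring, comm_monoid_mult} \<Rightarrow> 'r::{ring, monoid_mult} \<Rightarrow> 'r"
    and sS :: "'f \<Rightarrow> 's::{ring, monoid_mult} \<Rightarrow> 's"
    and n :: nat
    and \<phi> :: "('f, 'r) tri set \<Rightarrow> ('f, 's) tri set"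
  assumes "unital_algebra sR" and "unital_algebra sS"
    and "inj (\<lambda>c. sR c 1)" and "inj (\<lambda>c. sS c 1)"
    and "n \<ge> 3"
    and "lie_iso (tri_lie_quot n sR) (tri_lie_quot n sS) \<phi>"
  shows "\<exists>h \<psi>\<^sub>1 \<psi>\<^sub>2 g\<^sub>1 g\<^sub>2.
    h * h = h \<and>
    alg_iso_on sR sS h \<psi>\<^sub>1 \<and>
    alg_antiiso_on sR sS (1 - h) \<psi>\<^sub>2 \<and>
    g\<^sub>1 \<in> UT n \<and> g\<^sub>1 \<in> mat_units n \<and>
    g\<^sub>2 \<in> Diag_units n \<and> g\<^sub>2 \<in> mat_units n \<and>
    (\<forall>x\<in>tri n.
       \<phi> (tri_coset n sR x) =
       tri_coset n sS
         (tri_conj n sS g\<^sub>1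
           (tri_conj n sS g\<^sub>2
             (tri_diff (tri_map \<psi>\<^sub>1 (tri_scale sR h x))
                       (tri_antimap n \<psi>\<^sub>2 (tri_scale sR (1 - h) x))))))"
proof -
  obtain F where lift: "tri_lift sR sS n F"
    and \<phi>: "\<And>x. x \<in> tri n \<Longrightarrow> \<phi> (tri_coset n sR x) = tri_coset n sS (F x)"
    using ex_tri_lift[OF assms(1,2,4,5,6)] by blast
  interpret F: tri_lift sR sS n F by (rule lift)
  obtain g g' where g: "g \<in> UT n" "g' \<in> UT n" and inv: "mat_inverse_of n g g'"
    and graded: "graded_lift sR sS n (\<lambda>x. tri_conj n sS g' (F x)) F.h"
    by (rule F.ex_graded_lift)
  let ?F = "\<lambda>x. tri_conj n sS g' (F x)"
  define e where "e = F.h"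
  interpret G: graded_lift sR sS n ?F e unfolding e_def by (rule graded)
  note gc = UT_D(1)[OF g(1)]
  interpret C: tri_conjugation sS n g g'
    by unfold_locales (use assms(4) g gc inv in auto)
  have n: "0 < n" using assms(5) by simp
  have ee': "e * (1 - e) = 0" "(1 - e) * e = 0" using G.e by (simp_all add: algebra_simps)
  obtain \<psi>1 d1 d1' where bij1: "bij_betw \<psi>1 (range (sR e)) (range (sS e))"
    and lin1: "\<And>a b. \<psi>1 (a + b) = \<psi>1 a + \<psi>1 b" "\<And>c a. \<psi>1 (sR c a) = sS c (\<psi>1 a)"
    and mult1: "\<And>a b. \<psi>1 (a * b) = \<psi>1 a * \<psi>1 b" and cut1: "\<And>a. \<psi>1 (sR e a) = \<psi>1 a"
    and d1: "\<And>i. i < n \<Longrightarrow> d1 i \<in> range (sS e) \<and> d1' i \<in> range (sS e)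
      \<and> d1 i * d1' i = sS e 1 \<and> d1' i * d1 i = sS e 1"
    and f: "\<And>i j a. i < j \<Longrightarrow> j < n \<Longrightarrow> G.iso_part i j a = d1 i * \<psi>1 a * d1' j"
    using multiplicative_family[OF assms(1,2) G.e assms(5), where mu = "(*)" and f = G.iso_part,
        OF mult_1_right mult_1_left G.iso_part_add G.iso_part_scale G.iso_part_bij G.iso_part_cut G.iso_part_mult] by blast
  \<comment> \<open>\<open>anti_part\<close> is a multiplicative family for the opposite
    multiplication of R; so \<open>\<psi>2\<close> reverses products.\<close>
  obtain \<psi>2 d2 d2' where bij2: "bij_betw \<psi>2 (range (sR (1 - e))) (range (sS (1 - e)))"
    and lin2: "\<And>a b. \<psi>2 (a + b) = \<psi>2 a + \<psi>2 b" "\<And>c a. \<psi>2 (sR c a) = sS c (\<psi>2 a)"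
    and mult2: "\<And>a b. \<psi>2 (b * a) = \<psi>2 a * \<psi>2 b" and cut2: "\<And>a. \<psi>2 (sR (1 - e) a) = \<psi>2 a"
    and d2: "\<And>i. i < n \<Longrightarrow> d2 i \<in> range (sS (1 - e)) \<and> d2' i \<in> range (sS (1 - e))
      \<and> d2 i * d2' i = sS (1 - e) 1 \<and> d2' i * d2 i = sS (1 - e) 1"
    and g_eq: "\<And>i j a. i < j \<Longrightarrow> j < n \<Longrightarrow> G.anti_part i j a = d2 i * \<psi>2 a * d2' j"
    using multiplicative_family[OF assms(1,2) G.e' assms(5), where mu = "\<lambda>a b. b * a" and f = G.anti_part,
        OF mult_1_left mult_1_right G.anti_part_add G.anti_part_scale G.anti_part_bij G.anti_part_cut G.anti_part_mult] by blast
  \<comment> \<open>Units of the complementary ideals e S and (1 - e) S add up to a unit of S: mixed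
    products vanish and the two identities sum to 1.\<close>
  define u where "u i = d1 i + d2 i" for i
  define v where "v i = d1' i + d2' i" for i
  let ?g2 = "mat_diag n u"
  have \<psi>1_range: "\<psi>1 a \<in> range (sS e)" for a
    using lin1(2)[of e a] cut1[of a] by (metis rangeI)
  have \<psi>2_range: "\<psi>2 a \<in> range (sS (1 - e))" for a
    using lin2(2)[of "1 - e" a] cut2[of a] by (metis rangeI)
  note orth = F.S.orthogonal_mult[OF ee'(1)] F.S.orthogonal_mult[OF ee'(2)]
  have uv: "u i * v i = 1 \<and> v i * u i = 1" if i: "i < n" for i
  proof -
    have "sS e 1 + sS (1 - e) 1 = 1" by (simp add: F.S.sc_add_left[symmetric] F.S.sc_one)
    then show ?thesis
      using d1[OF i] d2[OF i] orth by (simp add: u_def v_def distrib_left distrib_right)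
  qed
  have g2: "?g2 \<in> Diag_units n" "mat_inverse_of n ?g2 (mat_diag n v)"
    by (rule mat_diag_units, rule uv, assumption)+
  have g2c: "?g2 \<in> carrier_mat n n" "mat_diag n v \<in> carrier_mat n n" by (simp_all add: mat_diag_def)
  interpret C2: tri_conjugation sS n ?g2 "mat_diag n v"
    by unfold_locales (use assms(4) g2 g2c in auto)
  let ?W = "\<lambda>x. tri_diff (tri_map \<psi>1 (tri_scale sR e x)) (tri_antimap n \<psi>2 (tri_scale sR (1 - e) x))"
  have \<psi>0: "\<psi>1 0 = 0" "\<psi>2 0 = 0" using lin1(2)[of 0 0] lin2(2)[of 0 0] by simp_all
  have main: "tri_diff (?F x) (tri_conj n sS ?g2 (?W x)) \<in> tri_scalars n" and W_in: "?W x \<in> tri n"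
    if x: "x \<in> tri n" for x
  proof -
    have m: "tri_map \<psi>1 (tri_scale sR e x) \<in> tri n"
      using F.R.tri_scale_in[OF x, of e] \<psi>0 by (auto simp: tri_map_def tri_def)
    have a: "tri_antimap n \<psi>2 (tri_scale sR (1 - e) x) \<in> tri n"
      using up_lower[OF F.R.tri_scale_in[OF x, of "1 - e"]] \<psi>0 by (auto simp: tri_antimap_def tri_def)
    show W: "?W x \<in> tri n" using m a by simp
    have upm: "up (tri_map \<psi>1 (tri_scale sR e x)) p q = \<psi>1 (up x p q)" if "p < n" "q < n" for p q
      using that F.R.tri_scale_in[OF x, of e] cut1 by (simp add: tri_map_def tri_dim[of _ n] F.R.up_scale[OF x])
    have upa: "up (tri_antimap n \<psi>2 (tri_scale sR (1 - e) x)) p q = \<psi>2 (up x (n - 1 - q) (n - 1 - p))"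
      if "p < n" "q < n" for p q
      using that cut2 by (simp add: tri_antimap_def F.R.up_scale[OF x])
    have dgW: "dg (?W x) i = e * dg x i - (1 - e) * dg x (n - 1 - i)" if "i < n" for i
      using that dg_diff[OF m a that] F.R.dg_scale[OF x] by (simp add: tri_map_def tri_antimap_def)
    have upW: "up (?W x) p q = \<psi>1 (up x p q) - \<psi>2 (up x (n - 1 - q) (n - 1 - p))" if "p < n" "q < n" for p q
      using up_diff[OF m a that] upm[OF that] upa[OF that] by simp
    \<comment> \<open>Reflection exchanges the order of consecutive diagonal entries and so negates
      gaps; the minus sign of the second summand compensates for this.\<close>
    have gap: "gap (?F x) k = gap (?W x) k" if k: "Suc k < n" for k
    proof -
      have k': "k < n - 1" and eq: "n - 1 - Suc k = n - 2 - k" "n - 1 - k = Suc (n - 2 - k)" using k by auto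
      have "gap (?F x) k = e * gap x k + (1 - e) * gap x (n - 2 - k)"
        using F.gap_F_eq[OF x k'] by (simp add: gap_def e_def)
      also have "\<dots> = gap (?W x) k"
        using k dgW[of k] dgW[of "Suc k"] unfolding gap_def eq by (simp add: right_diff_distrib)
      finally show ?thesis .
    qed
    \<comment> \<open>Equal gaps leave a scalar undetermined: the last entry of \<open>?F x\<close>
      is 0, that of \<open>?W x\<close> need not be.\<close>
    define c where "c = dg (?F x) (n - 1) - dg (?W x) (n - 1)"
    show "tri_diff (?F x) (tri_conj n sS ?g2 (?W x)) \<in> tri_scalars n"
    proof (rule F.S.tri_diff_scalarI[where c = c])
      fix i assume i: "i < n"
      have "dg (?F x) i - dg (?W x) i = c"
        unfolding c_def by (rule gap_eq_imp_dg_diff_const[OF gap i])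
      then show "dg (?F x) i = dg (tri_conj n sS ?g2 (?W x)) i + c" by (simp add: algebra_simps)
    next
      fix p q assume pq: "p < q" "q < n"
      then have pn: "p < n" by simp
      let ?a = "\<psi>1 (up x p q)" and ?b = "\<psi>2 (up x (n - 1 - q) (n - 1 - p))"
      have "up (tri_conj n sS ?g2 (?W x)) p q = tri_embed n sS (tri_conj n sS ?g2 (?W x)) $$ (p, q)"
        using pq pn by (simp add: tri_embed_index)
      also have "\<dots> = (?g2 * tri_embed n sS (?W x) * mat_diag n v) $$ (p, q)"
        unfolding C2.embed_conj[OF W] ..
      also have "\<dots> = u p * up (?W x) p q * v q"
        using pq unfolding mat_diag_mult(2)[OF mult_carrier_mat[OF g2c(1) tri_embed_carrier] pn pq(2)]
          mat_diag_mult(1)[OF tri_embed_carrier pn pq(2)] by (simp add: tri_embed_index)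
      also have "\<dots> = u p * (?a - ?b) * v q" unfolding upW[OF pn pq(2)] ..
      also have "u p * (?a - ?b) = d1 p * ?a - d2 p * ?b"
        using d1[OF pn] d2[OF pn] orth \<psi>1_range \<psi>2_range by (simp add: u_def distrib_right right_diff_distrib)
      also have "\<dots> * v q = d1 p * ?a * d1' q - d2 p * ?b * d2' q"
        using d1[OF pn] d2[OF pn] d1[OF pq(2)] d2[OF pq(2)] orth
          F.S.range_sc_mult[of "d1 p" e ?a] F.S.range_sc_mult[of "d2 p" "1 - e" ?b]
        by (simp add: v_def distrib_left left_diff_distrib)
      also have "\<dots> = up (?F x) p q"
        using G.up_F_split[OF x pq] f[OF pq] g_eq[OF pq] by simp
      finally show "up (?F x) p q = up (tri_conj n sS ?g2 (?W x)) p q" by simp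
    qed (use x W in simp_all)
  qed
  have "\<phi> (tri_coset n sR x) = tri_coset n sS (tri_conj n sS g (tri_conj n sS ?g2 (?W x)))"
    if x: "x \<in> tri n" for x
  proof -
    let ?y = "tri_conj n sS ?g2 (?W x)" and ?s = "tri_diff (?F x) (tri_conj n sS ?g2 (?W x))"
    have y: "?y \<in> tri n" using W_in[OF x] by simp
    have s: "?s \<in> tri n" using x y by simp
    \<comment> \<open>The scalar error \<open>?s\<close> is fixed by conjugation, so it is unchanged
      when the conjugation by \<open>g'\<close> is undone.\<close>
    have "?F x = tri_add ?y ?s" using x y by (intro tri_eqI[of _ n]) (simp_all add: tri_ops[of _ n])
    then have "tri_conj n sS g (?F x) = tri_add (tri_conj n sS g ?y) ?s"
      using C.conj_add[OF y s] C.conj_scalars[OF main[OF x]] by simp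
    then have Fx: "F x = tri_add (tri_conj n sS g ?y) ?s"
      using C.conj_cancel[OF _ g(2)] x by simp
    have "tri_diff (tri_add a b) a = b" if "a \<in> tri n" "b \<in> tri n" for a b :: "('f, 's) tri"
      using that by (intro tri_eqI[of _ n]) (simp_all add: tri_ops[of _ n])
    from this[OF tri_conj_in[OF y, of sS g] s] have "tri_diff (F x) (tri_conj n sS g ?y) = ?s"
      unfolding Fx[symmetric] .
    then show ?thesis
      using \<phi>[OF x] main[OF x] x y by (simp add: F.S.tri_coset_eq_iff[OF n])
  qed
  moreover have "alg_iso_on sR sS e \<psi>1"
    using bij1 lin1 mult1 by (simp add: alg_iso_on_def)
  moreover have "alg_antiiso_on sR sS (1 - e) \<psi>2"
    using bij2 lin2 mult2 by (simp add: alg_antiiso_on_def)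
  moreover have "g \<in> mat_units n" "?g2 \<in> mat_units n"
    using mat_inv_eq(1)[OF gc inv] mat_inv_eq(1)[OF g2c(1) g2(2)] by auto
  ultimately show ?thesis using G.e g(1) g2(1) by blast
qed

end
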